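(* Let $S$ and $T$ be computable metric spaces, let $\mu\in\mathcal M_1(S\times T)$ be computable, let $\mu_T$ be its projection (pushforward) onto $T$, let $V$ be a class of Borel subsets of $T$ consisting of $\mu_T$-continuity sets and having the strong Vitali covering property with respect to $\mu_T$, and assume that $\mathrm D^\star_{S,T}(\mu,V)$ is total. Then there exists a computable map $K:T\to\mathcal C(\mathbb N,\mathcal M_1(S))$ such that $$\mathrm D^\star_{S,T}(\mu,V)=\mathrm{Lim}_{\mathcal M_1(S)}\circ K .$$ In particular, $\mathrm D^\star_{S,T}(\mu,V)\le_{\mathrm{sW}}\mathrm{Lim}_{\mathcal M_1(S)}$.
   Context: **Represented spaces.** A represented space is a set $X$ with a partial surjection $\delta_X:\subseteq\mathbb N^{\mathbb N}\to X$; $p$ is a name of $\delta_X(p)$. A realizer of a partial multi-valued function $f:\subseteq X\rightrightarrows Y$ is a partial $F:\subseteq\mathbb N^{\mathbb N}\to\mathbb N^{\mathbb N}$ with $\delta_Y(F(p))\in f(\delta_X(p))$ for all $p$ in the domain of $f\circ\delta_X$; write $F\vdash f$. $f$ is continuous (computable) if it has a continuous (computable) realizer. Subsets carry the restricted representation, products the product representation. $\mathcal C(X,Y)$ is the represented space of continuous maps $X\to Y$ (in the sense of realizers): $0^n1p$ is a name of $f$ iff the $n$-th oracle Turing machine with oracle $p$ computes a realizer of $f$. $\mathbb N$ is represented by $0^n10^\omega\mapsto n$; Sierpinski space $\mathbb S=\{0,1\}$ by $\delta(0^\omega)=0$, $\delta(p)=1$ for $p\ne0^\omega$; $\mathcal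 O(X)$, the space of open sets, is $\mathcal C(X,\mathbb S)$ with $f$ representing $f^{-1}(1)$; $\mathbb R$ has its standard (Cauchy) representation. **Computable metric spaces.** $X$ is admissible if, for every represented $Y$, the map $f\mapsto f^{-1}$ from $\mathcal C(Y,X)$ to $\mathcal C(\mathcal O(X),\mathcal O(Y))$ has a well-defined continuous partial inverse. A computable metric space is a complete separable metric space $(S,d_S)$ with an admissible representation and a computable dense sequence $s\in\mathcal C(\mathbb N,S)$ such that the following are computable: $d_S:S\times S\to\mathbb R$; the limit map on sequences $(r_n)$ with $d_S(r_n,r_{n+1})<2^{-n}$ for all $n$; and the map taking $(m_n,q_n)_n\in\mathcal C(\mathbb N,\mathbb N\times\mathbb Q)$ to $\bigcup_n\{x:d_S(x,s(m_n))<q_n\}\in\mathcal O(S)$, the last also having a computable multi-valued inverse. $S\times T$ is a computable metric space in the standard way. $\mathcal M_1(S)$ is the space of Borel probability measures with the weak topology; for a computable metric space $S$ it is a computable metric space under the Prokhorov metric, with dense set the finite convex combinations with positive rational weights of Dirac measures at points of the dense sequence. **Continuity sets.** A Borel set $E$ is a $\nu$-continuity set if $\nu(\partial E)=0$. $\mathcal O_\nu(T)$ is the represented space of open $\nu$-continuity sets $U$ in $T$: a name of $U$ is a pair $(u,v)$ where $u$ is a name of $U$ in $\mathcal O(T)$ and $v$ is a name in $\mathcal O(T)$ of some open $W\subseteq T\setminus U$ with $\nu(W)=\nu(T\setminus U)$. **Vitali notions.** Let $\nu$ be a probability measure on a separable metric space $T$. A sequence $(E_n)$ of Borel sets converges regularly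 to $x$ (with respect to $\nu$) if there are closed balls $B_n$ of radii $r_n\to0$ with $x\in E_n\subseteq B_n$ for all $n$ and an $\alpha>0$ with $\nu(E_n)\ge\alpha\,\nu(B_n)$ for all $n$. A class $W$ of Borel sets is a Vitali cover of a Borel set $F$ if for every $x\in F$ some sequence of elements of $W$ converges regularly to $x$. A class $V$ of Borel sets has the Vitali covering property (with respect to $\nu$) if for every Borel $F$ (1) some $W\subseteq V$ is a Vitali cover of $F$, and (2) for every Vitali cover $W\subseteq V$ of $F$ there is a countable collection of pairwise disjoint sets $F_n\in W$ with $\nu(F\setminus\bigcup_nF_n)=0$. For a computable metric space $T$, a class $V$ of $\nu$-continuity sets has the strong Vitali covering property with respect to $\nu$ if it has the Vitali covering property with respect to $\nu$ and there is a multi-valued map $U:T\rightrightarrows\mathcal C(\mathbb N,\mathcal O_\nu(T))$, computable relative to $\nu$, such that for every $x\in T$ (and every output $U(x)$) there is a sequence $(E_n)$ of elements of $V$ converging regularly to $x$ with respect to $\nu$ with $U(x)(n)\subseteq E_n$ and $\nu(U(x)(n))=\nu(E_n)$ for every $n$. **The map $\mathrm D^\star_{S,T}(\mu,V)$.** For $t\in T$, $\mathrm D^\star_{S,T}(\mu,V)(t)$ is the probability measure on $S$ given by $$A\mapsto\lim_{n\to\infty}\frac{\mu(A\times E_n)}{\mu(S\times E_n)}\qquad(A\subseteq S\text{ Borel}),$$ where $(E_n)$ is any sequence of elements of $V$ converging regularly to $t$ with respect to $\mu_T$. It is total if for every $t\in T$ and every Borel $A\subseteq S$ these quotients are defined for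 all large $n$ and the limit exists and is independent of the choice of $(E_n)$. **Lim and reducibility.** $\mathrm{Lim}_X:\subseteq\mathcal C(\mathbb N,X)\to X$ takes convergent Cauchy sequences (no rate of convergence given) in a metric space $X$ to their limits. $f\le_{\mathrm{sW}}g$ means there are computable partial $H,K:\subseteq\mathbb N^{\mathbb N}\to\mathbb N^{\mathbb N}$ such that for every $G\vdash g$, $H\circ G\circ K\vdash f$. *)

theory Defs
  imports "HOL-Probability.Probability"
begin

section \<open>Computability on Baire space\<close>

type_synonym baire = "nat \<Rightarrow> nat"

text \<open>
  Computability relative to an oracle is rendered by the partial recursive functions with an oracle,
  acting on single natural numbers: tuples are coded by \<^const>\<open>prod_encode\<close>. In \<open>Rec f g\<close> and
  \<open>Mu f\<close> the recursion, respectively search, variable is the second component of the coded argument.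
\<close>

datatype prog =
    Zero | Succ | Fst | Snd | Oracle
  | Pair prog prog | Comp prog prog | Rec prog prog | Mu prog

inductive eval :: "baire \<Rightarrow> prog \<Rightarrow> nat \<Rightarrow> nat \<Rightarrow> bool" for p :: baire where
  "eval p Zero x 0"
| "eval p Succ x (Suc x)"
| "eval p Fst x (fst (prod_decode x))"
| "eval p Snd x (snd (prod_decode x))"
| "eval p Oracle x (p x)"
| "eval p f x a \<Longrightarrow> eval p g x b \<Longrightarrow> eval p (Pair f g) x (prod_encode (a, b))"
| "eval p g x y \<Longrightarrow> eval p f y z \<Longrightarrow> eval p (Comp f g) x z"
| "eval p f x y \<Longrightarrow> eval p (Rec f g) (prod_encode (x, 0)) y"
| "eval p (Rec f g) (prod_encode (x, n)) y \<Longrightarrow>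
     eval p g (prod_encode (x, prod_encode (n, y))) z \<Longrightarrow>
     eval p (Rec f g) (prod_encode (x, Suc n)) z"
| "eval p f (prod_encode (x, n)) 0 \<Longrightarrow>
     (\<And>m. m < n \<Longrightarrow> \<exists>y. eval p f (prod_encode (x, m)) (Suc y)) \<Longrightarrow>
     eval p (Mu f) x n"

lemma eval_functional: "eval p e x y \<Longrightarrow> eval p e x z \<Longrightarrow> y = z"
proof (induction arbitrary: z rule: eval.induct)
  case (10 f x n)
  from 10(4) obtain
    z0: "eval p f (prod_encode (x, z)) 0" and
    zl: "\<And>m. m < z \<Longrightarrow> \<exists>y. eval p f (prod_encode (x, m)) (Suc y)"
    by (cases rule: eval.cases) auto
  show ?case
  proof (rule linorder_cases[of n z])
    assume "n < z"
    with zl[of n] 10(2) show ?thesis by blast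
  next
    assume "z < n"
    with 10(3)[of z] z0 show ?thesis by blast
  qed
next
  case (6 f x a g b)
  from 6(5) show ?case by cases (use 6 in blast)
next
  case (7 g x y f w)
  from 7(5) show ?case by cases (use 7 in blast)
next
  case (8 f x y g)
  from "8.prems" show ?case by cases (simp_all add: "8.IH")
next
  case (9 f g x n y w)
  from "9.prems" show ?case
  proof cases
    case (9 x' n' y')
    then have y: "eval p (Rec f g) (prod_encode (x, n)) y'"
      and z: "eval p g (prod_encode (x, prod_encode (n, y'))) z" by simp_all
    from y have "y = y'" by (rule "9.IH"(1))
    with z show ?thesis using "9.IH"(2) by simp
  qed simp_all
qed (auto elim: eval.cases)

text \<open>The Goedel numbering: the machine number \<open>n\<close> is the program \<open>e\<close> with \<open>prog_code e = n\<close>.\<close>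

primrec prog_code :: "prog \<Rightarrow> nat" where
  "prog_code Zero = 0"
| "prog_code Succ = 1"
| "prog_code Fst = 2"
| "prog_code Snd = 3"
| "prog_code Oracle = 4"
| "prog_code (Pair f g) = 5 + 4 * prod_encode (prog_code f, prog_code g)"
| "prog_code (Comp f g) = 6 + 4 * prod_encode (prog_code f, prog_code g)"
| "prog_code (Rec f g) = 7 + 4 * prod_encode (prog_code f, prog_code g)"
| "prog_code (Mu f) = 8 + 4 * prog_code f"

lemma bij_prog_code: "bij prog_code"
proof (rule bijI)
  have [simp]: "4 * a \<noteq> Suc (4 * b)" "4 * a \<noteq> Suc (Suc (4 * b))" "4 * a \<noteq> 3 + 4 * b" for a b
    by presburger+
  note [simp] = this[symmetric]
  have "prog_code e = prog_code e' \<Longrightarrow> e = e'" for e e'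
    by (induction e arbitrary: e'; case_tac e'; simp)
  then show "inj prog_code" by (auto intro: injI)
next
  have "\<exists>e. prog_code e = n" for n
  proof (induction n rule: less_induct)
    case (less n)
    show ?case
    proof (cases "n < 5")
      case True
      then have "n = 0 \<or> n = 1 \<or> n = 2 \<or> n = 3 \<or> n = 4" by auto
      then show ?thesis by (metis prog_code.simps(1-5))
    next
      case False
      define k where "k = (n - 5) div 4"
      obtain a b where ab: "k = prod_encode (a, b)"
        by (metis prod.collapse prod_decode_inverse)
      have "k < n" using False by (simp add: k_def)
      moreover have "a \<le> k" "b \<le> k"
        by (simp_all add: ab le_prod_encode_1 le_prod_encode_2)
      ultimately have "a < n" "b < n" by auto
      with \<open>k < n\<close> less obtain f g h where
        fgh: "prog_code f = a" "prog_code g = b" "prog_code h = k" by meson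
      have "n = 5 + 4 * k \<or> n = 6 + 4 * k \<or> n = 7 + 4 * k \<or> n = 8 + 4 * k"
        using False unfolding k_def by presburger
      then show ?thesis
        by (metis fgh ab prog_code.simps(6-9))
    qed
  qed
  then show "surj prog_code" by (metis surjI)
qed

definition phi :: "prog \<Rightarrow> baire \<Rightarrow> baire option" where
  "phi e p = (if \<exists>q. \<forall>k. eval p e k (q k) then Some (THE q. \<forall>k. eval p e k (q k)) else None)"

definition computable :: "(baire \<Rightarrow> baire option) \<Rightarrow> bool" where
  "computable F \<longleftrightarrow> (\<exists>e. F \<subseteq>\<^sub>m phi e)"

definition computable_seq :: "baire \<Rightarrow> bool" where
  "computable_seq p \<longleftrightarrow> (\<exists>e. phi e (\<lambda>_. 0) = Some p)"

definition pair_seq :: "baire \<Rightarrow> baire \<Rightarrow> baire" where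
  "pair_seq p q = (\<lambda>n. if even n then p (n div 2) else q (n div 2))"

text \<open>The sequence \<open>0\<^sup>n 1 p\<close>.\<close>

definition tag :: "nat \<Rightarrow> baire \<Rightarrow> baire" where
  "tag n p = (\<lambda>i. if i < n then 0 else if i = n then 1 else p (i - Suc n))"


section \<open>Represented spaces\<close>

text \<open>A represented space is given by its representation \<open>\<delta>\<close>; its underlying set is \<open>ran \<delta>\<close>.\<close>

type_synonym 'x rep = "baire \<Rightarrow> 'x option"

text \<open>Partial multi-valued maps are set-valued functions; the domain is where the value is nonempty.\<close>

definition realizes ::
  "'x rep \<Rightarrow> 'y rep \<Rightarrow> (baire \<Rightarrow> baire option) \<Rightarrow> ('x \<Rightarrow> 'y set) \<Rightarrow> bool" where
  "realizes \<delta>X \<delta>Y F f \<longleftrightarrow>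
     (\<forall>p x. \<delta>X p = Some x \<and> f x \<noteq> {} \<longrightarrow>
        (\<exists>q y. F p = Some q \<and> \<delta>Y q = Some y \<and> y \<in> f x))"

definition rep_computable :: "'x rep \<Rightarrow> 'y rep \<Rightarrow> ('x \<Rightarrow> 'y set) \<Rightarrow> bool" where
  "rep_computable \<delta>X \<delta>Y f \<longleftrightarrow> (\<exists>F. computable F \<and> realizes \<delta>X \<delta>Y F f)"

text \<open>Here \<^typ>\<open>baire\<close> carries the product topology of the discrete topology.\<close>

definition rep_continuous :: "'x rep \<Rightarrow> 'y rep \<Rightarrow> ('x \<Rightarrow> 'y set) \<Rightarrow> bool" where
  "rep_continuous \<delta>X \<delta>Y f \<longleftrightarrow>
     (\<exists>F. continuous_on (dom F) (\<lambda>p. the (F p)) \<and> realizes \<delta>X \<delta>Y F f)"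

definition computable_point :: "'x rep \<Rightarrow> 'x \<Rightarrow> bool" where
  "computable_point \<delta> x \<longleftrightarrow> (\<exists>p. computable_seq p \<and> \<delta> p = Some x)"

definition sW_reducible ::
  "'x rep \<Rightarrow> 'y rep \<Rightarrow> ('x \<Rightarrow> 'y set) \<Rightarrow> 'u rep \<Rightarrow> 'v rep \<Rightarrow> ('u \<Rightarrow> 'v set) \<Rightarrow> bool" where
  "sW_reducible \<delta>X \<delta>Y f \<delta>U \<delta>V g \<longleftrightarrow>
     (\<exists>H K. computable H \<and> computable K \<and>
        (\<forall>G. realizes \<delta>U \<delta>V G g \<longrightarrow> realizes \<delta>X \<delta>Y (H \<circ>\<^sub>m G \<circ>\<^sub>m K) f))"

text \<open>The partial function given by a relation between names and points.\<close>

definition rep_of :: "(baire \<Rightarrow> 'x \<Rightarrow> bool) \<Rightarrow> 'x rep" where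
  "rep_of R p = (if \<exists>!x. R p x then Some (THE x. R p x) else None)"

definition rep_prod :: "'x rep \<Rightarrow> 'y rep \<Rightarrow> ('x \<times> 'y) rep" where
  "rep_prod \<delta>X \<delta>Y =
     rep_of (\<lambda>r (x, y). \<exists>p q. r = pair_seq p q \<and> \<delta>X p = Some x \<and> \<delta>Y q = Some y)"

text \<open>
  Elements of \<open>\<C>(X,Y)\<close> are functions that are \<^const>\<open>undefined\<close> off the underlying set of \<open>X\<close>,
  so that distinct elements differ as maps on \<open>X\<close>. A machine with oracle \<open>p\<close> and input \<open>q\<close> is run
  with oracle \<open>pair_seq p q\<close>.
\<close>

definition rep_fun :: "'x rep \<Rightarrow> 'y rep \<Rightarrow> ('x \<Rightarrow> 'y) rep" where
  "rep_fun \<delta>X \<delta>Y =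
     rep_of (\<lambda>r f. f \<in> ran \<delta>X \<rightarrow>\<^sub>E ran \<delta>Y \<and>
       (\<exists>e p. r = tag (prog_code e) p \<and>
          realizes \<delta>X \<delta>Y (\<lambda>q. phi e (pair_seq p q)) (\<lambda>x. {f x})))"

definition rep_nat :: "nat rep" where
  "rep_nat = rep_of (\<lambda>p n. p = tag n (\<lambda>_. 0))"

definition rep_sierpinski :: "bool rep" where
  "rep_sierpinski p = Some (p \<noteq> (\<lambda>_. 0))"

definition rep_open :: "'x rep \<Rightarrow> 'x set rep" where
  "rep_open \<delta> = (\<lambda>p. map_option (\<lambda>f. {x \<in> ran \<delta>. f x}) (rep_fun \<delta> rep_sierpinski p))"

text \<open>The rationals are numbered by \<^const>\<open>nat_to_rat_surj\<close>.\<close>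

definition rep_rat :: "rat rep" where
  "rep_rat = (\<lambda>p. map_option nat_to_rat_surj (rep_nat p))"

text \<open>The Cauchy representation of the metric space \<open>(M, d)\<close> with dense sequence \<open>a\<close>.\<close>

definition cauchy_rep :: "'x set \<Rightarrow> ('x \<Rightarrow> 'x \<Rightarrow> real) \<Rightarrow> (nat \<Rightarrow> 'x) \<Rightarrow> 'x rep" where
  "cauchy_rep M d a = rep_of (\<lambda>p x. x \<in> M \<and> (\<forall>n. d (a (p n)) x \<le> (1/2) ^ n))"

definition rep_real :: "real rep" where
  "rep_real = cauchy_rep UNIV dist (\<lambda>n. of_rat (nat_to_rat_surj n))"

definition lim_map :: "('x \<Rightarrow> 'x \<Rightarrow> real) \<Rightarrow> 'x rep \<Rightarrow> (nat \<Rightarrow> 'x) \<Rightarrow> 'x set" where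
  "lim_map d \<delta> r = {x \<in> ran \<delta>. range r \<subseteq> ran \<delta> \<and> (\<lambda>n. d (r n) x) \<longlonglongrightarrow> 0}"


section \<open>Computable metric spaces\<close>

text \<open>
  The quantifier over all represented spaces \<open>Y\<close> ranges over representations of sets of elements of
  \<^typ>\<open>baire\<close>. This loses nothing: choosing one name for each point identifies any represented
  space with one of this kind.
\<close>

definition preimage_inverse ::
  "'y rep \<Rightarrow> 'x rep \<Rightarrow> ('x set \<Rightarrow> 'y set) \<Rightarrow> ('y \<Rightarrow> 'x) set" where
  "preimage_inverse \<delta>Y \<delta>X g =
     {f \<in> ran (rep_fun \<delta>Y \<delta>X). g = (\<lambda>U \<in> ran (rep_open \<delta>X). {y \<in> ran \<delta>Y. f y \<in> U})}"

definition admissible :: "'x rep \<Rightarrow> bool" where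
  "admissible \<delta>X \<longleftrightarrow>
     (\<forall>\<delta>Y :: baire rep.
        (\<forall>g f f'. f \<in> preimage_inverse \<delta>Y \<delta>X g \<and> f' \<in> preimage_inverse \<delta>Y \<delta>X g \<longrightarrow> f = f') \<and>
        rep_continuous (rep_fun (rep_open \<delta>X) (rep_open \<delta>Y)) (rep_fun \<delta>Y \<delta>X)
          (preimage_inverse \<delta>Y \<delta>X))"

definition ball_union :: "(nat \<Rightarrow> 'x::metric_space) \<Rightarrow> (nat \<Rightarrow> nat \<times> rat) \<Rightarrow> 'x set" where
  "ball_union s f = (\<Union>n. ball (s (fst (f n))) (of_rat (snd (f n))))"

definition computable_metric_space :: "'x::polish_space rep \<Rightarrow> (nat \<Rightarrow> 'x) \<Rightarrow> bool" where
  "computable_metric_space \<delta> s \<longleftrightarrow>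
     ran \<delta> = UNIV \<and>
     admissible \<delta> \<and>
     computable_point (rep_fun rep_nat \<delta>) s \<and>
     closure (range s) = UNIV \<and>
     rep_computable (rep_prod \<delta> \<delta>) rep_real (\<lambda>(x, y). {dist x y}) \<and>
     rep_computable (rep_fun rep_nat \<delta>) \<delta>
       (\<lambda>r. {x. (\<forall>n. dist (r n) (r (Suc n)) < (1/2) ^ n) \<and> r \<longlonglongrightarrow> x}) \<and>
     rep_computable (rep_fun rep_nat (rep_prod rep_nat rep_rat)) (rep_open \<delta>)
       (\<lambda>f. {ball_union s f}) \<and>
     rep_computable (rep_open \<delta>) (rep_fun rep_nat (rep_prod rep_nat rep_rat))
       (\<lambda>U. {f. ball_union s f = U})"

definition prod_dense_seq :: "(nat \<Rightarrow> 'x) \<Rightarrow> (nat \<Rightarrow> 'y) \<Rightarrow> nat \<Rightarrow> 'x \<times> 'y" where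
  "prod_dense_seq s t n = (s (fst (prod_decode n)), t (snd (prod_decode n)))"


section \<open>The space of Borel probability measures\<close>

definition borel_prob :: "'x::topological_space measure set" where
  "borel_prob = {M. sets M = sets borel \<and> prob_space M}"

definition prokhorov :: "'x::metric_space measure \<Rightarrow> 'x measure \<Rightarrow> real" where
  "prokhorov M N = Inf {\<epsilon>. 0 < \<epsilon> \<and> (\<forall>A \<in> sets borel.
     measure M A \<le> measure N (\<Union>a\<in>A. ball a \<epsilon>) + \<epsilon> \<and>
     measure N A \<le> measure M (\<Union>a\<in>A. ball a \<epsilon>) + \<epsilon>)}"

text \<open>
  The index \<open>k\<close> codes a nonempty list of pairs \<open>(m, w)\<close>, standing for the Dirac measure at \<open>s m\<close>
  with weight proportional to \<open>w + 1\<close>; after normalisation these are exactly the finite convex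
  combinations with positive rational weights.
\<close>

definition dirac_comb :: "(nat \<Rightarrow> 'x::topological_space) \<Rightarrow> nat \<Rightarrow> 'x measure" where
  "dirac_comb s k = (let xs = map prod_decode (list_decode (Suc k)) in
     measure_of UNIV (sets borel)
       (\<lambda>A. ennreal ((\<Sum>(m, w)\<leftarrow>xs. real (Suc w) * indicator A (s m)) /
                     (\<Sum>(m, w)\<leftarrow>xs. real (Suc w)))))"

definition rep_prob :: "(nat \<Rightarrow> 'x::metric_space) \<Rightarrow> 'x measure rep" where
  "rep_prob s = cauchy_rep borel_prob prokhorov (dirac_comb s)"


section \<open>Continuity sets and Vitali covers\<close>

definition continuity_set :: "'x::topological_space measure \<Rightarrow> 'x set \<Rightarrow> bool" where
  "continuity_set \<nu> E \<longleftrightarrow> E \<in> sets borel \<and> measure \<nu> (frontier E) = 0"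

definition rep_open_cont :: "'x::topological_space rep \<Rightarrow> 'x measure \<Rightarrow> 'x set rep" where
  "rep_open_cont \<delta> \<nu> =
     rep_of (\<lambda>r U. continuity_set \<nu> U \<and>
       (\<exists>u v W. r = pair_seq u v \<and> rep_open \<delta> u = Some U \<and> rep_open \<delta> v = Some W \<and>
          W \<subseteq> - U \<and> measure \<nu> W = measure \<nu> (- U)))"

definition converges_regularly ::
  "'x::metric_space measure \<Rightarrow> (nat \<Rightarrow> 'x set) \<Rightarrow> 'x \<Rightarrow> bool" where
  "converges_regularly \<nu> E x \<longleftrightarrow>
     (\<forall>n. E n \<in> sets borel) \<and>
     (\<exists>c r \<alpha>. (\<forall>n. 0 < r n) \<and> r \<longlonglongrightarrow> (0::real) \<and> 0 < \<alpha> \<and>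
        (\<forall>n. x \<in> E n \<and> E n \<subseteq> cball (c n) (r n) \<and>
             measure \<nu> (E n) \<ge> \<alpha> * measure \<nu> (cball (c n) (r n))))"

definition vitali_cover :: "'x::metric_space measure \<Rightarrow> 'x set set \<Rightarrow> 'x set \<Rightarrow> bool" where
  "vitali_cover \<nu> W F \<longleftrightarrow>
     W \<subseteq> sets borel \<and> (\<forall>x\<in>F. \<exists>E. range E \<subseteq> W \<and> converges_regularly \<nu> E x)"

definition vitali_covering_property :: "'x::metric_space measure \<Rightarrow> 'x set set \<Rightarrow> bool" where
  "vitali_covering_property \<nu> V \<longleftrightarrow>
     V \<subseteq> sets borel \<and>
     (\<forall>F \<in> sets borel.
        (\<exists>W\<subseteq>V. vitali_cover \<nu> W F) \<and>
        (\<forall>W\<subseteq>V. vitali_cover \<nu> W F \<longrightarrow>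
           (\<exists>C\<subseteq>W. countable C \<and> disjoint C \<and> measure \<nu> (F - \<Union>C) = 0)))"

text \<open>
  Computability of the multi-valued map \<open>U\<close> relative to \<open>\<nu>\<close> means that one machine computes a
  realizer of \<open>U\<close> when given, in addition, an arbitrary name of \<open>\<nu>\<close>.
\<close>

definition strong_vitali_covering_property ::
  "'x::polish_space rep \<Rightarrow> (nat \<Rightarrow> 'x) \<Rightarrow> 'x measure \<Rightarrow> 'x set set \<Rightarrow> bool" where
  "strong_vitali_covering_property \<delta> s \<nu> V \<longleftrightarrow>
     (\<forall>E\<in>V. continuity_set \<nu> E) \<and>
     vitali_covering_property \<nu> V \<and>
     (\<exists>U :: 'x \<Rightarrow> (nat \<Rightarrow> 'x set) set.
        (\<forall>x. U x \<noteq> {} \<and> U x \<subseteq> ran (rep_fun rep_nat (rep_open_cont \<delta> \<nu>))) \<and>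
        rep_computable (rep_prod (rep_prob s) \<delta>) (rep_fun rep_nat (rep_open_cont \<delta> \<nu>))
          (\<lambda>(\<nu>', x). if \<nu>' = \<nu> then U x else {}) \<and>
        (\<forall>x. \<forall>u \<in> U x. \<exists>E. range E \<subseteq> V \<and> converges_regularly \<nu> E x \<and>
           (\<forall>n. u n \<subseteq> E n \<and> measure \<nu> (u n) = measure \<nu> (E n))))"


section \<open>The map \<open>D\<^sup>\<star>\<close>\<close>

definition marginal :: "('a::topological_space \<times> 'b::topological_space) measure \<Rightarrow> 'b measure" where
  "marginal \<mu> = distr \<mu> borel snd"

definition is_dstar_limit ::
  "('a::metric_space \<times> 'b::metric_space) measure \<Rightarrow> 'b set set \<Rightarrow> 'b \<Rightarrow> 'a set \<Rightarrow> real \<Rightarrow> bool" where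
  "is_dstar_limit \<mu> V t A l \<longleftrightarrow>
     (\<exists>E. range E \<subseteq> V \<and> converges_regularly (marginal \<mu>) E t) \<and>
     (\<forall>E. range E \<subseteq> V \<and> converges_regularly (marginal \<mu>) E t \<longrightarrow>
        (\<forall>\<^sub>F n in sequentially. measure \<mu> (UNIV \<times> E n) \<noteq> 0) \<and>
        (\<lambda>n. measure \<mu> (A \<times> E n) / measure \<mu> (UNIV \<times> E n)) \<longlonglongrightarrow> l)"

definition Dstar ::
  "('a::metric_space \<times> 'b::metric_space) measure \<Rightarrow> 'b set set \<Rightarrow> 'b \<Rightarrow> 'a measure set" where
  "Dstar \<mu> V t = {M \<in> borel_prob. \<forall>A \<in> sets borel. is_dstar_limit \<mu> V t A (measure M A)}"

definition Dstar_total ::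
  "('a::metric_space \<times> 'b::metric_space) measure \<Rightarrow> 'b set set \<Rightarrow> bool" where
  "Dstar_total \<mu> V \<longleftrightarrow> (\<forall>t. \<forall>A \<in> sets borel. \<exists>l. is_dstar_limit \<mu> V t A l)"

end

theory Submission
  imports Defs
begin

text \<open>
  Let \<open>d\<close> be the metric of \<open>T\<close>. From a fast Cauchy name \<open>q\<close> of \<open>x\<close> the strong Vitali property yields
  open sets \<open>u\<^sub>N\<close> that agree, up to null sets, with elements \<open>E\<^sub>N\<close> of \<open>V\<close> converging regularly to \<open>x\<close>.
  Approximate \<open>\<mu>\<close> by Dirac combinations and keep only the atoms certified to lie well inside \<open>u\<^sub>N\<close>,
  after checking that few atoms remain undecided between \<open>u\<^sub>N\<close> and its complement. The result is close
  to the slice \<open>\<mu>(\<cdot> \<times> E\<^sub>N) / \<mu>(S \<times> E\<^sub>N)\<close>. The slices converge setwise, their limit is a measure by Nikodym's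
  theorem, and setwise convergence implies convergence in the Prokhorov metric.

  This output depends on the name \<open>q\<close>, and the convergence is not uniform in \<open>q\<close> because the regularity
  constants are not. Therefore \<open>K x n\<close> is the average of the \<open>n\<close>-th output over the names \<open>q\<^sub>\<theta>\<close>, where
  \<open>\<theta>\<close> is uniform in \<open>(0, 1)\<close> and \<open>q\<^sub>\<theta> i\<close> is the least \<open>j\<close> with \<open>d (t j) x < \<theta> / 2 ^ (i + 2)\<close>. For every
  single \<open>\<theta>\<close> the outputs converge, hence so do their averages. For almost every \<open>\<theta>\<close> the part of
  \<open>q\<^sub>\<theta>\<close> read by the algorithm is constant near \<open>\<theta>\<close>, so almost all of \<open>(0, 1)\<close> is eventually covered by
  dyadic intervals on which the output is certified, from any name of \<open>x\<close>, to be constant.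
\<close>

section \<open>Relative computability\<close>

text \<open>\<open>K\<close> has to be single-valued: what a machine returns for \<open>x\<close>
  must not depend on the name of \<open>x\<close> that it reads, whereas every search for a
  certificate does depend on it. The parameter \<theta> cures this because
  \<open>rname x \<theta>\<close> is a function of \<open>x\<close> and \<theta> alone. At a single
  \<theta> this name need not be computable, since a distance may equal its threshold, but for fixed
  \<open>x\<close> only countably many \<theta> are affected. Lower bounds suffice for the average:
  all outputs are probability measures, so once the certified intervals have total length at least
  \<open>1 - (1/2) ^ m\<close>, the remaining ones can shift the average by at most
  \<open>(1/2) ^ m\<close>.

  The second open set in a name of a continuity set is what makes slices accessible: the mass of an
  open set alone can only be approximated from below, while a slice divides by it. This mass may
  also vanish for small \<open>N\<close>, which no search can recognise. Hence the search for the
  \<open>n\<close>-th output may move on to any \<open>N \<ge> n\<close>, which is harmless because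
  only the limit matters.\<close>

definition pi1 :: "nat \<Rightarrow> nat" where "pi1 x = fst (prod_decode x)"
definition pi2 :: "nat \<Rightarrow> nat" where "pi2 x = snd (prod_decode x)"

lemma pi_simps [simp]:
  "pi1 (prod_encode (a, b)) = a" "pi2 (prod_encode (a, b)) = b" "prod_encode (pi1 x, pi2 x) = x"
  by (simp_all add: pi1_def pi2_def)

text \<open>One program has to serve every oracle. Restricting to total functionals keeps
  composition and recursion free of termination questions; partiality enters through
  \<open>sig\<close>.\<close>

definition tot :: "(baire \<Rightarrow> nat \<Rightarrow> nat) \<Rightarrow> bool" where
  "tot f \<longleftrightarrow> (\<exists>e. \<forall>p x. eval p e x (f p x))"

definition dec :: "(baire \<Rightarrow> nat \<Rightarrow> bool) \<Rightarrow> bool" where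
  "dec P \<longleftrightarrow> tot (\<lambda>p x. of_bool (P p x))"

text \<open>Sigma-1 relations relative to the oracle, in normal form: a decidable matrix under a
  single unbounded number quantifier. The algorithms below are described by such relations, and
  \<open>sig_search\<close> turns them into programs.\<close>

definition sig :: "(baire \<Rightarrow> nat \<Rightarrow> bool) \<Rightarrow> bool" where
  "sig R \<longleftrightarrow> (\<exists>D. dec D \<and> (\<forall>p x. R p x \<longleftrightarrow> (\<exists>w. D p (prod_encode (x, w)))))"

named_theorems cintros

section \<open>Closure properties of total functionals and decidable relations\<close>

lemma tot_comp: "tot f \<Longrightarrow> tot g \<Longrightarrow> tot (\<lambda>p x. f p (g p x))"
  unfolding tot_def by (metis eval.intros(7))

lemma tot_pair [cintros]: "tot f \<Longrightarrow> tot g \<Longrightarrow> tot (\<lambda>p x. prod_encode (f p x, g p x))"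
  unfolding tot_def by (metis eval.intros(6))

lemma tot_Suc [cintros]: "tot f \<Longrightarrow> tot (\<lambda>p x. Suc (f p x))"
  by (rule tot_comp[where f = "\<lambda>p. Suc"]) (auto simp: tot_def intro: eval.intros)

lemma tot_pi1 [cintros]: "tot f \<Longrightarrow> tot (\<lambda>p x. pi1 (f p x))"
  by (rule tot_comp[where f = "\<lambda>p. pi1"]) (auto simp: tot_def pi1_def intro: eval.intros)

lemma tot_pi2 [cintros]: "tot f \<Longrightarrow> tot (\<lambda>p x. pi2 (f p x))"
  by (rule tot_comp[where f = "\<lambda>p. pi2"]) (auto simp: tot_def pi2_def intro: eval.intros)

lemma tot_oracle [cintros]: "tot f \<Longrightarrow> tot (\<lambda>p x. p (f p x))"
  by (rule tot_comp[where f = "\<lambda>p. p"]) (auto simp: tot_def intro: eval.intros)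

lemma tot_id [cintros]: "tot (\<lambda>p x. x)"
proof -
  have "eval p (Pair Fst Snd) x (prod_encode (fst (prod_decode x), snd (prod_decode x)))" for p x
    by (intro eval.intros)
  then have "eval p (Pair Fst Snd) x x" for p x by simp
  then show ?thesis unfolding tot_def by blast
qed

lemma tot_const [cintros]: "tot (\<lambda>p x. c)"
proof (induction c)
  case 0
  then show ?case by (auto simp: tot_def intro: eval.intros)
qed (rule tot_Suc)

lemma tot_cong: "tot f \<Longrightarrow> (\<And>p x. f p x = g p x) \<Longrightarrow> tot g"
  unfolding tot_def by auto

text \<open>A program receives a single number, so the premise on \<open>g\<close> is about its
  uncurried form: argument, stage and previous value are read off one code \<open>z\<close>. The
  rules for sums and bounded quantifiers treat their bound variables in the same way, which lets all
  of them be applied by resolution.\<close>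

lemma tot_rec [cintros]:
  assumes f: "tot f" and g: "tot (\<lambda>p z. g p (pi1 z) (pi1 (pi2 z)) (pi2 (pi2 z)))" and h: "tot h"
  shows "tot (\<lambda>p x. rec_nat (f p x) (\<lambda>n y. g p x n y) (h p x))"
proof -
  obtain F G where F: "eval p F x (f p x)"
    and G: "eval p G x (g p (pi1 x) (pi1 (pi2 x)) (pi2 (pi2 x)))" for p x
    using f g unfolding tot_def by blast
  have "eval p (Rec F G) (prod_encode (x, n)) (rec_nat (f p x) (\<lambda>n y. g p x n y) n)" for p x n
  proof (induction n)
    case 0
    then show ?case using F by (auto intro: eval.intros)
  next
    case (Suc n)
    from eval.intros(9)[OF this G] show ?case by simp
  qed
  then have "eval p (Rec F G) z (rec_nat (f p (pi1 z)) (\<lambda>n y. g p (pi1 z) n y) (pi2 z))" for p z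
    by (metis pi_simps(3))
  then have "tot (\<lambda>p z. rec_nat (f p (pi1 z)) (\<lambda>n y. g p (pi1 z) n y) (pi2 z))"
    unfolding tot_def by blast
  from tot_comp[OF this tot_pair[OF tot_id h]] show ?thesis by simp
qed

lemma tot_add [cintros]: "tot f \<Longrightarrow> tot g \<Longrightarrow> tot (\<lambda>p x. f p x + g p x)"
proof -
  assume *: "tot f" "tot g"
  have "tot (\<lambda>p x. rec_nat (f p x) (\<lambda>n y. Suc y) (g p x))"
    by (intro cintros *)
  moreover have "rec_nat a (\<lambda>n y. Suc y) b = a + b" for a b :: nat by (induction b) auto
  ultimately show ?thesis by simp
qed

lemma tot_mult [cintros]: "tot f \<Longrightarrow> tot g \<Longrightarrow> tot (\<lambda>p x. f p x * g p x)"
proof -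
  assume *: "tot f" "tot g"
  have "tot (\<lambda>p x. rec_nat 0 (\<lambda>n y. y + f p x) (g p x))"
    by (intro cintros *[THEN tot_comp])
  moreover have "rec_nat 0 (\<lambda>n y. y + a) b = a * b" for a b :: nat by (induction b) auto
  ultimately show ?thesis by simp
qed

lemma tot_diff [cintros]: "tot f \<Longrightarrow> tot g \<Longrightarrow> tot (\<lambda>p x. f p x - g p x)"
proof -
  assume *: "tot f" "tot g"
  have "tot (\<lambda>p x. rec_nat (f p x) (\<lambda>n y. rec_nat 0 (\<lambda>n y. n) y) (g p x))"
    by (intro cintros *)
  moreover have "rec_nat 0 (\<lambda>n y. n) b = b - 1" for b :: nat by (cases b) auto
  moreover have "rec_nat a (\<lambda>n y. y - 1) b = a - b" for a b :: nat by (induction b) auto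
  ultimately show ?thesis by simp
qed

lemma tot_power [cintros]: "tot f \<Longrightarrow> tot g \<Longrightarrow> tot (\<lambda>p x. f p x ^ g p x)"
proof -
  assume *: "tot f" "tot g"
  have "tot (\<lambda>p x. rec_nat 1 (\<lambda>n y. f p x * y) (g p x))"
    by (intro cintros *[THEN tot_comp])
  moreover have "rec_nat 1 (\<lambda>n y. a * y) b = a ^ b" for a b :: nat by (induction b) auto
  ultimately show ?thesis by simp
qed

lemma dec_comp: "dec P \<Longrightarrow> tot g \<Longrightarrow> dec (\<lambda>p x. P p (g p x))"
  unfolding dec_def by (rule tot_comp)

lemma dec_not [cintros]: "dec P \<Longrightarrow> dec (\<lambda>p x. \<not> P p x)"
proof -
  assume "dec P"
  then have "tot (\<lambda>p x. 1 - of_bool (P p x))"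
    unfolding dec_def by (intro cintros)
  then show ?thesis unfolding dec_def by (rule tot_cong) auto
qed

lemma dec_and [cintros]: "dec P \<Longrightarrow> dec Q \<Longrightarrow> dec (\<lambda>p x. P p x \<and> Q p x)"
proof -
  assume "dec P" "dec Q"
  then have "tot (\<lambda>p x. of_bool (P p x) * of_bool (Q p x))"
    unfolding dec_def by (intro cintros)
  then show ?thesis unfolding dec_def by (rule tot_cong) auto
qed

lemma dec_or [cintros]: "dec P \<Longrightarrow> dec Q \<Longrightarrow> dec (\<lambda>p x. P p x \<or> Q p x)"
  using dec_not[OF dec_and[OF dec_not dec_not], of P Q] by simp

lemma dec_imp [cintros]: "dec P \<Longrightarrow> dec Q \<Longrightarrow> dec (\<lambda>p x. P p x \<longrightarrow> Q p x)"
  using dec_or[OF dec_not, of P Q] by simp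

lemma dec_le [cintros]: "tot f \<Longrightarrow> tot g \<Longrightarrow> dec (\<lambda>p x. f p x \<le> g p x)"
proof -
  assume "tot f" "tot g"
  then have "tot (\<lambda>p x. 1 - (f p x - g p x))" by (intro cintros)
  then show ?thesis unfolding dec_def by (rule tot_cong) auto
qed

lemma dec_less [cintros]: "tot f \<Longrightarrow> tot g \<Longrightarrow> dec (\<lambda>p x. f p x < g p x)"
  using dec_not[OF dec_le, of g f] by (simp add: not_le)

lemma dec_eq [cintros]: "tot f \<Longrightarrow> tot g \<Longrightarrow> dec (\<lambda>p x. f p x = g p x)"
  using dec_and[OF dec_le dec_le, of f g g f] by (simp add: order_eq_iff)

lemma dec_ball [cintros]:
  assumes f: "tot f" and P: "dec (\<lambda>p z. P p (pi1 z) (pi2 z))"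
  shows "dec (\<lambda>p x. \<forall>i<f p x. P p x i)"
proof -
  have "tot (\<lambda>p x. rec_nat 1 (\<lambda>n y. y * of_bool (P p x n)) (f p x))"
    using dec_comp[OF P, of "\<lambda>p z. prod_encode (pi1 z, pi1 (pi2 z))"]
    by (intro cintros f) (simp add: dec_def cintros)
  moreover have "rec_nat 1 (\<lambda>n y. y * of_bool (P p x n)) k = (of_bool (\<forall>i<k. P p x i) :: nat)" for p x k
    by (induction k) (auto simp: less_Suc_eq)
  ultimately show ?thesis unfolding dec_def by simp
qed

lemma tot_if [cintros]:
  assumes "dec P" "tot f" "tot g" shows "tot (\<lambda>p x. if P p x then f p x else g p x)"
proof -
  have "tot (\<lambda>p x. of_bool (P p x) * f p x + (1 - of_bool (P p x)) * g p x)"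
    using assms unfolding dec_def by (intro cintros)
  then show ?thesis by (rule tot_cong) auto
qed

lemma dec_even [cintros]: "tot f \<Longrightarrow> dec (\<lambda>p x. even (f p x))"
proof -
  assume *: "tot f"
  have "tot (\<lambda>p x. rec_nat 1 (\<lambda>n y. 1 - y) (f p x))" by (intro cintros *)
  moreover have "rec_nat 1 (\<lambda>n y. 1 - y) n = (of_bool (even n) :: nat)" for n by (induction n) auto
  ultimately show ?thesis unfolding dec_def by simp
qed

lemma tot_div2 [cintros]: "tot f \<Longrightarrow> tot (\<lambda>p x. f p x div 2)"
proof -
  assume *: "tot f"
  have "tot (\<lambda>p x. rec_nat 0 (\<lambda>n y. if even n then y else Suc y) (f p x))" by (intro cintros *)
  moreover have "rec_nat 0 (\<lambda>n y. if even n then y else Suc y) n = n div 2" for n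
    by (induction n) auto
  ultimately show ?thesis by simp
qed

text \<open>A nonempty list is coded by the successor of the pair of its head and its coded tail, so
  \<open>pi2 (d - 1)\<close> is the code of the tail.\<close>

lemma tot_funpow_pi2:
  assumes "tot f" "tot g" shows "tot (\<lambda>p x. ((\<lambda>d. pi2 (d - 1)) ^^ g p x) (f p x))"
proof -
  have "tot (\<lambda>p x. rec_nat (f p x) (\<lambda>n d. pi2 (d - 1)) (g p x))" by (intro cintros assms)
  moreover have "rec_nat a (\<lambda>n d. pi2 (d - 1)) n = ((\<lambda>d. pi2 (d - 1)) ^^ n) a" for a n
    by (induction n) auto
  ultimately show ?thesis by simp
qed

text \<open>The \<open>i\<close>-th entry of the list coded by \<open>D\<close>; a junk value beyond its length.\<close>

definition el :: "nat \<Rightarrow> nat \<Rightarrow> nat" where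
  "el D i = pi1 (((\<lambda>d. pi2 (d - 1)) ^^ i) D - 1)"

lemma tot_el [cintros]: "tot f \<Longrightarrow> tot g \<Longrightarrow> tot (\<lambda>p x. el (f p x) (g p x))"
  unfolding el_def by (intro cintros tot_funpow_pi2)

lemma funpow_list_encode:
  "i \<le> length xs \<Longrightarrow> ((\<lambda>d. pi2 (d - 1)) ^^ i) (list_encode xs) = list_encode (drop i xs)"
proof (induction i)
  case (Suc i)
  then have "drop i xs = xs ! i # drop (Suc i) xs" by (simp add: Cons_nth_drop_Suc)
  with Suc show ?case by simp
qed simp

lemma el_list_encode: "i < length xs \<Longrightarrow> el (list_encode xs) i = xs ! i"
  unfolding el_def by (simp add: funpow_list_encode Cons_nth_drop_Suc[symmetric] del: One_nat_def)

text \<open>This replaces a choice of finitely many values by a single number quantifier.\<close>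

lemma ex_el: "\<exists>w. \<forall>i<n. el w i = f i"
  by (rule exI[of _ "list_encode (map f [0..<n])"]) (simp add: el_list_encode)

definition len :: "nat \<Rightarrow> nat" where "len w = length (list_decode w)"

lemma list_encode_eq_0: "list_encode xs = 0 \<longleftrightarrow> xs = []"
  by (cases xs) auto

lemma length_le_list_encode: "length xs \<le> list_encode xs"
proof (induction xs)
  case (Cons a xs)
  have "list_encode xs \<le> prod_encode (a, list_encode xs)" by (rule le_prod_encode_2)
  with Cons show ?case by simp
qed simp

text \<open>The code of a list bounds its length, and taking tails stays at 0 once the list is
  exhausted. Counting the nonzero iterates among the first \<open>f p x\<close> ones therefore gives
  the length.\<close>

lemma tot_len [cintros]: "tot f \<Longrightarrow> tot (\<lambda>p x. len (f p x))"
proof -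
  assume f: "tot f"
  have "tot (\<lambda>p x. rec_nat 0 (\<lambda>i y. if ((\<lambda>d. pi2 (d - 1)) ^^ i) (f p x) = 0 then y else Suc y) (f p x))"
    by (intro cintros tot_funpow_pi2 f tot_comp[OF f])
  moreover have "rec_nat 0 (\<lambda>i y. if ((\<lambda>d. pi2 (d - 1)) ^^ i) w = 0 then y else Suc y) n = min n (len w)"
    (is "?R n = _") for w n
  proof -
    have nz: "((\<lambda>d. pi2 (d - 1)) ^^ i) w = 0 \<longleftrightarrow> len w \<le> i" for i
    proof (cases "i \<le> len w")
      case True
      then show ?thesis using funpow_list_encode[of i "list_decode w"]
        by (simp add: len_def list_encode_eq_0)
    next
      case False
      have 0: "((\<lambda>d. pi2 (d - 1)) ^^ k) 0 = 0" for k
        by (induction k) (auto simp: pi2_def prod_decode_def prod_decode_aux.simps)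
      from False have "i = (i - len w) + len w" by simp
      then have "((\<lambda>d. pi2 (d - 1)) ^^ i) w = ((\<lambda>d. pi2 (d - 1)) ^^ (i - len w)) (((\<lambda>d. pi2 (d - 1)) ^^ len w) w)"
        by (metis comp_apply funpow_add)
      also have "\<dots> = 0" using funpow_list_encode[of "len w" "list_decode w"] 0 by (simp add: len_def)
      finally show ?thesis using False by simp
    qed
    show ?thesis by (induction n) (use nz in \<open>auto simp: min_def not_le\<close>)
  qed
  moreover have "min w (len w) = len w" for w
    using length_le_list_encode[of "list_decode w"] by (simp add: len_def)
  ultimately show ?thesis by simp
qed

lemma el_nth: "i < len w \<Longrightarrow> el w i = list_decode w ! i"
  using el_list_encode[of i "list_decode w"] by (simp add: len_def)

lemma list_decode_map_el: "list_decode w = map (el w) [0..<len w]"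
  by (rule nth_equalityI) (auto simp: el_nth len_def)

lemma tot_sum [cintros]:
  assumes f: "tot f" and g: "tot (\<lambda>p z. g p (pi1 z) (pi2 z))"
  shows "tot (\<lambda>p x. \<Sum>i<f p x. g p x i)"
proof -
  have "tot (\<lambda>p x. rec_nat 0 (\<lambda>n y. y + g p x n) (f p x))"
    using tot_comp[OF g, of "\<lambda>p z. prod_encode (pi1 z, pi1 (pi2 z))"]
    by (intro cintros f) (simp add: cintros)
  moreover have "rec_nat 0 (\<lambda>n y. y + g p x n) k = (\<Sum>i<k. g p x i)" for p x k
    by (induction k) auto
  ultimately show ?thesis by simp
qed

section \<open>Closure properties of semidecidable relations\<close>

lemma sig_dec: "dec D \<Longrightarrow> sig D"
  unfolding sig_def
  by (rule exI[of _ "\<lambda>p z. D p (pi1 z)"]) (auto intro!: cintros dec_comp[of D "\<lambda>p z. pi1 z"])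

lemma sig_comp: "sig R \<Longrightarrow> tot g \<Longrightarrow> sig (\<lambda>p x. R p (g p x))"
  unfolding sig_def
proof (elim exE conjE, goal_cases)
  case (1 D)
  then show ?case
    by (intro exI[of _ "\<lambda>p z. D p (prod_encode (g p (pi1 z), pi2 z))"] conjI
      dec_comp[OF 1(2), of "\<lambda>p z. prod_encode (g p (pi1 z), pi2 z)"] cintros tot_comp[OF 1(1)]) auto
qed

lemma sig_cong: "sig R \<Longrightarrow> (\<And>p x. R p x = Q p x) \<Longrightarrow> sig Q"
  unfolding sig_def by simp

lemma sig_ex [cintros]:
  assumes "sig (\<lambda>p z. R p (pi1 z) (pi2 z))" shows "sig (\<lambda>p x. \<exists>y. R p x y)"
proof -
  obtain D where D: "dec D" "R p (pi1 z) (pi2 z) \<longleftrightarrow> (\<exists>w. D p (prod_encode (z, w)))" for p z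
    using assms unfolding sig_def by metis
  have "dec (\<lambda>p z. D p (prod_encode (prod_encode (pi1 z, pi1 (pi2 z)), pi2 (pi2 z))))"
    by (intro dec_comp[OF D(1), of "\<lambda>p z. prod_encode (prod_encode (pi1 z, pi1 (pi2 z)), pi2 (pi2 z))"] cintros)
  moreover have "(\<exists>y. R p x y) \<longleftrightarrow> (\<exists>w. D p (prod_encode (prod_encode (x, pi1 w), pi2 w)))" for p x
  proof
    assume "\<exists>y. R p x y"
    then obtain y where "R p x y" ..
    then obtain w where "D p (prod_encode (prod_encode (x, y), w))"
      using D(2)[of p "prod_encode (x, y)"] by auto
    then show "\<exists>w. D p (prod_encode (prod_encode (x, pi1 w), pi2 w))"
      by (intro exI[of _ "prod_encode (y, w)"]) simp
  next
    assume "\<exists>w. D p (prod_encode (prod_encode (x, pi1 w), pi2 w))"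
    then show "\<exists>y. R p x y" using D(2)[of p "prod_encode (x, pi1 w)" for w] by auto
  qed
  ultimately show ?thesis unfolding sig_def
    by (intro exI[of _ "\<lambda>p z. D p (prod_encode (prod_encode (pi1 z, pi1 (pi2 z)), pi2 (pi2 z)))"]) simp
qed

lemma sig_and [cintros]:
  assumes "sig R" "sig Q" shows "sig (\<lambda>p x. R p x \<and> Q p x)"
proof -
  obtain D E where D: "dec D" "R p z \<longleftrightarrow> (\<exists>w. D p (prod_encode (z, w)))"
    and E: "dec E" "Q p z \<longleftrightarrow> (\<exists>w. E p (prod_encode (z, w)))" for p z
    using assms unfolding sig_def by metis
  have "sig (\<lambda>p x. \<exists>w v. D p (prod_encode (x, w)) \<and> E p (prod_encode (x, v)))"
    by (intro sig_ex sig_dec cintros dec_comp[OF D(1)] dec_comp[OF E(1)])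
  then show ?thesis by (rule sig_cong) (auto simp: D(2) E(2))
qed

lemma sig_or [cintros]:
  assumes "sig R" "sig Q" shows "sig (\<lambda>p x. R p x \<or> Q p x)"
proof -
  obtain D E where D: "dec D" "R p z \<longleftrightarrow> (\<exists>w. D p (prod_encode (z, w)))"
    and E: "dec E" "Q p z \<longleftrightarrow> (\<exists>w. E p (prod_encode (z, w)))" for p z
    using assms unfolding sig_def by metis
  have "sig (\<lambda>p x. \<exists>w. D p (prod_encode (x, w)) \<or> E p (prod_encode (x, w)))"
    by (intro sig_ex sig_dec cintros dec_comp[OF D(1)] dec_comp[OF E(1)])
  then show ?thesis by (rule sig_cong) (auto simp: D(2) E(2))
qed

lemma sig_imp [cintros]: "dec P \<Longrightarrow> sig R \<Longrightarrow> sig (\<lambda>p x. P p x \<longrightarrow> R p x)"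
  using sig_or[OF sig_dec[OF dec_not], of P R] by simp

text \<open>The finitely many witnesses are collected in one coded list, which moves the existential
  quantifier to the front.\<close>

lemma sig_ball [cintros]:
  assumes f: "tot f" and R: "sig (\<lambda>p z. R p (pi1 z) (pi2 z))"
  shows "sig (\<lambda>p x. \<forall>i<f p x. R p x i)"
proof -
  obtain D where D: "dec D" "R p (pi1 z) (pi2 z) \<longleftrightarrow> (\<exists>w. D p (prod_encode (z, w)))" for p z
    using R unfolding sig_def by metis
  have "sig (\<lambda>p x. \<exists>v. \<forall>i<f p x. D p (prod_encode (prod_encode (x, i), el v i)))"
    by (intro sig_ex sig_dec cintros dec_comp[OF D(1)] tot_comp[OF f])
  moreover have "(\<forall>i<f p x. R p x i) \<longleftrightarrow> (\<exists>v. \<forall>i<f p x. D p (prod_encode (prod_encode (x, i), el v i)))"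
    for p x
  proof
    assume "\<forall>i<f p x. R p x i"
    then have "\<forall>i. \<exists>w. i < f p x \<longrightarrow> D p (prod_encode (prod_encode (x, i), w))"
      using D(2)[of p "prod_encode (x, i)" for i] by auto
    then obtain g where g: "\<forall>i<f p x. D p (prod_encode (prod_encode (x, i), g i))" by metis
    obtain v where "\<forall>i<f p x. el v i = g i" using ex_el by blast
    with g show "\<exists>v. \<forall>i<f p x. D p (prod_encode (prod_encode (x, i), el v i))"
      by (intro exI[of _ v]) simp
  next
    assume "\<exists>v. \<forall>i<f p x. D p (prod_encode (prod_encode (x, i), el v i))"
    then show "\<forall>i<f p x. R p x i" using D(2)[of p "prod_encode (x, i)" for i] by auto
  qed
  ultimately show ?thesis by simp
qed

lemma sig_bex [cintros]:
  assumes f: "tot f" and R: "sig (\<lambda>p z. R p (pi1 z) (pi2 z))"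
  shows "sig (\<lambda>p x. \<exists>i<f p x. R p x i)"
proof -
  have "sig (\<lambda>p x. \<exists>i. i < f p x \<and> R p x i)"
    by (intro sig_ex sig_and sig_dec dec_less R tot_comp[OF f] cintros)
  then show ?thesis by simp
qed

lemmas [cintros] = sig_dec

section \<open>Unbounded search\<close>

lemma eval_Mu_least:
  assumes d: "\<And>z. eval p d z (1 - of_bool (D z))" and w: "D (prod_encode (x, w))"
  shows "\<exists>n. eval p (Mu d) x n \<and> D (prod_encode (x, n))"
proof -
  define n where "n = (LEAST w. D (prod_encode (x, w)))"
  have n: "D (prod_encode (x, n))" unfolding n_def using w by (rule LeastI)
  have "\<not> D (prod_encode (x, m))" if "m < n" for m
    using not_less_Least that unfolding n_def by blast
  then have "\<exists>y. eval p d (prod_encode (x, m)) (Suc y)" if "m < n" for m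
    using d[of "prod_encode (x, m)"] that by auto
  moreover have "eval p d (prod_encode (x, n)) 0" using d[of "prod_encode (x, n)"] n by simp
  ultimately have "eval p (Mu d) x n" by (intro eval.intros(10))
  with n show ?thesis by blast
qed

lemma sig_semidecidable:
  assumes "sig R" shows "\<exists>e. \<forall>p x. R p x \<longleftrightarrow> (\<exists>y. eval p e x y)"
proof -
  obtain D where D: "dec D" "R p x \<longleftrightarrow> (\<exists>w. D p (prod_encode (x, w)))" for p x
    using assms unfolding sig_def by metis
  have "tot (\<lambda>p z. 1 - of_bool (D p z))"
    using D(1) unfolding dec_def by (intro cintros)
  then obtain d where d: "eval p d z (1 - of_bool (D p z))" for p z
    unfolding tot_def by blast
  have "R p x \<longleftrightarrow> (\<exists>y. eval p (Mu d) x y)" for p x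
  proof
    assume "R p x"
    then show "\<exists>y. eval p (Mu d) x y"
      using D(2) eval_Mu_least[of p d "D p" x, OF d] by blast
  next
    assume "\<exists>y. eval p (Mu d) x y"
    then obtain y where "eval p d (prod_encode (x, y)) 0" by (auto elim: eval.cases)
    from eval_functional[OF this d] have "D p (prod_encode (x, y))"
      by (cases "D p (prod_encode (x, y))") auto
    then show "R p x" using D(2) by blast
  qed
  then show ?thesis by blast
qed

text \<open>Value and witness are searched for as one pair, so the machine returns some
  \<open>y'\<close> related to \<open>x\<close> and not a prescribed one. Which value is found
  depends on the oracle; this is how outputs come to depend on names.\<close>

lemma sig_search:
  assumes "sig R"
  shows "\<exists>e. \<forall>p x y. R p (prod_encode (x, y)) \<longrightarrow>
    (\<exists>y'. eval p e x y' \<and> R p (prod_encode (x, y')))"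
proof -
  obtain D where D: "dec D" "R p x \<longleftrightarrow> (\<exists>w. D p (prod_encode (x, w)))" for p x
    using assms unfolding sig_def by metis
  define D' where "D' p z = D p (prod_encode (prod_encode (pi1 z, pi1 (pi2 z)), pi2 (pi2 z)))" for p z
  have "dec D'" unfolding D'_def
    by (intro dec_comp[OF D(1), of "\<lambda>p z. prod_encode (prod_encode (pi1 z, pi1 (pi2 z)), pi2 (pi2 z))"] cintros)
  then have "tot (\<lambda>p z. 1 - of_bool (D' p z))"
    unfolding dec_def by (intro cintros)
  then obtain d where d: "eval p d z (1 - of_bool (D' p z))" for p z
    unfolding tot_def by blast
  have "\<exists>y'. eval p (Comp Fst (Mu d)) x y' \<and> R p (prod_encode (x, y'))" if R: "R p (prod_encode (x, y))" for p x y
  proof -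
    obtain w where "D p (prod_encode (prod_encode (x, y), w))" using R D(2) by blast
    then have "D' p (prod_encode (x, prod_encode (y, w)))" by (simp add: D'_def)
    from eval_Mu_least[of p d "D' p", OF d this]
    obtain n where n: "eval p (Mu d) x n" "D' p (prod_encode (x, n))" by blast
    have "eval p (Comp Fst (Mu d)) x (pi1 n)"
      unfolding pi1_def by (rule eval.intros(7)[OF n(1) eval.intros(3)])
    moreover have "R p (prod_encode (x, pi1 n))" using n D(2) by (auto simp: D'_def)
    ultimately show ?thesis by blast
  qed
  then show ?thesis by blast
qed


section \<open>A universal machine with partial oracles\<close>

text \<open>
  Oracles are graphs of partial functions, so that the finite part of the oracle used by a
  computation can itself serve as an oracle.
\<close>

type_synonym orc = "nat \<Rightarrow> nat \<Rightarrow> bool"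

text \<open>The rules of \<open>eval\<close> as one monotone operator on program codes, where
  \<open>X\<close> stands for the calls already established. It avoids the datatype of programs so
  that the formula is arithmetical; the decomposition of \<open>E\<close> mirrors
  \<open>prog_code\<close>.\<close>

definition step :: "orc \<Rightarrow> (nat \<Rightarrow> nat \<Rightarrow> nat \<Rightarrow> bool) \<Rightarrow> nat \<Rightarrow> nat \<Rightarrow> nat \<Rightarrow> bool" where
  "step G X E x y \<longleftrightarrow>
     E = 0 \<and> y = 0 \<or> E = 1 \<and> y = Suc x \<or> E = 2 \<and> y = pi1 x \<or> E = 3 \<and> y = pi2 x \<or> E = 4 \<and> G x y \<or>
     (\<exists>c. E = 5 + 4 * c \<and> X (pi1 c) x (pi1 y) \<and> X (pi2 c) x (pi2 y)) \<or>
     (\<exists>c u. E = 6 + 4 * c \<and> X (pi2 c) x u \<and> X (pi1 c) u y) \<or>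
     (\<exists>c. E = 7 + 4 * c \<and> pi2 x = 0 \<and> X (pi1 c) (pi1 x) y) \<or>
     (\<exists>c n u. E = 7 + 4 * c \<and> pi2 x = Suc n \<and> X E (prod_encode (pi1 x, n)) u \<and>
        X (pi2 c) (prod_encode (pi1 x, prod_encode (n, u))) y) \<or>
     (\<exists>c. E = 8 + 4 * c \<and> X c (prod_encode (x, y)) 0 \<and>
        (\<forall>m<y. \<exists>u. X c (prod_encode (x, m)) (Suc u)))"

lemma step_mono: "G \<le> H \<Longrightarrow> X \<le> Y \<Longrightarrow> step G X E x y \<Longrightarrow> step H Y E x y"
  unfolding step_def le_fun_def le_bool_def
  by (elim disj_forward ex_forward conj_forward all_forward imp_forward) (assumption | blast)+

lemma step_mono' [mono]: "(\<And>E x y. X E x y \<longrightarrow> Y E x y) \<Longrightarrow> step G X E x y \<longrightarrow> step G Y E x y"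
  using step_mono[of G G X Y E x y] by (auto simp: le_fun_def)

inductive run :: "orc \<Rightarrow> nat \<Rightarrow> nat \<Rightarrow> nat \<Rightarrow> bool" for G where
  run_step: "step G (run G) E x y \<Longrightarrow> run G E x y"

definition graph :: "baire \<Rightarrow> orc" where "graph p = (\<lambda>x y. y = p x)"

lemma run_mono:
  assumes "run G E x y" "G \<le> H" shows "run H E x y"
  using assms(1)
proof (induction rule: run.induct)
  case (run_step E x y)
  then have "step H (run H) E x y"
    by (rule step_mono[OF assms(2), rotated]) (auto simp: le_fun_def)
  then show ?case by (rule run.intros)
qed

lemma eval_run: "eval p e x y \<Longrightarrow> run (graph p) (prog_code e) x y"
proof (induction rule: eval.induct)
  case (10 f x n)
  have "step (graph p) (run (graph p)) (8 + 4 * prog_code f) x n"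
    unfolding step_def by (intro disjI2, rule exI[of _ "prog_code f"]) (use 10 in blast)
  then show ?case unfolding prog_code.simps by (rule run_step)
qed (rule run_step; force simp: step_def graph_def pi1_def pi2_def)+

lemma run_eval:
  assumes "run (graph p) E x y" shows "prog_code e = E \<Longrightarrow> eval p e x y"
  using assms
proof (induction arbitrary: e rule: run.induct)
  case (run_step E x y)
  have [simp]: "4 * a \<noteq> Suc (4 * b)" "4 * a \<noteq> Suc (Suc (4 * b))" "4 * a \<noteq> 3 + 4 * b" for a b :: nat
    by presburger+
  note [simp] = this[symmetric]
  note st = run_step(1)[unfolded step_def]
  show ?case
  proof (cases e)
    case (Pair f g)
    with st run_step(2) have "eval p f x (pi1 y)" "eval p g x (pi2 y)" by auto
    from eval.intros(6)[OF this] show ?thesis using Pair by simp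
  next
    case (Comp f g)
    with st run_step(2) obtain u where "eval p g x u" "eval p f u y" by auto blast
    then show ?thesis using Comp by (auto intro: eval.intros)
  next
    case (Rec f g)
    have x: "x = prod_encode (pi1 x, pi2 x)" by simp
    from Rec st run_step(2) consider "pi2 x = 0" "eval p f (pi1 x) y"
      | n u where "pi2 x = Suc n" "eval p (Rec f g) (prod_encode (pi1 x, n)) u"
        "eval p g (prod_encode (pi1 x, prod_encode (n, u))) y" by (auto, metis prog_code.simps(8))
    then show ?thesis
    proof cases
      case 1
      then show ?thesis using eval.intros(8)[of p f "pi1 x" y g] x Rec by simp
    next
      case 2
      then show ?thesis using eval.intros(9)[OF 2(2,3)] x Rec by (metis 2(1))
    qed
  next
    case (Mu f)
    with st run_step(2) have "eval p f (prod_encode (x, y)) 0"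
      "\<forall>m<y. \<exists>u. eval p f (prod_encode (x, m)) (Suc u)" by (auto, blast)
    then show ?thesis using Mu by (auto intro: eval.intros)
  qed (use st run_step(2) in \<open>auto simp: graph_def pi1_def pi2_def intro: eval.intros\<close>)
qed

lemma run_graph_iff: "run (graph p) (prog_code e) x y \<longleftrightarrow> eval p e x y"
  using eval_run run_eval by blast

lemma phi_eq_SomeD:
  assumes "phi e p = Some q" shows "eval p e k (q k)"
proof -
  from assms obtain r where r: "\<forall>k. eval p e k (r k)" and q: "q = (THE q. \<forall>k. eval p e k (q k))"
    by (auto simp: phi_def split: if_splits)
  have "(THE q. \<forall>k. eval p e k (q k)) = r"
    using r eval_functional by (intro the_equality) blast+
  with r q show ?thesis by simp
qed

lemma phi_eq_Some: "phi e p = Some q \<longleftrightarrow> (\<forall>k. eval p e k (q k))"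
proof
  assume *: "\<forall>k. eval p e k (q k)"
  have "(THE q. \<forall>k. eval p e k (q k)) = q"
    using * eval_functional by (intro the_equality) blast+
  with * show "phi e p = Some q" unfolding phi_def by auto
qed (use phi_eq_SomeD in blast)

text \<open>Machines are composed at the level of graphs: the relation computed by one machine
  serves as the oracle of the next.\<close>

lemma run_phi: "phi e p = Some q \<Longrightarrow> run (graph p) (prog_code e) = graph q"
  unfolding phi_eq_Some
  by (intro ext) (metis run_graph_iff graph_def eval_functional)

text \<open>
  Finite derivations, entries being justified by the entries behind them, make the graph of the
  machine semidecidable relative to any semidecidable graph of an oracle.
\<close>

primrec deriv :: "orc \<Rightarrow> (nat \<times> nat \<times> nat) list \<Rightarrow> bool" where
  "deriv G [] \<longleftrightarrow> True"
| "deriv G (z # l) \<longleftrightarrow> deriv G l \<and>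
     step G (\<lambda>E x y. (E, x, y) \<in> set l) (fst z) (fst (snd z)) (snd (snd z))"

lemma deriv_append: "deriv G l \<Longrightarrow> deriv G l' \<Longrightarrow> deriv G (l @ l')"
  by (induction l) (auto elim!: step_mono[rotated 2] simp: le_fun_def)

text \<open>Every rule instance depends on finitely many calls, also in the case of
  \<open>Mu\<close>, where their number is not fixed in advance. The derivations of these calls are
  concatenated and the new entry is put in front.\<close>

lemma run_deriv:
  assumes "run G E x y" shows "\<exists>l. deriv G l \<and> (E, x, y) \<in> set l"
  using assms
proof (induction rule: run.induct)
  case (run_step E x y)
  let ?X = "\<lambda>E x y. \<exists>l. deriv G l \<and> (E, x, y) \<in> set l"
  have st: "step G ?X E x y" by (rule step_mono[OF _ _ run_step]) (auto simp: le_fun_def)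
  have join: "\<exists>l. deriv G l \<and> (\<forall>z\<in>Z. z \<in> set l)"
    if "finite Z" "\<forall>(E, x, y)\<in>Z. ?X E x y" for Z :: "(nat \<times> nat \<times> nat) set"
    using that
  proof (induction Z)
    case (insert z Z)
    then obtain l where l: "deriv G l" "\<forall>z\<in>Z. z \<in> set l" by auto
    from insert.prems obtain l' where l': "deriv G l'" "z \<in> set l'" by (cases z) auto
    show ?case using deriv_append[OF l'(1) l(1)] l(2) l'(2) by (intro exI[of _ "l' @ l"]) auto
  qed (auto intro: exI[of _ "[]"])
  have "\<exists>Z. finite Z \<and> (\<forall>(E, x, y)\<in>Z. ?X E x y) \<and> step G (\<lambda>E x y. (E, x, y) \<in> Z) E x y"
    using st[unfolded step_def]
  proof (elim disjE exE conjE, goal_cases)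
    case (6 c)
    then show ?case unfolding step_def
      by (intro exI[of _ "{(pi1 c, x, pi1 y), (pi2 c, x, pi2 y)}"]) auto
  next
    case (7 c u)
    then show ?case unfolding step_def
      by (intro exI[of _ "{(pi2 c, x, u), (pi1 c, u, y)}"]) auto
  next
    case (8 c)
    then show ?case unfolding step_def
      by (intro exI[of _ "{(pi1 c, pi1 x, y)}"]) auto
  next
    case (9 c n u)
    then show ?case unfolding step_def
      by (intro exI[of _ "{(E, prod_encode (pi1 x, n), u), (pi2 c, prod_encode (pi1 x, prod_encode (n, u)), y)}"])
         auto
  next
    case (10 c)
    from 10 obtain u where u: "\<forall>m<y. ?X c (prod_encode (x, m)) (Suc (u m))" by metis
    show ?case unfolding step_def
      by (intro exI[of _ "insert (c, prod_encode (x, y), 0) ((\<lambda>m. (c, prod_encode (x, m), Suc (u m))) ` {..<y})"])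
         (use 10 u in auto)
  qed (intro exI[of _ "{}"]; simp add: step_def)+
  then obtain Z where Z: "finite Z" "\<forall>(E, x, y)\<in>Z. ?X E x y" "step G (\<lambda>E x y. (E, x, y) \<in> Z) E x y"
    by blast
  from join[OF Z(1,2)] obtain l where l: "deriv G l" "\<forall>z\<in>Z. z \<in> set l" by blast
  have "deriv G ((E, x, y) # l)"
    using l(1) step_mono[OF _ _ Z(3), of G "\<lambda>E x y. (E, x, y) \<in> set l"] l(2)
    by (auto simp: le_fun_def)
  then show ?case by (intro exI[of _ "(E, x, y) # l"]) auto
qed

lemma deriv_run: "deriv G l \<Longrightarrow> (E, x, y) \<in> set l \<Longrightarrow> run G E x y"
proof (induction l arbitrary: E x y)
  case (Cons z l)
  then have "step G (run G) (fst z) (fst (snd z)) (snd (snd z))"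
    by (auto elim!: step_mono[rotated 2] simp: le_fun_def)
  from run_step[OF this] Cons show ?case by auto
qed simp

definition restr :: "nat \<Rightarrow> baire \<Rightarrow> orc" where
  "restr N p = (\<lambda>x y. x < N \<and> y = p x)"

lemma restr_mono: "N \<le> M \<Longrightarrow> restr N p \<le> restr M p"
  by (auto simp: restr_def le_fun_def)

lemma deriv_mono: "G \<le> H \<Longrightarrow> deriv G l \<Longrightarrow> deriv H l"
  by (induction l) (auto elim!: step_mono[rotated 2])

text \<open>A derivation is finite and so consults only finitely many places of the oracle.
  Continuity and measurability arguments about machines rest on this.\<close>

lemma run_finite_use:
  assumes "run (graph p) E x y" shows "\<exists>N. run (restr N p) E x y"
proof -
  have "deriv (graph p) l \<Longrightarrow> \<exists>N. deriv (restr N p) l" for l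
  proof (induction l)
    case (Cons z l)
    then obtain N where N: "deriv (restr N p) l" by auto
    \<comment> \<open>Only an oracle entry consults \<open>p\<close>, and it does so at its own
      argument. A bound above the arguments of all entries is therefore large enough.\<close>
    define M where "M = max N (Suc (fst (snd z)))"
    have "step (restr M p) (\<lambda>E x y. (E, x, y) \<in> set l) (fst z) (fst (snd z)) (snd (snd z))"
      using Cons.prems unfolding deriv.simps step_def restr_def graph_def M_def by auto
    moreover have "deriv (restr M p) l"
      by (rule deriv_mono[OF restr_mono N]) (simp add: M_def)
    ultimately show ?case by auto
  qed simp
  then show ?thesis using run_deriv[OF assms] deriv_run by metis
qed

text \<open>A universal Sigma-1 formula: \<open>w\<close> codes a derivation of length
  \<open>n\<close> in which justifications stand at later places. All universal quantifiers are
  bounded, so the relation is semidecidable as soon as \<open>G\<close> is.\<close>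

lemma run_iff_coded:
  "run G E x y \<longleftrightarrow> (\<exists>w n. (\<exists>k<n. el w k = prod_encode (E, prod_encode (x, y))) \<and>
     (\<forall>i<n. step G (\<lambda>E x y. \<exists>j<n. i < j \<and> el w j = prod_encode (E, prod_encode (x, y)))
        (pi1 (el w i)) (pi1 (pi2 (el w i))) (pi2 (pi2 (el w i)))))"
  (is "_ \<longleftrightarrow> (\<exists>w n. ?C w n)")
proof
  assume "run G E x y"
  then obtain l where l: "deriv G l" "(E, x, y) \<in> set l" using run_deriv by blast
  define w where "w = list_encode (map (\<lambda>z. prod_encode (fst z, prod_encode (fst (snd z), snd (snd z)))) l)"
  have w: "el w i = prod_encode (fst (l ! i), prod_encode (fst (snd (l ! i)), snd (snd (l ! i))))" if "i < length l" for i
    using that by (simp add: w_def el_list_encode)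
  have "step G (\<lambda>E x y. \<exists>j<length l. i < j \<and> l ! j = (E, x, y)) (fst (l ! i)) (fst (snd (l ! i))) (snd (snd (l ! i)))"
    if "i < length l" "deriv G l" for i l
    using that
  proof (induction l arbitrary: i)
    case (Cons z l)
    show ?case
    proof (cases i)
      case 0
      have "(\<lambda>E x y. (E, x, y) \<in> set l) \<le> (\<lambda>E x y. \<exists>j<length (z # l). i < j \<and> (z # l) ! j = (E, x, y))"
        using 0 by (force simp: le_fun_def in_set_conv_nth)
      from step_mono[OF order_refl this] Cons.prems 0 show ?thesis by auto
    next
      case (Suc k)
      have "(\<lambda>E x y. \<exists>j<length l. k < j \<and> l ! j = (E, x, y)) \<le> (\<lambda>E x y. \<exists>j<length (z # l). i < j \<and> (z # l) ! j = (E, x, y))"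
        unfolding le_fun_def le_bool_def by (metis Suc Suc_less_eq length_Cons nth_Cons_Suc)
      from step_mono[OF order_refl this] Cons Suc show ?thesis by auto
    qed
  qed simp
  note this[OF _ l(1)]
  moreover have "(\<lambda>E x y. \<exists>j<length l. i < j \<and> l ! j = (E, x, y)) \<le>
     (\<lambda>E x y. \<exists>j<length l. i < j \<and> el w j = prod_encode (E, prod_encode (x, y)))" for i
    using w by (auto simp: le_fun_def)
  ultimately have "step G (\<lambda>E x y. \<exists>j<length l. i < j \<and> el w j = prod_encode (E, prod_encode (x, y)))
        (fst (l ! i)) (fst (snd (l ! i))) (snd (snd (l ! i)))" if "i < length l" for i
    using step_mono[OF order_refl] that by blast
  note st = this
  have "?C w (length l)"
  proof (intro conjI allI impI)
    obtain k where "k < length l" "l ! k = (E, x, y)" using l(2) by (auto simp: in_set_conv_nth)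
    then show "\<exists>k<length l. el w k = prod_encode (E, prod_encode (x, y))" using w[of k] by auto
  next
    fix i assume "i < length l"
    then show "step G (\<lambda>E x y. \<exists>j<length l. i < j \<and> el w j = prod_encode (E, prod_encode (x, y)))
        (pi1 (el w i)) (pi1 (pi2 (el w i))) (pi2 (pi2 (el w i)))"
      using st[of i] w[of i] by (cases "l ! i") simp
  qed
  then show "\<exists>w n. ?C w n" by blast
next
  assume "\<exists>w n. ?C w n"
  then obtain w n where C: "?C w n" by blast
  have "run G (pi1 (el w i)) (pi1 (pi2 (el w i))) (pi2 (pi2 (el w i)))" if "i < n" for i
    using that
  \<comment> \<open>Justifications point towards the end of the list, so the induction starts
    there.\<close>
  proof (induction "n - i" arbitrary: i rule: less_induct)
    case less
    have "run G E x y" if "j < n" "i < j" "el w j = prod_encode (E, prod_encode (x, y))" for j E x y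
      using less.hyps[of j] that by auto
    then have "(\<lambda>E x y. \<exists>j<n. i < j \<and> el w j = prod_encode (E, prod_encode (x, y))) \<le> run G"
      by (auto simp: le_fun_def)
    from step_mono[OF order_refl this] C less.prems show ?case
      by (intro run_step) blast
  qed
  with C show "run G E x y" by (metis pi_simps(1,2))
qed

lemma sig_run [cintros]:
  assumes G: "sig (\<lambda>p z. G p (pi1 z) (pi1 (pi2 z)) (pi2 (pi2 z)))"
    and E: "tot E" and f: "tot f" and g: "tot g"
  shows "sig (\<lambda>p z. run (G p z) (E p z) (f p z) (g p z))"
proof -
  have G3: "sig (\<lambda>p z. G p (h p z) (f p z) (g p z))" if "tot h" "tot f" "tot g" for h f g
    using sig_comp[OF G, of "\<lambda>p z. prod_encode (h p z, prod_encode (f p z, g p z))"] that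
    by (simp add: cintros)
  have "sig (\<lambda>p z. run (G p (pi1 z)) (pi1 (pi2 z)) (pi1 (pi2 (pi2 z))) (pi2 (pi2 (pi2 z))))"
    unfolding run_iff_coded step_def
    by (intro cintros G3)
  from sig_comp[OF this, of "\<lambda>p z. prod_encode (z, prod_encode (E p z, prod_encode (f p z, g p z)))"]
  show ?thesis using E f g by (simp add: cintros)
qed


section \<open>Operations on names\<close>

abbreviation sigR :: "(baire \<Rightarrow> nat \<Rightarrow> nat \<Rightarrow> nat \<Rightarrow> bool) \<Rightarrow> bool" where
  "sigR G \<equiv> sig (\<lambda>p z. G p (pi1 z) (pi1 (pi2 z)) (pi2 (pi2 z)))"

text \<open>A relational counterpart of \<open>pair_seq\<close>: the arguments may be outputs of
  machines, which are available only as semidecidable graphs.\<close>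

definition pairR :: "orc \<Rightarrow> orc \<Rightarrow> orc" where
  "pairR G H i y \<longleftrightarrow> (even i \<longrightarrow> G (i div 2) y) \<and> (odd i \<longrightarrow> H (i div 2) y)"

definition natR :: "nat \<Rightarrow> orc" where
  "natR n i y \<longleftrightarrow> (if i = n then y = 1 else y = 0)"

definition tagR :: "nat \<Rightarrow> orc \<Rightarrow> orc" where
  "tagR c G i y \<longleftrightarrow> i < c \<and> y = 0 \<or> i = c \<and> y = 1 \<or> c < i \<and> G (i - Suc c) y"

text \<open>Evaluation in a function space: \<open>E\<close> is the program number read off the
  prefix of zeros and the first 1, and the rest of the name is the parameter of that
  program.\<close>

definition applyR :: "orc \<Rightarrow> orc \<Rightarrow> orc" where
  "applyR F G i y \<longleftrightarrow> (\<exists>E. F E 1 \<and> (\<forall>k<E. F k 0) \<and> run (pairR (\<lambda>k. F (k + Suc E)) G) E i y)"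

lemma pairR_graph: "pairR (graph p) (graph q) = graph (pair_seq p q)"
  by (intro ext) (auto simp: pairR_def graph_def pair_seq_def)

lemma natR_graph: "natR n = graph (tag n (\<lambda>_. 0))"
  by (intro ext) (auto simp: natR_def graph_def tag_def)

lemma tagR_graph: "tagR c (graph p) = graph (tag c p)"
  by (intro ext) (auto simp: tagR_def graph_def tag_def)

lemma applyR_graph_tag: "applyR (graph (tag c p)) G = run (pairR (graph p) G) c"
proof (intro ext iffI)
  fix i y
  assume "applyR (graph (tag c p)) G i y"
  then obtain E where E: "tag c p E = 1" "\<forall>k<E. tag c p k = 0"
    and r: "run (pairR (\<lambda>k. graph (tag c p) (k + Suc E)) G) E i y"
    by (auto simp: applyR_def graph_def)
  have "\<not> E < c" using E(1) by (auto simp: tag_def)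
  moreover have "\<not> c < E" using E(2) by (auto simp: tag_def split: if_splits)
  ultimately have "E = c" by simp
  with r show "run (pairR (graph p) G) c i y" by (simp add: graph_def tag_def)
next
  fix i y
  assume "run (pairR (graph p) G) c i y"
  then show "applyR (graph (tag c p)) G i y"
    by (auto simp: applyR_def graph_def tag_def intro!: exI[of _ c])
qed

lemma tag_inject: "tag c p = tag d q \<longleftrightarrow> c = d \<and> p = q"
proof
  assume eq: "tag c p = tag d q"
  have "c = d"
  proof (rule linorder_cases[of c d])
    assume "c < d"
    then show ?thesis using fun_cong[OF eq, of c] by (simp add: tag_def)
  next
    assume "d < c"
    then show ?thesis using fun_cong[OF eq, of d] by (simp add: tag_def)
  qed
  moreover have "p i = q i" for i using fun_cong[OF eq, of "i + Suc c"] \<open>c = d\<close> by (simp add: tag_def)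
  ultimately show "c = d \<and> p = q" by auto
qed simp

lemma pair_seq_inject: "pair_seq p q = pair_seq p' q' \<longleftrightarrow> p = p' \<and> q = q'"
proof
  assume eq: "pair_seq p q = pair_seq p' q'"
  have "p i = p' i" "q i = q' i" for i
    using fun_cong[OF eq, of "2 * i"] fun_cong[OF eq, of "Suc (2 * i)"] by (auto simp: pair_seq_def)
  then show "p = p' \<and> q = q'" by auto
qed simp

lemma sig_graph [cintros]:
  assumes "tot (\<lambda>p z. q p (pi1 z) (pi2 z))" "tot f" "tot g"
  shows "sig (\<lambda>p z. graph (q p z) (f p z) (g p z))"
  unfolding graph_def using tot_comp[OF assms(1), of "\<lambda>p z. prod_encode (z, f p z)"] assms(2,3)
  by (intro cintros) (simp_all add: cintros)

lemma sig_natR [cintros]: "tot n \<Longrightarrow> tot f \<Longrightarrow> tot g \<Longrightarrow> sig (\<lambda>p z. natR (n p z) (f p z) (g p z))"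
proof -
  assume "tot n" "tot f" "tot g"
  then have "sig (\<lambda>p z. (f p z = n p z \<longrightarrow> g p z = 1) \<and> (f p z \<noteq> n p z \<longrightarrow> g p z = 0))"
    by (intro cintros)
  then show ?thesis by (rule sig_cong) (auto simp: natR_def)
qed

lemma sig_subst3:
  assumes "sigR G" "tot h" "tot f" "tot g"
  shows "sig (\<lambda>p z. G p (h p z) (f p z) (g p z))"
  using sig_comp[OF assms(1), of "\<lambda>p z. prod_encode (h p z, prod_encode (f p z, g p z))"] assms(2-)
  by (simp add: cintros)

lemma sig_pairR [cintros]:
  assumes "sigR G"
    and "sigR H" and "tot f" "tot g"
  shows "sig (\<lambda>p z. pairR (G p z) (H p z) (f p z) (g p z))"
  unfolding pairR_def by (intro cintros assms sig_subst3[OF assms(1)] sig_subst3[OF assms(2)])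

lemma sig_tagR [cintros]:
  assumes "sigR G" and "tot c" "tot f" "tot g"
  shows "sig (\<lambda>p z. tagR (c p z) (G p z) (f p z) (g p z))"
  unfolding tagR_def by (intro cintros assms sig_subst3[OF assms(1)])

lemma sig_applyR [cintros]:
  assumes "sigR F"
    and "sigR H" and "tot f" "tot g"
  shows "sig (\<lambda>p z. applyR (F p z) (H p z) (f p z) (g p z))"
  unfolding applyR_def
  by (intro cintros sig_subst3[OF assms(1)] sig_subst3[OF assms(2)] assms tot_comp[OF assms(3)] tot_comp[OF assms(4)])

text \<open>The graph contains only one value for each argument, so searching it can only return the
  right one.\<close>

lemma tot_of_sig:
  assumes "sig (\<lambda>p z. pi2 z = f p (pi1 z))" shows "tot f"
proof -
  obtain e where e: "\<And>p x y. pi2 (prod_encode (x, y)) = f p (pi1 (prod_encode (x, y))) \<Longrightarrow>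
      \<exists>y'. eval p e x y' \<and> pi2 (prod_encode (x, y')) = f p (pi1 (prod_encode (x, y')))"
    using sig_search[OF assms] by blast
  have "eval p e x (f p x)" for p x using e[of x "f p x" p] by simp
  then show ?thesis unfolding tot_def by blast
qed

lemma tot_computable_seq:
  assumes "computable_seq m" "tot f" shows "tot (\<lambda>p x. m (f p x))"
proof -
  obtain e where "phi e (\<lambda>_. 0) = Some m" using assms(1) unfolding computable_seq_def by blast
  from run_phi[OF this] have r: "run (graph (\<lambda>_. 0)) (prog_code e) = graph m" .
  have "sig (\<lambda>p z. run (graph (\<lambda>_. 0)) (prog_code e) (pi1 z) (pi2 z))"
    by (rule sig_run[OF sig_graph]) (intro cintros)+
  then have "sig (\<lambda>p z. pi2 z = m (pi1 z))" unfolding r by (simp add: graph_def)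
  then have "tot (\<lambda>p. m)" by (rule tot_of_sig)
  from tot_comp[OF this assms(2)] show ?thesis .
qed

section \<open>Names in product and function spaces\<close>

lemma rep_of_SomeD: "rep_of R p = Some x \<Longrightarrow> R p x"
  unfolding rep_of_def by (metis option.discI option.inject theI')

lemma rep_of_Some: "R p x \<Longrightarrow> (\<And>y. R p y \<Longrightarrow> y = x) \<Longrightarrow> rep_of R p = Some x"
  unfolding rep_of_def by (metis the_equality)

lemma rep_nat_tag: "rep_nat (tag n (\<lambda>_. 0)) = Some n"
  unfolding rep_nat_def by (rule rep_of_Some) (auto simp: tag_inject)

lemma rep_nat_SomeD: "rep_nat p = Some n \<Longrightarrow> p = tag n (\<lambda>_. 0)"
  unfolding rep_nat_def using rep_of_SomeD[of "\<lambda>p n. p = tag n (\<lambda>_. 0)" p n] by simp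

lemma ran_rep_nat: "ran rep_nat = UNIV"
  using rep_nat_tag by (auto simp: ran_def)

lemma rep_prod_pair:
  "\<delta>X p = Some x \<Longrightarrow> \<delta>Y q = Some y \<Longrightarrow> rep_prod \<delta>X \<delta>Y (pair_seq p q) = Some (x, y)"
  unfolding rep_prod_def by (rule rep_of_Some) (auto simp: pair_seq_inject)

lemma rep_prod_SomeD:
  "rep_prod \<delta>X \<delta>Y r = Some z \<Longrightarrow> \<exists>p q. r = pair_seq p q \<and> \<delta>X p = Some (fst z) \<and> \<delta>Y q = Some (snd z)"
  unfolding rep_prod_def by (drule rep_of_SomeD) (auto split: prod.splits)

lemma rep_fun_SomeD:
  assumes "rep_fun \<delta>X \<delta>Y r = Some f"
  shows "f \<in> ran \<delta>X \<rightarrow>\<^sub>E ran \<delta>Y"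
    and "\<exists>e p. r = tag (prog_code e) p \<and> realizes \<delta>X \<delta>Y (\<lambda>q. phi e (pair_seq p q)) (\<lambda>x. {f x})"
  using rep_of_SomeD[OF assms[unfolded rep_fun_def]] by auto

lemma rep_fun_tag:
  assumes "f \<in> ran \<delta>X \<rightarrow>\<^sub>E ran \<delta>Y"
    and "\<And>q x. \<delta>X q = Some x \<Longrightarrow> \<exists>r. phi e (pair_seq p q) = Some r \<and> \<delta>Y r = Some (f x)"
  shows "rep_fun \<delta>X \<delta>Y (tag (prog_code e) p) = Some f"
  unfolding rep_fun_def
proof (rule rep_of_Some)
  show "f \<in> ran \<delta>X \<rightarrow>\<^sub>E ran \<delta>Y \<and> (\<exists>e' p'. tag (prog_code e) p = tag (prog_code e') p' \<and>
      realizes \<delta>X \<delta>Y (\<lambda>q. phi e' (pair_seq p' q)) (\<lambda>x. {f x}))"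
    using assms by (intro conjI exI[of _ e] exI[of _ p]) (auto simp: realizes_def)
next
  fix g
  assume g: "g \<in> ran \<delta>X \<rightarrow>\<^sub>E ran \<delta>Y \<and> (\<exists>e' p'. tag (prog_code e) p = tag (prog_code e') p' \<and>
      realizes \<delta>X \<delta>Y (\<lambda>q. phi e' (pair_seq p' q)) (\<lambda>x. {g x}))"
  then have re: "realizes \<delta>X \<delta>Y (\<lambda>q. phi e (pair_seq p q)) (\<lambda>x. {g x})"
    using bij_prog_code by (auto simp: tag_inject dest!: bij_is_inj injD)
  have "g x = f x" if "x \<in> ran \<delta>X" for x
  proof -
    from that obtain q where "\<delta>X q = Some x" by (auto simp: ran_def)
    with assms(2)[OF this] re show ?thesis unfolding realizes_def by force
  qed
  with g assms(1) show "g = f" by (blast intro: PiE_ext)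
qed

lemma applyR_rep_fun:
  assumes "rep_fun \<delta>X \<delta>Y r = Some f" "\<delta>X p = Some x"
  shows "\<exists>q. applyR (graph r) (graph p) = graph q \<and> \<delta>Y q = Some (f x)"
proof -
  obtain e p' where r: "r = tag (prog_code e) p'"
    and re: "realizes \<delta>X \<delta>Y (\<lambda>q. phi e (pair_seq p' q)) (\<lambda>x. {f x})"
    using rep_fun_SomeD(2)[OF assms(1)] by blast
  from re assms(2) obtain q where q: "phi e (pair_seq p' p) = Some q" "\<delta>Y q = Some (f x)"
    unfolding realizes_def by auto
  have "applyR (graph r) (graph p) = graph q"
    unfolding r applyR_graph_tag pairR_graph by (rule run_phi[OF q(1)])
  with q(2) show ?thesis by blast
qed

lemma applyR_rep_fun_nat:
  "rep_fun rep_nat \<delta>Y r = Some f \<Longrightarrow> \<exists>q. applyR (graph r) (natR n) = graph q \<and> \<delta>Y q = Some (f n)"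
  unfolding natR_graph using applyR_rep_fun[of rep_nat \<delta>Y r f "tag n (\<lambda>_. 0)" n] rep_nat_tag by simp

lemma rep_computable_run:
  assumes "rep_computable \<delta>X \<delta>Y f"
  shows "\<exists>E. \<forall>p x. \<delta>X p = Some x \<and> f x \<noteq> {} \<longrightarrow> (\<exists>q y. run (graph p) E = graph q \<and> \<delta>Y q = Some y \<and> y \<in> f x)"
proof -
  obtain F e where F: "F \<subseteq>\<^sub>m phi e" "realizes \<delta>X \<delta>Y F f"
    using assms unfolding rep_computable_def computable_def by blast
  have "\<exists>q y. run (graph p) (prog_code e) = graph q \<and> \<delta>Y q = Some y \<and> y \<in> f x"
    if px: "\<delta>X p = Some x" "f x \<noteq> {}" for p x
  proof -
    obtain q y where q: "F p = Some q" "\<delta>Y q = Some y" "y \<in> f x"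
      using F(2) px unfolding realizes_def by blast
    have "phi e p = Some q" using F(1) q(1) by (auto simp: map_le_def dom_def)
    from run_phi[OF this] q show ?thesis by blast
  qed
  then show ?thesis by blast
qed

text \<open>Semidecidable relations are open in the oracle. This is what makes sets with a name in
  \<open>rep_open\<close> topologically open.\<close>

lemma sig_finite_use:
  assumes "sig R" "R p x" shows "\<exists>N. \<forall>q. (\<forall>i<N. q i = p i) \<longrightarrow> R q x"
proof -
  obtain e where e: "\<And>p x. R p x \<longleftrightarrow> (\<exists>y. eval p e x y)" using sig_semidecidable[OF assms(1)] by blast
  with assms(2) obtain y where "run (graph p) (prog_code e) x y" by (auto simp: run_graph_iff)
  from run_finite_use[OF this] obtain N where N: "run (restr N p) (prog_code e) x y" by blast
  have "R q x" if "\<forall>i<N. q i = p i" for q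
  proof -
    have "restr N p \<le> graph q" using that by (auto simp: restr_def graph_def le_fun_def)
    from run_mono[OF N this] show ?thesis by (auto simp: e run_graph_iff)
  qed
  then show ?thesis by blast
qed

subsection \<open>Rational numbers\<close>

abbreviation rt :: "nat \<Rightarrow> real" where "rt r \<equiv> of_rat (nat_to_rat_surj r)"

definition ipos :: "nat \<Rightarrow> nat" where "ipos n = (if even n then n div 2 else 0)"
definition ineg :: "nat \<Rightarrow> nat" where "ineg n = (if even n then 0 else Suc (n div 2))"
text \<open>A rational is coded by integer codes of numerator and denominator. An odd denominator
  code means a negative denominator and swaps the signs; code 0 means denominator 0, where the value
  is 0 by convention and is written as 0 over 1. Splitting into positive and negative parts keeps
  all arithmetic within the natural numbers.\<close>

definition rpos :: "nat \<Rightarrow> nat" where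
  "rpos r = (if pi2 r = 0 then 0 else if even (pi2 r) then ipos (pi1 r) else ineg (pi1 r))"
definition rneg :: "nat \<Rightarrow> nat" where
  "rneg r = (if pi2 r = 0 then 0 else if even (pi2 r) then ineg (pi1 r) else ipos (pi1 r))"
definition rden :: "nat \<Rightarrow> nat" where
  "rden r = (if pi2 r = 0 then 1 else if even (pi2 r) then ipos (pi2 r) else ineg (pi2 r))"

lemma tot_rat [cintros]:
  "tot f \<Longrightarrow> tot (\<lambda>p x. rpos (f p x))" "tot f \<Longrightarrow> tot (\<lambda>p x. rneg (f p x))"
  "tot f \<Longrightarrow> tot (\<lambda>p x. rden (f p x))"
  unfolding rpos_def rneg_def rden_def ipos_def ineg_def by (intro cintros; assumption)+

lemma int_decode_eq: "int_decode n = int (ipos n) - int (ineg n)"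
  by (auto simp: int_decode_def sum_decode_def ipos_def ineg_def)

lemma rden_pos: "0 < rden r"
  by (auto simp: rden_def ipos_def ineg_def elim!: evenE)

lemma rt_eq: "rt r = (real (rpos r) - real (rneg r)) / real (rden r)"
proof -
  have "rt r = of_int (int_decode (pi1 r)) / of_int (int_decode (pi2 r))"
    by (simp add: nat_to_rat_surj_def pi1_def pi2_def split: prod.split)
       (metis Fract_of_int_quotient of_rat_divide of_rat_of_int_eq)
  also have "\<dots> = (real (rpos r) - real (rneg r)) / real (rden r)"
    unfolding int_decode_eq
    by (auto simp: rpos_def rneg_def rden_def ipos_def ineg_def divide_simps) (simp_all add: algebra_simps)
  finally show ?thesis .
qed

lemma rt_add: "rt r + (1/2) ^ i =
    (real (rpos r * 2 ^ i + rden r) - real (rneg r * 2 ^ i)) / real (rden r * 2 ^ i)"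
  and rt_diff: "rt r - real m * (1/2) ^ i =
    (real (rpos r * 2 ^ i) - real (rneg r * 2 ^ i + m * rden r)) / real (rden r * 2 ^ i)"
  using rden_pos[of r] by (simp_all add: rt_eq field_simps power_divide)

text \<open>Cross-multiplying and moving the negative terms to the other side leaves a comparison of
  natural numbers.\<close>

lemma dec_frac_less:
  assumes "tot a" "tot b" "tot d" "tot a'" "tot b'" "tot d'" and "\<And>p z. 0 < d p z" "\<And>p z. 0 < d' p z"
  shows "dec (\<lambda>p z. (real (a p z) - real (b p z)) / real (d p z) < (real (a' p z) - real (b' p z)) / real (d' p z))"
proof -
  have eq: "(real a - real b) / real d < (real a' - real b') / real d' \<longleftrightarrow> a * d' + b' * d < a' * d + b * d'"
    if "0 < d" "0 < d'" for a b d a' b' d'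
  proof -
    have "(real a - real b) / real d < (real a' - real b') / real d' \<longleftrightarrow>
        (real a - real b) * real d' < (real a' - real b') * real d"
      using that by (simp add: field_simps)
    also have "\<dots> \<longleftrightarrow> real (a * d' + b' * d) < real (a' * d + b * d')"
      by (simp add: algebra_simps)
    finally show ?thesis by (simp only: of_nat_less_iff)
  qed
  show ?thesis unfolding eq[OF assms(7,8)] using assms(1-6) by (intro cintros)
qed

lemma dec_rt [cintros]:
  assumes "tot r" "tot i"
  shows "tot k \<Longrightarrow> tot a \<Longrightarrow> dec (\<lambda>p z. rt (r p z) + (1/2) ^ i p z < real (k p z) / 2 ^ a p z)"
    and "tot k \<Longrightarrow> tot a \<Longrightarrow> dec (\<lambda>p z. real (k p z) / 2 ^ a p z < rt (r p z) - (1/2) ^ i p z)"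
    and "tot m \<Longrightarrow> tot c \<Longrightarrow> dec (\<lambda>p z. rt (r p z) + (1/2) ^ i p z < rt (c p z) - 2 * (1/2) ^ m p z)"
proof -
  have frac: "real k / 2 ^ a = (real k - real 0) / real (2 ^ a)" for k a by simp
  show "dec (\<lambda>p z. rt (r p z) + (1/2) ^ i p z < real (k p z) / 2 ^ a p z)" if "tot k" "tot a"
    unfolding rt_add frac by (intro dec_frac_less cintros assms that) (simp_all add: rden_pos)
  have "dec (\<lambda>p z. real (k p z) / 2 ^ a p z < rt (r p z) - real 1 * (1/2) ^ i p z)" if "tot k" "tot a"
    unfolding rt_diff frac by (intro dec_frac_less cintros assms that) (simp_all add: rden_pos)
  then show "tot k \<Longrightarrow> tot a \<Longrightarrow> dec (\<lambda>p z. real (k p z) / 2 ^ a p z < rt (r p z) - (1/2) ^ i p z)"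
    by simp
  have "dec (\<lambda>p z. rt (r p z) + (1/2) ^ i p z < rt (c p z) - real 2 * (1/2) ^ m p z)" if "tot m" "tot c"
    unfolding rt_diff rt_add by (intro dec_frac_less cintros assms that) (simp_all add: rden_pos)
  then show "tot m \<Longrightarrow> tot c \<Longrightarrow> dec (\<lambda>p z. rt (r p z) + (1/2) ^ i p z < rt (c p z) - 2 * (1/2) ^ m p z)"
    by simp
qed

section \<open>Algorithms in computable metric spaces\<close>

definition ball_sum :: "(nat \<Rightarrow> 'x::metric_space) \<Rightarrow> (nat \<Rightarrow> nat \<Rightarrow> nat \<Rightarrow> bool) \<Rightarrow> 'x set" where
  "ball_sum s B = {x. \<exists>i j r. B i j r \<and> dist (s j) x < rt r}"

locale comp_metric =
  fixes \<delta> :: "'x::polish_space rep" and s :: "nat \<Rightarrow> 'x"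
  assumes cms: "computable_metric_space \<delta> s"
begin

lemma ran_rep: "ran \<delta> = UNIV"
  using cms unfolding computable_metric_space_def by blast

lemma ex_name: "\<exists>p. \<delta> p = Some x"
  using ran_rep UNIV_I[of x] by (auto simp: ran_def)

lemma dense: "0 < e \<Longrightarrow> \<exists>j. dist (s j) x < e"
proof -
  assume "0 < e"
  have "x \<in> closure (range s)" using cms unfolding computable_metric_space_def by simp
  with \<open>0 < e\<close> show ?thesis unfolding closure_approachable by blast
qed

definition dname :: baire where
  "dname = (SOME m. computable_seq m \<and> rep_fun rep_nat \<delta> m = Some s)"

lemma dname: "computable_seq dname" "rep_fun rep_nat \<delta> dname = Some s"
proof -
  have "\<exists>m. computable_seq m \<and> rep_fun rep_nat \<delta> m = Some s"
    using cms unfolding computable_metric_space_def computable_point_def by blast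
  then have "computable_seq dname \<and> rep_fun rep_nat \<delta> dname = Some s"
    unfolding dname_def by (rule someI_ex)
  then show "computable_seq dname" "rep_fun rep_nat \<delta> dname = Some s" by auto
qed

definition ptR :: "nat \<Rightarrow> orc" where "ptR j = applyR (graph dname) (natR j)"

lemma ptR: "\<exists>q. ptR j = graph q \<and> \<delta> q = Some (s j)"
  unfolding ptR_def by (rule applyR_rep_fun_nat[OF dname(2)])

lemma sig_ptR [cintros]:
  assumes "tot j" "tot f" "tot g" shows "sig (\<lambda>p z. ptR (j p z) (f p z) (g p z))"
  unfolding ptR_def by (intro cintros tot_computable_seq[OF dname(1)] assms tot_comp[OF assms(1)])

section \<open>Comparing distances with rational numbers\<close>

definition dist_prog :: "nat \<Rightarrow> bool" where
  "dist_prog E \<longleftrightarrow> (\<forall>p q x y. \<delta> p = Some x \<and> \<delta> q = Some y \<longrightarrow>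
     (\<exists>r. run (pairR (graph p) (graph q)) E = graph r \<and> (\<forall>i. \<bar>rt (r i) - dist x y\<bar> \<le> (1/2) ^ i)))"

text \<open>A machine number meeting the specification is fixed once and for all, so that in
  semidecidable relations it counts as a constant. The other codes below are chosen for the same
  reason.\<close>

definition dist_code :: nat where "dist_code = (SOME E. dist_prog E)"

lemma dist_code: "dist_prog dist_code"
proof -
  have "rep_computable (rep_prod \<delta> \<delta>) rep_real (\<lambda>(x, y). {dist x y})"
    using cms unfolding computable_metric_space_def by blast
  from rep_computable_run[OF this] obtain E where E: "\<And>p a b. rep_prod \<delta> \<delta> p = Some (a, b) \<Longrightarrow>
    \<exists>q. run (graph p) E = graph q \<and> rep_real q = Some (dist a b)"
    by auto
  have "dist_prog E"
    unfolding dist_prog_def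
  proof (intro allI impI)
    fix p q x y assume pq: "\<delta> p = Some x \<and> \<delta> q = Some y"
    from E[OF rep_prod_pair[of \<delta> p x \<delta> q y, OF pq[THEN conjunct1] pq[THEN conjunct2]]]
    obtain r where r: "run (graph (pair_seq p q)) E = graph r" "rep_real r = Some (dist x y)" by auto
    from r(2) have "\<forall>i. dist (rt (r i)) (dist x y) \<le> (1/2) ^ i"
      unfolding rep_real_def cauchy_rep_def by (drule_tac rep_of_SomeD) auto
    with r(1) show "\<exists>r. run (pairR (graph p) (graph q)) E = graph r \<and> (\<forall>i. \<bar>rt (r i) - dist x y\<bar> \<le> (1/2) ^ i)"
      by (auto simp: pairR_graph dist_real_def)
  qed
  then show ?thesis unfolding dist_code_def by (rule someI)
qed

lemma small_power: "0 < (e::real) \<Longrightarrow> \<exists>i. (1/2) ^ i < e"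
  using real_arch_pow_inv[of e "1/2"] by auto

lemma
  assumes "\<delta> p = Some x" "\<delta> q = Some y"
  shows dist_code_less:
      "(\<exists>i r. run (pairR (graph p) (graph q)) dist_code i r \<and> rt r + (1/2) ^ i < v) \<longleftrightarrow> dist x y < v"
    and dist_code_greater:
      "(\<exists>i r. run (pairR (graph p) (graph q)) dist_code i r \<and> v < rt r - (1/2) ^ i) \<longleftrightarrow> v < dist x y"
proof -
  obtain r where r: "run (pairR (graph p) (graph q)) dist_code = graph r"
    and d: "\<And>i. \<bar>rt (r i) - dist x y\<bar> \<le> (1/2) ^ i" using dist_code assms unfolding dist_prog_def by blast
  have *: "(\<exists>i r. run (pairR (graph p) (graph q)) dist_code i r \<and> Q i r) \<longleftrightarrow> (\<exists>i. Q i (r i))" for Q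
    unfolding r by (auto simp: graph_def)
  show "(\<exists>i r. run (pairR (graph p) (graph q)) dist_code i r \<and> rt r + (1/2) ^ i < v) \<longleftrightarrow> dist x y < v"
    unfolding *
  proof
    assume "\<exists>i. rt (r i) + (1/2) ^ i < v"
    then obtain i where "rt (r i) + (1/2) ^ i < v" ..
    with d[of i] show "dist x y < v" by linarith
  next
    assume "dist x y < v"
    \<comment> \<open>The error of the approximation and the added margin each cost
      \<open>(1/2) ^ i\<close>, so half of the gap has to exceed this.\<close>
    then obtain i where "(1/2) ^ i < (v - dist x y) / 2" using small_power[of "(v - dist x y) / 2"] by auto
    with d[of i] have "rt (r i) + (1/2) ^ i < v" by (simp add: abs_le_iff)
    then show "\<exists>i. rt (r i) + (1/2) ^ i < v" ..
  qed
  show "(\<exists>i r. run (pairR (graph p) (graph q)) dist_code i r \<and> v < rt r - (1/2) ^ i) \<longleftrightarrow> v < dist x y"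
    unfolding *
  proof
    assume "\<exists>i. v < rt (r i) - (1/2) ^ i"
    then obtain i where "v < rt (r i) - (1/2) ^ i" ..
    with d[of i] show "v < dist x y" by linarith
  next
    assume "v < dist x y"
    then obtain i where "(1/2) ^ i < (dist x y - v) / 2" using small_power[of "(dist x y - v) / 2"] by auto
    with d[of i] have "v < rt (r i) - (1/2) ^ i" by (simp add: abs_le_iff)
    then show "\<exists>i. v < rt (r i) - (1/2) ^ i" ..
  qed
qed

definition dltR :: "orc \<Rightarrow> orc \<Rightarrow> nat \<Rightarrow> nat \<Rightarrow> bool" where
  "dltR P Q k a \<longleftrightarrow> (\<exists>i r. run (pairR P Q) dist_code i r \<and> rt r + (1/2) ^ i < real k / 2 ^ a)"

definition dgtR :: "orc \<Rightarrow> orc \<Rightarrow> nat \<Rightarrow> nat \<Rightarrow> bool" where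
  "dgtR P Q k a \<longleftrightarrow> (\<exists>i r. run (pairR P Q) dist_code i r \<and> real k / 2 ^ a < rt r - (1/2) ^ i)"

text \<open>The margin \<open>2 * (1/2) ^ m\<close> is the accuracy guaranteed by
  \<open>close_h\<close>: the ball of that radius around an accepted point lies in the ball whose
  radius is coded by \<open>c\<close>.\<close>

definition dballR :: "orc \<Rightarrow> orc \<Rightarrow> nat \<Rightarrow> nat \<Rightarrow> bool" where
  "dballR P Q m c \<longleftrightarrow> (\<exists>i r. run (pairR P Q) dist_code i r \<and> rt r + (1/2) ^ i < rt c - 2 * (1/2) ^ m)"

lemma sig_dist [cintros]:
  assumes P: "sigR P" and Q: "sigR Q" and "tot a" "tot b"
  shows "sig (\<lambda>p z. dltR (P p z) (Q p z) (a p z) (b p z))"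
    and "sig (\<lambda>p z. dgtR (P p z) (Q p z) (a p z) (b p z))"
    and "sig (\<lambda>p z. dballR (P p z) (Q p z) (a p z) (b p z))"
  unfolding dltR_def dgtR_def dballR_def
  by (intro cintros sig_subst3[OF P] sig_subst3[OF Q] assms(3-4)[THEN tot_comp])+

section \<open>From fast Cauchy sequences to names\<close>

definition seq_prog :: "prog \<Rightarrow> bool" where
  "seq_prog e \<longleftrightarrow> (\<forall>q n. \<exists>r. phi e (pair_seq q (tag n (\<lambda>_. 0))) = Some r \<and> \<delta> r = Some (s (q n)))"

definition seq_code :: prog where "seq_code = (SOME e. seq_prog e)"

lemma seq_code: "seq_prog seq_code"
proof -
  \<comment> \<open>The odd half of the oracle is the name of the argument \<open>n\<close>, whose
    only 1 stands at place \<open>n\<close>. Hence \<open>n\<close> is recognised by a 1 at position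
    \<open>2 * n + 1\<close>, and the even half holds the sequence.\<close>
  have "sig (\<lambda>o' z. \<exists>n. o' (2 * n + 1) = 1 \<and> ptR (o' (2 * n)) (pi1 z) (pi2 z))"
    by (intro cintros)
  from sig_search[OF this] obtain e where e: "\<And>o' x y. \<exists>n. o' (2 * n + 1) = 1 \<and> ptR (o' (2 * n)) x y \<Longrightarrow>
    \<exists>y'. eval o' e x y' \<and> (\<exists>n. o' (2 * n + 1) = 1 \<and> ptR (o' (2 * n)) x y')"
    unfolding pi_simps by blast
  have "seq_prog e"
    unfolding seq_prog_def
  proof (intro allI)
    fix q :: baire and n
    obtain r where r: "ptR (q n) = graph r" "\<delta> r = Some (s (q n))" using ptR by blast
    let ?o = "pair_seq q (tag n (\<lambda>_. 0))"
    have o: "(\<exists>k. ?o (2 * k + 1) = 1 \<and> ptR (?o (2 * k)) x y) \<longleftrightarrow> y = r x" for x y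
      using r(1) by (auto simp: pair_seq_def tag_def graph_def split: if_splits)
    have "eval ?o e x (r x)" for x using e[of ?o x "r x"] unfolding o by simp
    with r(2) show "\<exists>r. phi e ?o = Some r \<and> \<delta> r = Some (s (q n))" by (auto simp: phi_eq_Some)
  qed
  then show ?thesis unfolding seq_code_def by (rule someI)
qed

definition lim_prog :: "nat \<Rightarrow> bool" where
  "lim_prog E \<longleftrightarrow> (\<forall>q x. (\<forall>n. dist (s (q n)) (s (q (Suc n))) < (1/2) ^ n) \<and> (\<lambda>n. s (q n)) \<longlonglongrightarrow> x \<longrightarrow>
     (\<exists>r. run (tagR (prog_code seq_code) (graph q)) E = graph r \<and> \<delta> r = Some x))"

definition lim_code :: nat where "lim_code = (SOME E. lim_prog E)"

text \<open>The given representation may differ from the Cauchy representation. The computable limit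
  map of the space converts a sequence of indices of dense points into a name.\<close>

definition limR :: "orc \<Rightarrow> orc" where "limR Q = run (tagR (prog_code seq_code) Q) lim_code"

lemma sig_limR [cintros]:
  assumes Q: "sigR Q" and "tot f" "tot g"
  shows "sig (\<lambda>p z. limR (Q p z) (f p z) (g p z))"
  unfolding limR_def by (intro cintros sig_subst3[OF Q] assms)

lemma limR:
  assumes "\<And>n. dist (s (q n)) (s (q (Suc n))) < (1/2) ^ n" "(\<lambda>n. s (q n)) \<longlonglongrightarrow> x"
  shows "\<exists>r. limR (graph q) = graph r \<and> \<delta> r = Some x"
proof -
  have "rep_computable (rep_fun rep_nat \<delta>) \<delta>
       (\<lambda>r. {x. (\<forall>n. dist (r n) (r (Suc n)) < (1/2) ^ n) \<and> r \<longlonglongrightarrow> x})"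
    using cms unfolding computable_metric_space_def by blast
  from rep_computable_run[OF this] obtain E where E: "\<And>p r. rep_fun rep_nat \<delta> p = Some r \<Longrightarrow>
    {x. (\<forall>n. dist (r n) (r (Suc n)) < (1/2) ^ n) \<and> r \<longlonglongrightarrow> x} \<noteq> {} \<Longrightarrow>
    \<exists>q y. run (graph p) E = graph q \<and> \<delta> q = Some y \<and> r \<longlonglongrightarrow> y"
    by blast
  have "lim_prog E"
    unfolding lim_prog_def
  proof (intro allI impI)
    fix q x assume q: "(\<forall>n. dist (s (q n)) (s (q (Suc n))) < (1/2) ^ n) \<and> (\<lambda>n. s (q n)) \<longlonglongrightarrow> x"
    have "rep_fun rep_nat \<delta> (tag (prog_code seq_code) q) = Some (\<lambda>n. s (q n))"
    proof (rule rep_fun_tag)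
      show "(\<lambda>n. s (q n)) \<in> ran rep_nat \<rightarrow>\<^sub>E ran \<delta>" by (simp add: ran_rep_nat ran_rep)
    qed (use seq_code[unfolded seq_prog_def] rep_nat_SomeD in metis)
    from E[OF this] q obtain r y where "run (tagR (prog_code seq_code) (graph q)) E = graph r" "\<delta> r = Some y"
      "(\<lambda>n. s (q n)) \<longlonglongrightarrow> y" by (auto simp: tagR_graph)
    with q LIMSEQ_unique show "\<exists>r. run (tagR (prog_code seq_code) (graph q)) E = graph r \<and> \<delta> r = Some x" by blast
  qed
  then have "lim_prog lim_code" unfolding lim_code_def by (rule someI)
  with assms show ?thesis unfolding lim_prog_def limR_def by blast
qed

text \<open>The exponent \<open>n + 2\<close> brings consecutive terms closer than
  \<open>(1/2) ^ n\<close>, as the limit map demands. The inequality is strict so that any finite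
  part of the condition persists for nearby points.\<close>

definition fast :: "baire \<Rightarrow> 'x \<Rightarrow> bool" where
  "fast q x \<longleftrightarrow> (\<forall>n. dist (s (q n)) x < (1/2) ^ (n + 2))"

lemma limR_fast: "fast q x \<Longrightarrow> \<exists>r. limR (graph q) = graph r \<and> \<delta> r = Some x"
proof (rule limR)
  assume q: "fast q x"
  show "dist (s (q n)) (s (q (Suc n))) < (1/2) ^ n" for n
  proof -
    have "dist (s (q n)) (s (q (Suc n))) \<le> dist (s (q n)) x + dist (s (q (Suc n))) x"
      by (rule dist_triangle2)
    also have "\<dots> < (1/2) ^ (n + 2) + (1/2) ^ (Suc n + 2)"
      using q unfolding fast_def by (intro add_strict_mono) blast+
    also have "\<dots> \<le> (1/2 :: real) ^ n" by (simp add: field_simps)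
    finally show ?thesis .
  qed
  show "(\<lambda>n. s (q n)) \<longlonglongrightarrow> x"
  proof (rule metric_LIMSEQ_I)
    fix e :: real assume "0 < e"
    then obtain i where i: "(1/2) ^ i < e" using small_power[of e] by auto
    have "dist (s (q n)) x < e" if "i \<le> n" for n
    proof -
      have "dist (s (q n)) x < (1/2) ^ (n + 2)" using q unfolding fast_def by blast
      also have "\<dots> \<le> (1/2) ^ i" using that by (intro power_decreasing) auto
      finally show ?thesis using i by simp
    qed
    then show "\<exists>N. \<forall>n\<ge>N. dist (s (q n)) x < e" by blast
  qed
qed

lemma ex_fast: "\<exists>q. fast q x"
  unfolding fast_def using dense[of "(1/2) ^ (n + 2)" x for n] by (intro choice) auto

lemma ex_fast_extending:
  assumes "\<forall>i<N. dist (s (q i)) x < (1/2) ^ (i + 2)"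
  shows "\<exists>q'. fast q' x \<and> (\<forall>i<N. q' i = q i)"
proof -
  obtain q0 where "fast q0 x" using ex_fast by blast
  with assms show ?thesis by (intro exI[of _ "\<lambda>i. if i < N then q i else q0 i"]) (auto simp: fast_def)
qed

section \<open>Open sets as enumerated unions of balls\<close>

lemma rep_open_SomeD:
  assumes "rep_open \<delta> u = Some U" "\<delta> p = Some x"
  shows "\<exists>q. applyR (graph u) (graph p) = graph q \<and> (x \<in> U \<longleftrightarrow> q \<noteq> (\<lambda>_. 0))"
proof -
  from assms(1) obtain f where f: "rep_fun \<delta> rep_sierpinski u = Some f" "U = {x. f x}"
    unfolding rep_open_def ran_rep by auto
  from applyR_rep_fun[OF f(1) assms(2)] f(2) show ?thesis by (auto simp: rep_sierpinski_def)
qed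

text \<open>A successful test for membership reads finitely many entries of a fast sequence for
  \<open>x\<close>, and these entries also begin a fast sequence for every point near
  \<open>x\<close>. The test then succeeds for those points as well.\<close>

lemma open_rep_open:
  assumes u: "rep_open \<delta> u = Some U" shows "open U"
  unfolding open_dist
proof
  fix x assume "x \<in> U"
  obtain q where q: "fast q x" using ex_fast by blast
  obtain r where r: "limR (graph q) = graph r" "\<delta> r = Some x" using limR_fast[OF q] by blast
  \<comment> \<open>Membership shows as a nonzero entry of a Sierpinski name, which
    \<open>Suc (pi2 z)\<close> expresses. The oracle interleaves the name of \<open>U\<close> with
    the sequence for the point.\<close>
  define R where "R o' z \<longleftrightarrow> applyR (\<lambda>i y. graph (\<lambda>i. o' (2 * i)) i y) (limR (\<lambda>i y. graph (\<lambda>i. o' (2 * i + 1)) i y)) (pi1 z) (Suc (pi2 z))"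
    for o' z
  have "sig R" unfolding R_def by (intro cintros)
  have R: "R (pair_seq u q) z \<longleftrightarrow> applyR (graph u) (limR (graph q)) (pi1 z) (Suc (pi2 z))" for q z
    by (simp add: R_def pair_seq_def)
  obtain t where t: "applyR (graph u) (graph r) = graph t" "t \<noteq> (\<lambda>_. 0)"
    using rep_open_SomeD[OF u r(2)] \<open>x \<in> U\<close> by blast
  from t(2) obtain k where "t k \<noteq> 0" by auto
  then have "R (pair_seq u q) (prod_encode (k, t k - 1))"
    unfolding R r(1) t(1) by (simp add: graph_def)
  from sig_finite_use[of R "pair_seq u q" "prod_encode (k, t k - 1)", OF \<open>sig R\<close> this] obtain N where
    N: "\<And>o'. \<forall>i<N. o' i = pair_seq u q i \<Longrightarrow> R o' (prod_encode (k, t k - 1))" by blast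
  have "\<exists>e>0. \<forall>n<N. \<forall>y. dist y x < e \<longrightarrow> dist (s (q n)) y < (1/2) ^ (n + 2)"
  proof (induction N)
    case (Suc N)
    then obtain e where e: "e > 0" "\<And>n y. n < N \<Longrightarrow> dist y x < e \<Longrightarrow> dist (s (q n)) y < (1/2) ^ (n + 2)"
      by blast
    have d: "dist (s (q N)) x < (1/2) ^ (N + 2)" using q by (simp add: fast_def)
    have "dist (s (q N)) y < (1/2) ^ (N + 2)" if "dist y x < (1/2) ^ (N + 2) - dist (s (q N)) x" for y
      using dist_triangle2[of "s (q N)" y x] that by linarith
    with e d show ?case
      by (intro exI[of _ "min e ((1/2) ^ (N + 2) - dist (s (q N)) x)"]) (auto simp: less_Suc_eq)
  qed (auto intro: exI[of _ 1])
  then obtain e where e: "e > 0" "\<And>n y. n < N \<Longrightarrow> dist y x < e \<Longrightarrow> dist (s (q n)) y < (1/2) ^ (n + 2)"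
    by blast
  have "y \<in> U" if yd: "dist y x < e" for y
  proof -
    obtain q' where q': "fast q' y" "\<forall>i<N. q' i = q i"
      using ex_fast_extending[of N q y] e(2)[OF _ yd] by blast
    obtain r' where r': "limR (graph q') = graph r'" "\<delta> r' = Some y" using limR_fast[OF q'(1)] by blast
    have "R (pair_seq u q') (prod_encode (k, t k - 1))"
      by (rule N) (use q'(2) in \<open>auto simp: pair_seq_def\<close>)
    then have "applyR (graph u) (graph r') k (Suc (t k - 1))" unfolding R r'(1) by simp
    moreover obtain t' where "applyR (graph u) (graph r') = graph t'" "y \<in> U \<longleftrightarrow> t' \<noteq> (\<lambda>_. 0)"
      using rep_open_SomeD[OF u r'(2)] by blast
    ultimately show ?thesis by (auto simp: graph_def)
  qed
  with e(1) show "\<exists>e>0. \<forall>y. dist y x < e \<longrightarrow> y \<in> U" by blast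
qed

text \<open>A realizer of the multi-valued inverse of \<open>ball_union\<close> has to answer only
  where its value is nonempty; this shows that it answers at every open set.\<close>

lemma open_ball_union:
  assumes "open U" shows "\<exists>f. ball_union s f = U"
proof -
  define Z where "Z = {(j, r). ball (s j) (of_rat r) \<subseteq> U}"
  \<comment> \<open>The ball of radius 0 is empty, so this pair is allowed for every
    \<open>U\<close> and keeps \<open>Z\<close> enumerable by a total function.\<close>
  have "(0, 0) \<in> Z" by (simp add: Z_def)
  then have Z: "range (from_nat_into Z) = Z" by (intro range_from_nat_into) auto
  have "ball_union s (from_nat_into Z) = (\<Union>z\<in>range (from_nat_into Z). ball (s (fst z)) (of_rat (snd z)))"
    by (simp add: ball_union_def)
  also have "\<dots> = U"
  proof (rule antisym)
    show "(\<Union>z\<in>range (from_nat_into Z). ball (s (fst z)) (of_rat (snd z))) \<subseteq> U"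
      unfolding Z by (auto simp: Z_def)
    show "U \<subseteq> (\<Union>z\<in>range (from_nat_into Z). ball (s (fst z)) (of_rat (snd z)))"
    proof
      fix x assume "x \<in> U"
      then obtain e where e: "e > 0" "ball x e \<subseteq> U" using assms open_contains_ball by blast
      obtain r where r: "0 < (of_rat r :: real)" "of_rat r < e / 2"
        using of_rat_dense[of 0 "e / 2"] half_gt_zero[OF e(1)] by blast
      obtain j where j: "dist (s j) x < of_rat r" using dense[OF r(1)] by blast
      have "ball (s j) (of_rat r) \<subseteq> ball x e"
      proof
        fix y assume "y \<in> ball (s j) (of_rat r)"
        then have "dist x y < of_rat r + of_rat r"
          using j dist_triangle[of x y "s j"] by (simp add: dist_commute)
        with r show "y \<in> ball x e" by simp
      qed
      with e have "(j, r) \<in> Z" by (auto simp: Z_def)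
      with j show "x \<in> (\<Union>z\<in>range (from_nat_into Z). ball (s (fst z)) (of_rat (snd z)))"
        unfolding Z by force
    qed
  qed
  finally show ?thesis by blast
qed

definition ball_prog :: "nat \<Rightarrow> bool" where
  "ball_prog E \<longleftrightarrow> (\<forall>u U. rep_open \<delta> u = Some U \<longrightarrow> (\<exists>q f. run (graph u) E = graph q \<and>
     rep_fun rep_nat (rep_prod rep_nat rep_rat) q = Some f \<and> ball_union s f = U))"

definition ball_code :: nat where "ball_code = (SOME E. ball_prog E)"

text \<open>A natural number is named by the sequence whose only 1 stands at its place. In the
  interleaved name of the \<open>i\<close>-th ball the centre and the radius code are thus read off
  the single 1 among the even and among the odd positions.\<close>

definition ballR :: "orc \<Rightarrow> nat \<Rightarrow> nat \<Rightarrow> nat \<Rightarrow> bool" where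
  "ballR P i j r \<longleftrightarrow> applyR (run P ball_code) (natR i) (2 * j) 1 \<and> applyR (run P ball_code) (natR i) (2 * r + 1) 1"

lemma sig_ballR [cintros]:
  assumes P: "sigR P" and "tot i" "tot j" "tot r"
  shows "sig (\<lambda>p z. ballR (P p z) (i p z) (j p z) (r p z))"
  unfolding ballR_def by (intro cintros sig_subst3[OF P] assms assms(2)[THEN tot_comp])

lemma ballR:
  assumes u: "rep_open \<delta> u = Some U" shows "ball_sum s (ballR (graph u)) = U"
proof -
  have "rep_computable (rep_open \<delta>) (rep_fun rep_nat (rep_prod rep_nat rep_rat))
       (\<lambda>U. {f. ball_union s f = U})"
    using cms unfolding computable_metric_space_def by blast
  from rep_computable_run[OF this] obtain E where E:
    "\<forall>p x. rep_open \<delta> p = Some x \<and> {f. ball_union s f = x} \<noteq> {} \<longrightarrow> (\<exists>q y. run (graph p) E = graph q \<and>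
       rep_fun rep_nat (rep_prod rep_nat rep_rat) q = Some y \<and> y \<in> {f. ball_union s f = x})" ..
  have "ball_prog E"
    unfolding ball_prog_def
  proof (intro allI impI)
    fix u U assume u: "rep_open \<delta> u = Some U"
    show "\<exists>q f. run (graph u) E = graph q \<and> rep_fun rep_nat (rep_prod rep_nat rep_rat) q = Some f \<and> ball_union s f = U"
      using E[rule_format, of u U] open_ball_union[OF open_rep_open[OF u]] u by auto
  qed
  then have "ball_prog ball_code" unfolding ball_code_def by (rule someI)
  with u obtain q f where q: "run (graph u) ball_code = graph q"
    "rep_fun rep_nat (rep_prod rep_nat rep_rat) q = Some f" and U: "ball_union s f = U"
    unfolding ball_prog_def by blast
  have B: "\<exists>r0. snd (f i) = nat_to_rat_surj r0 \<and> (\<forall>j r. ballR (graph u) i j r \<longleftrightarrow> j = fst (f i) \<and> r = r0)" for i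
  proof -
    obtain w where w: "applyR (graph q) (natR i) = graph w" "rep_prod rep_nat rep_rat w = Some (f i)"
      using applyR_rep_fun_nat[OF q(2)] by blast
    obtain a b where ab: "w = pair_seq a b" "rep_nat a = Some (fst (f i))" "rep_rat b = Some (snd (f i))"
      using rep_prod_SomeD[OF w(2)] by blast
    from ab(3) obtain r0 where r0: "rep_nat b = Some r0" "snd (f i) = nat_to_rat_surj r0"
      by (auto simp: rep_rat_def)
    show ?thesis unfolding ballR_def q(1) w(1)
      using ab(1) rep_nat_SomeD[OF ab(2)] rep_nat_SomeD[OF r0(1)] r0(2)
      by (intro exI[of _ r0]) (auto simp: graph_def pair_seq_def tag_def)
  qed
  show ?thesis
  proof (rule set_eqI)
    fix x
    have "x \<in> U \<longleftrightarrow> (\<exists>i. dist (s (fst (f i))) x < of_rat (snd (f i)))"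
      by (auto simp: U[symmetric] ball_union_def)
    also have "\<dots> \<longleftrightarrow> (\<exists>i j r. ballR (graph u) i j r \<and> dist (s j) x < rt r)"
      using B by metis
    finally show "x \<in> ball_sum s (ballR (graph u)) \<longleftrightarrow> x \<in> U" by (simp add: ball_sum_def)
  qed
qed

end


section \<open>The Prokhorov metric\<close>

definition thick :: "'x::metric_space set \<Rightarrow> real \<Rightarrow> 'x set" where
  "thick A e = (\<Union>a\<in>A. ball a e)"

text \<open>This is one of the two inequalities in the definition of \<open>prokhorov\<close>.
  Between probability measures it implies the other one, by \<open>close_sym\<close>, so all
  estimates below are one-sided.\<close>

definition close :: "real \<Rightarrow> 'x::metric_space measure \<Rightarrow> 'x measure \<Rightarrow> bool" where
  "close e M N \<longleftrightarrow> (\<forall>A\<in>sets borel. measure M A \<le> measure N (thick A e) + e)"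

lemma borel_thick [measurable]: "thick A e \<in> sets borel"
  unfolding thick_def by (intro borel_open open_UN) auto

lemma thick_mono: "A \<subseteq> B \<Longrightarrow> e \<le> d \<Longrightarrow> thick A e \<subseteq> thick B d"
  unfolding thick_def by fastforce

lemma thick_thick: "thick (thick A e) d \<subseteq> thick A (e + d)"
  unfolding thick_def using dist_triangle_less_add by (fastforce simp: dist_commute)

lemma subset_thick: "0 < e \<Longrightarrow> A \<subseteq> thick A e"
  unfolding thick_def by auto

lemma mem_thick: "x \<in> thick A e \<longleftrightarrow> (\<exists>a\<in>A. dist a x < e)"
  unfolding thick_def by auto

lemma borel_probD:
  assumes "M \<in> borel_prob" shows "sets M = sets borel" "prob_space M" "space M = UNIV" "finite_measure M"
  using assms sets_eq_imp_space_eq[of M borel] unfolding borel_prob_def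
  by (auto intro: prob_space.finite_measure)

lemma measure_borel_prob_mono:
  "M \<in> borel_prob \<Longrightarrow> A \<subseteq> B \<Longrightarrow> B \<in> sets borel \<Longrightarrow> measure M A \<le> measure M B"
  by (rule finite_measure.finite_measure_mono) (auto dest: borel_probD)

lemma measure_borel_prob_le_1: "M \<in> borel_prob \<Longrightarrow> measure M A \<le> 1"
  by (rule prob_space.prob_le_1) (auto dest: borel_probD)

lemma measure_borel_prob_Compl:
  "M \<in> borel_prob \<Longrightarrow> A \<in> sets borel \<Longrightarrow> measure M (- A) = 1 - measure M A"
  using prob_space.prob_compl[of M A] borel_probD[of M] by (simp add: Compl_eq_Diff_UNIV)

lemma close_mono:
  assumes "close e M N" "e \<le> d" "N \<in> borel_prob" shows "close d M N"
  unfolding close_def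
proof
  fix A :: "'a set" assume "A \<in> sets borel"
  then have "measure M A \<le> measure N (thick A e) + e" using assms(1) by (simp add: close_def)
  also have "measure N (thick A e) \<le> measure N (thick A d)"
    by (intro measure_borel_prob_mono assms thick_mono) auto
  finally show "measure M A \<le> measure N (thick A d) + d" using assms(2) by simp
qed

text \<open>Apply the condition to the complement of the thickened set.\<close>

lemma close_sym:
  assumes M: "M \<in> borel_prob" and N: "N \<in> borel_prob" and c: "close e M N" shows "close e N M"
  unfolding close_def
proof
  fix A :: "'a set" assume A: "A \<in> sets borel"
  let ?B = "- thick A e"
  have B: "?B \<in> sets borel" by measurable
  have "thick ?B e \<subseteq> - A" by (auto simp: mem_thick) (metis dist_commute)
  then have "measure N (thick ?B e) \<le> measure N (- A)"
    using A by (intro measure_borel_prob_mono N) auto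
  moreover have "measure M ?B \<le> measure N (thick ?B e) + e" using c B by (simp add: close_def)
  ultimately show "measure N A \<le> measure M (thick A e) + e"
    using measure_borel_prob_Compl[OF M borel_thick, of A e] measure_borel_prob_Compl[OF N A] by linarith
qed

lemma close_trans:
  assumes "close e M N" "close d N L" "L \<in> borel_prob" shows "close (e + d) M L"
  unfolding close_def
proof
  fix A :: "'a set" assume "A \<in> sets borel"
  then have "measure M A \<le> measure N (thick A e) + e" using assms(1) by (simp add: close_def)
  also have "measure N (thick A e) \<le> measure L (thick (thick A e) d) + d"
    using assms(2) by (simp add: close_def)
  also have "measure L (thick (thick A e) d) \<le> measure L (thick A (e + d))"
    by (intro measure_borel_prob_mono assms thick_thick) auto
  finally show "measure M A \<le> measure L (thick A (e + d)) + (e + d)" by simp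
qed

lemma prokhorov_eq: "prokhorov M N = Inf {e. 0 < e \<and> close e M N \<and> close e N M}"
  unfolding prokhorov_def close_def thick_def by (intro arg_cong[of _ _ Inf]) blast

lemma prokhorov_le:
  assumes "M \<in> borel_prob" "N \<in> borel_prob" "close e M N" "0 < e" shows "prokhorov M N \<le> e"
  unfolding prokhorov_eq using close_sym[OF assms(1-3)] assms(3,4)
  by (intro cInf_lower) (auto intro!: bdd_belowI[of _ 0])

text \<open>This provides an element of the set whose infimum is the distance.\<close>

lemma close_1: "M \<in> borel_prob \<Longrightarrow> close 1 M N"
  unfolding close_def using measure_borel_prob_le_1[of M] by (smt (verit) measure_nonneg)

lemma prokhorov_closeD:
  assumes "M \<in> borel_prob" "N \<in> borel_prob" "prokhorov M N < e" shows "close e M N"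
proof -
  have "1 \<in> {e. 0 < e \<and> close e M N \<and> close e N M}" using close_1 assms by auto
  then obtain d where "d < e" "close d M N"
    using cInf_lessD[OF _ assms(3)[unfolded prokhorov_eq]] by blast
  then show ?thesis using close_mono[of d M N e] assms by simp
qed

lemma prokhorov_nonneg:
  assumes "M \<in> borel_prob" "N \<in> borel_prob" shows "0 \<le> prokhorov M N"
proof -
  have "1 \<in> {e. 0 < e \<and> close e M N \<and> close e N M}" using close_1 assms by auto
  then show ?thesis unfolding prokhorov_eq by (intro cInf_greatest) auto
qed

lemma prokhorov_sym:
  assumes "M \<in> borel_prob" "N \<in> borel_prob" shows "prokhorov M N = prokhorov N M"
  unfolding prokhorov_eq by (intro arg_cong[of _ _ Inf]) auto

lemma prokhorov_triangle:
  assumes "M \<in> borel_prob" "N \<in> borel_prob" "L \<in> borel_prob"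
  shows "prokhorov M L \<le> prokhorov M N + prokhorov N L"
proof (rule field_le_epsilon)
  fix e :: real assume e: "0 < e"
  have "close (prokhorov M N + e / 2) M N" "close (prokhorov N L + e / 2) N L"
    using assms e by (auto intro: prokhorov_closeD)
  from close_trans[OF this assms(3)]
  have "close (prokhorov M N + prokhorov N L + e) M L" by (simp add: algebra_simps)
  then show "prokhorov M L \<le> prokhorov M N + prokhorov N L + e"
    using assms e prokhorov_nonneg[of M N] prokhorov_nonneg[of N L] by (intro prokhorov_le) auto
qed

text \<open>The thickenings of a closed set decrease to the set itself, so the two measures agree on
  closed sets. These are stable under intersection and generate the Borel sets.\<close>

lemma prokhorov_le_0_imp_eq:
  assumes M: "M \<in> borel_prob" and N: "N \<in> borel_prob" and "prokhorov M N \<le> 0" shows "M = N"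
proof -
  have le: "measure M C \<le> measure N C"
    if M: "M \<in> borel_prob" and N: "N \<in> borel_prob" and le: "prokhorov M N \<le> 0" and C: "closed C"
    for M N :: "'a measure" and C
  proof -
    have "(\<lambda>n. measure N (thick C (1 / Suc n))) \<longlonglongrightarrow> measure N (\<Inter>n. thick C (1 / Suc n))"
    proof (rule finite_measure.finite_Lim_measure_decseq)
      show "finite_measure N" using N by (rule borel_probD)
      show "range (\<lambda>n. thick C (1 / real (Suc n))) \<subseteq> sets N"
        unfolding borel_probD(1)[OF N] using borel_thick by blast
      show "decseq (\<lambda>n. thick C (1 / real (Suc n)))"
        by (intro antimonoI thick_mono frac_le) auto
    qed
    moreover have "(\<Inter>n. thick C (1 / Suc n)) = C"
    proof (intro equalityI subsetI)
      fix x assume x: "x \<in> (\<Inter>n. thick C (1 / real (Suc n)))"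
      have "\<exists>y\<in>C. dist y x < e" if "0 < e" for e
      proof -
        obtain n where "1 / real (Suc n) < e" using \<open>0 < e\<close> by (rule nat_approx_posE)
        with x show ?thesis by (auto simp: mem_thick) (meson less_trans)
      qed
      then show "x \<in> C" using C closure_approachable[of x C] by (simp add: closure_closed)
    next
      fix x assume "x \<in> C"
      then show "x \<in> (\<Inter>n. thick C (1 / real (Suc n)))"
        using subset_thick[of "1 / real (Suc n)" C for n] by auto
    qed
    ultimately have lim: "(\<lambda>n. measure N (thick C (1 / Suc n)) + 1 / Suc n) \<longlonglongrightarrow> measure N C + 0"
      by (intro tendsto_add LIMSEQ_Suc[OF lim_1_over_n]) simp
    have "measure M C \<le> measure N (thick C (1 / Suc n)) + 1 / Suc n" for n
    proof -
      have "0 < 1 / real (Suc n)" by simp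
      with le have "prokhorov M N < 1 / Suc n" by linarith
      from prokhorov_closeD[OF M N this] C show ?thesis
        unfolding close_def using borel_closed by blast
    qed
    then show ?thesis using LIMSEQ_le_const[OF lim] by auto
  qed
  show ?thesis
  proof (rule measure_eqI_generator_eq[where E = "Collect closed" and \<Omega> = UNIV and A = "\<lambda>_. UNIV"])
    show "Int_stable (Collect (closed :: 'a set \<Rightarrow> bool))" by (auto simp: Int_stable_def)
    show "sets M = sigma_sets UNIV (Collect closed)" "sets N = sigma_sets UNIV (Collect closed)"
      using borel_probD(1)[OF M] borel_probD(1)[OF N] by (simp_all add: borel_eq_closed)
    show "emeasure M X = emeasure N X" if "X \<in> Collect closed" for X
    proof -
      have "measure M X = measure N X"
        using le[OF M N assms(3)] le[OF N M] assms(3) prokhorov_sym[OF M N] that by (auto intro: antisym)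
      then show ?thesis
        using borel_probD(4)[OF M] borel_probD(4)[OF N] by (simp add: finite_measure.emeasure_eq_measure)
    qed
    show "emeasure M UNIV \<noteq> \<infinity>"
      using borel_probD(4)[OF M] by (simp add: finite_measure.emeasure_eq_measure)
  qed auto
qed

lemma close_measure:
  assumes "M \<in> borel_prob" "N \<in> borel_prob" "0 < e" "\<And>A. A \<in> sets borel \<Longrightarrow> measure M A \<le> measure N A + e"
  shows "close e M N"
  unfolding close_def using assms(4) measure_borel_prob_mono[OF assms(2) subset_thick[OF assms(3)] borel_thick]
  by (meson add_right_mono order_trans)

section \<open>Finite combinations of Dirac measures\<close>

text \<open>The list behind \<open>dirac_comb\<close> is coded by \<open>Suc k\<close> and hence
  nonempty. Its atoms are accessed through their index \<open>cpos\<close> and their integer weight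
  \<open>cw\<close>, which is at least 1; \<open>ctot\<close> is the common denominator.\<close>

definition clen :: "nat \<Rightarrow> nat" where "clen k = len (Suc k)"
definition cpos :: "nat \<Rightarrow> nat \<Rightarrow> nat" where "cpos k i = pi1 (el (Suc k) i)"
definition cw :: "nat \<Rightarrow> nat \<Rightarrow> nat" where "cw k i = Suc (pi2 (el (Suc k) i))"
definition ctot :: "nat \<Rightarrow> nat" where "ctot k = (\<Sum>i<clen k. cw k i)"

lemma tot_c [cintros]:
  "tot f \<Longrightarrow> tot (\<lambda>p x. clen (f p x))"
  "tot f \<Longrightarrow> tot g \<Longrightarrow> tot (\<lambda>p x. cpos (f p x) (g p x))"
  "tot f \<Longrightarrow> tot g \<Longrightarrow> tot (\<lambda>p x. cw (f p x) (g p x))"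
  unfolding clen_def cpos_def cw_def by (intro cintros; assumption)+

lemma clen_pos: "0 < clen k"
  by (simp add: clen_def len_def split: prod.split)

lemma ctot_pos: "0 < ctot k"
  using clen_pos[of k] by (auto simp: ctot_def cw_def intro!: sum_pos)

lemma tot_ctot [cintros]:
  assumes "tot f" shows "tot (\<lambda>p x. ctot (f p x))"
  unfolding ctot_def by (intro cintros assms tot_comp[OF assms])

lemma sum_list_decode:
  "(\<Sum>x\<leftarrow>list_decode w. f x) = (\<Sum>i<len w. f (el w i))"
  unfolding list_decode_map_el by (simp add: sum_list_sum_nth atLeast0LessThan)

lemma dirac_comb_alt:
  "dirac_comb s k = measure_of UNIV (sets borel)
     (\<lambda>A. ennreal ((\<Sum>i<clen k. real (cw k i) * indicator A (s (cpos k i))) / real (ctot k)))"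
proof -
  have "(\<Sum>(m, w)\<leftarrow>map prod_decode (list_decode (Suc k)). f m w) = (\<Sum>i<clen k. f (cpos k i) (cw k i - 1))" for f :: "nat \<Rightarrow> nat \<Rightarrow> real"
    using sum_list_decode[of "\<lambda>x. f (pi1 x) (pi2 x)" "Suc k"]
    by (simp add: split_def pi1_def[symmetric] pi2_def[symmetric] clen_def cpos_def cw_def o_def del: list_decode.simps)
  from this[of "\<lambda>m w. real (Suc w) * indicator A (s m)" for A] this[of "\<lambda>m w. real (Suc w)"]
  show ?thesis unfolding dirac_comb_def Let_def by (simp add: ctot_def cw_def)
qed

lemma
  fixes s :: "nat \<Rightarrow> 'x::topological_space"
  shows sets_dirac_comb: "sets (dirac_comb s k) = sets borel"
    and measure_dirac_comb: "A \<in> sets borel \<Longrightarrow> measure (dirac_comb s k) A =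
      (\<Sum>i<clen k. real (cw k i) * indicator A (s (cpos k i))) / real (ctot k)"
    and dirac_comb_borel_prob: "dirac_comb s k \<in> borel_prob"
proof -
  let ?f = "\<lambda>A. (\<Sum>i<clen k. real (cw k i) * indicator A (s (cpos k i))) / real (ctot k)"
  show sets: "sets (dirac_comb s k) = sets borel"
    unfolding dirac_comb_alt using sets.sets_measure_of_eq[of borel] by simp
  have em: "emeasure (dirac_comb s k) A = ennreal (?f A)" if "A \<in> sets borel" for A
  proof (rule emeasure_measure_of[OF dirac_comb_alt])
    show "positive (sets (dirac_comb s k)) (\<lambda>A. ennreal (?f A))" by (simp add: positive_def)
    show "countably_additive (sets (dirac_comb s k)) (\<lambda>A. ennreal (?f A))"
    proof (rule countably_additiveI)
      fix A :: "nat \<Rightarrow> 'x set" assume "disjoint_family A"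
      then have "(\<lambda>j. indicator (A j) x :: real) sums indicator (\<Union>j. A j) x" for x
        by (intro indicator_sums) (auto simp: disjoint_family_on_def)
      then have "(\<lambda>j. ?f (A j)) sums ?f (\<Union>j. A j)"
        by (intro sums_divide sums_sum sums_mult)
      then show "(\<Sum>j. ennreal (?f (A j))) = ennreal (?f (\<Union>j. A j))"
        by (intro suminf_ennreal_eq) (auto intro!: divide_nonneg_nonneg sum_nonneg)
    qed
  qed (use that sets in auto)
  have nonneg: "0 \<le> ?f A" for A by (auto intro!: divide_nonneg_nonneg sum_nonneg)
  show "A \<in> sets borel \<Longrightarrow> measure (dirac_comb s k) A = ?f A"
    unfolding measure_def by (simp only: em enn2real_ennreal[OF nonneg])
  have "emeasure (dirac_comb s k) (space (dirac_comb s k)) = 1"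
  proof -
    have "(\<Sum>i<clen k. real (cw k i)) = real (ctot k)" by (simp add: ctot_def)
    then have "?f UNIV = 1" using ctot_pos[of k] by simp
    then show ?thesis using em[of UNIV] sets_eq_imp_space_eq[OF sets] by simp
  qed
  then show "dirac_comb s k \<in> borel_prob"
    unfolding borel_prob_def using sets by (auto intro: prob_spaceI)
qed

text \<open>The code of the normalised combination with integer weights \<open>W k\<close> at the
  points with index \<open>pos k\<close>. Weights are stored diminished by 1, so atoms of weight 0
  must be dropped. The order is reversed because primitive recursion prepends, and the final
  \<open>- 1\<close> undoes the \<open>Suc\<close> of the decoding.\<close>

definition combcode :: "nat \<Rightarrow> (nat \<Rightarrow> nat) \<Rightarrow> (nat \<Rightarrow> nat) \<Rightarrow> nat" where
  "combcode n pos W =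
     list_encode (map (\<lambda>k. prod_encode (pos k, W k - 1)) (rev (filter (\<lambda>k. W k \<noteq> 0) [0..<n]))) - 1"

lemma tot_combcode [cintros]:
  assumes n: "tot n" and pos: "tot (\<lambda>p z. pos p (pi1 z) (pi2 z))" and W: "tot (\<lambda>p z. W p (pi1 z) (pi2 z))"
  shows "tot (\<lambda>p x. combcode (n p x) (pos p x) (W p x))"
proof -
  have *: "tot (\<lambda>p x. pos p (f p x) (g p x))" "tot (\<lambda>p x. W p (f p x) (g p x))" if "tot f" "tot g" for f g
    using tot_comp[OF pos, of "\<lambda>p z. prod_encode (f p z, g p z)"]
      tot_comp[OF W, of "\<lambda>p z. prod_encode (f p z, g p z)"] that by (simp_all add: cintros)
  have "tot (\<lambda>p x. rec_nat 0 (\<lambda>k X. if W p x k \<noteq> 0 then Suc (prod_encode (prod_encode (pos p x k, W p x k - 1), X)) else X) (n p x) - 1)"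
    by (intro cintros * n)
  moreover have "rec_nat 0 (\<lambda>k X. if W k \<noteq> 0 then Suc (prod_encode (prod_encode (pos k, W k - 1), X)) else X) n =
     list_encode (map (\<lambda>k. prod_encode (pos k, W k - 1)) (rev (filter (\<lambda>k. W k \<noteq> 0) [0..<n])))" for n pos W
    by (induction n) auto
  ultimately show ?thesis unfolding combcode_def by simp
qed

text \<open>The summand is arbitrary because both the total weight and the mass of a set are
  obtained from this.\<close>

lemma sum_combcode:
  fixes f :: "nat \<Rightarrow> nat \<Rightarrow> 'a::comm_monoid_add"
  assumes "0 < (\<Sum>k<n. W k)"
  shows "(\<Sum>i<clen (combcode n pos W). f (cpos (combcode n pos W) i) (cw (combcode n pos W) i)) =
    (\<Sum>k | k < n \<and> W k \<noteq> 0. f (pos k) (W k))"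
proof -
  let ?L = "map (\<lambda>k. prod_encode (pos k, W k - 1)) (rev (filter (\<lambda>k. W k \<noteq> 0) [0..<n]))"
  have "\<exists>k<n. W k \<noteq> 0" by (rule ccontr) (use assms in auto)
  then have "?L \<noteq> []" by (auto simp: filter_empty_conv)
  then have "list_encode ?L \<noteq> 0" by (simp add: list_encode_eq_0)
  then have c: "Suc (combcode n pos W) = list_encode ?L" unfolding combcode_def by simp
  have "(\<Sum>i<clen (combcode n pos W). f (cpos (combcode n pos W) i) (cw (combcode n pos W) i)) =
    (\<Sum>x\<leftarrow>?L. f (pi1 x) (Suc (pi2 x)))"
    using sum_list_decode[of "\<lambda>x. f (pi1 x) (Suc (pi2 x))" "list_encode ?L"]
    by (simp add: clen_def cpos_def cw_def c)
  also have "\<dots> = (\<Sum>k\<leftarrow>rev (filter (\<lambda>k. W k \<noteq> 0) [0..<n]). f (pos k) (Suc (W k - 1)))"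
    by (simp add: o_def)
  also have "\<dots> = (\<Sum>k | k < n \<and> W k \<noteq> 0. f (pos k) (Suc (W k - 1)))"
    by (subst sum_list_distinct_conv_sum_set) (auto intro!: sum.cong)
  also have "\<dots> = (\<Sum>k | k < n \<and> W k \<noteq> 0. f (pos k) (W k))" by (intro sum.cong) auto
  finally show ?thesis .
qed

lemma ctot_combcode: "0 < (\<Sum>k<n. W k) \<Longrightarrow> ctot (combcode n pos W) = (\<Sum>k<n. W k)"
  unfolding ctot_def by (subst sum_combcode) (auto intro!: sum.mono_neutral_left)

lemma measure_combcode:
  fixes s :: "nat \<Rightarrow> 'x::topological_space"
  assumes "0 < (\<Sum>k<n. W k)" "A \<in> sets borel"
  shows "measure (dirac_comb s (combcode n pos W)) A =
    (\<Sum>k<n. real (W k) * indicator A (s (pos k))) / real (\<Sum>k<n. W k)"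
proof -
  have "(\<Sum>k | k < n \<and> W k \<noteq> 0. real (W k) * indicator A (s (pos k))) = (\<Sum>k<n. real (W k) * indicator A (s (pos k)))"
    by (intro sum.mono_neutral_left) auto
  then show ?thesis
    unfolding measure_dirac_comb[OF assms(2)] ctot_combcode[OF assms(1)]
    using sum_combcode[OF assms(1), of "\<lambda>m w. real w * indicator A (s m)" pos] by simp
qed

lemma rep_prob_Some:
  assumes "\<nu> \<in> borel_prob" "\<And>n. prokhorov (dirac_comb s (p n)) \<nu> \<le> (1/2) ^ n"
  shows "rep_prob s p = Some \<nu>"
  unfolding rep_prob_def cauchy_rep_def
proof (rule rep_of_Some)
  fix \<nu>' assume \<nu>': "\<nu>' \<in> borel_prob \<and> (\<forall>n. prokhorov (dirac_comb s (p n)) \<nu>' \<le> (1/2) ^ n)"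
  have "prokhorov \<nu>' \<nu> \<le> 2 * (1/2) ^ n" for n
    using prokhorov_triangle[of \<nu>' "dirac_comb s (p n)" \<nu>] assms \<nu>' dirac_comb_borel_prob[of s "p n"]
      prokhorov_sym[of \<nu>' "dirac_comb s (p n)"] by (smt (verit, best))
  moreover have "(\<lambda>n. 2 * (1/2 :: real) ^ n) \<longlonglongrightarrow> 2 * 0" by (intro tendsto_intros) auto
  ultimately have "prokhorov \<nu>' \<nu> \<le> 0" by (intro LIMSEQ_le_const[of "\<lambda>n. 2 * (1/2) ^ n"]) auto
  then show "\<nu>' = \<nu>" using prokhorov_le_0_imp_eq \<nu>' assms(1) by blast
qed (use assms in auto)

lemma rep_prob_SomeD:
  assumes "rep_prob s p = Some \<nu>"
  shows "\<nu> \<in> borel_prob" "prokhorov (dirac_comb s (p n)) \<nu> \<le> (1/2) ^ n"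
  using rep_of_SomeD[OF assms[unfolded rep_prob_def cauchy_rep_def]] by auto


section \<open>Setwise convergence\<close>

text \<open>Finitely many balls of radius \<open>e / 2\<close> carry all but \<open>e / 2\<close> of
  the mass of \<open>D\<close>. They have only finitely many unions, on which the convergence is
  uniform. An arbitrary \<open>A\<close> is replaced by the union of those balls that meet it, and
  this union lies in \<open>thick A e\<close>.\<close>

lemma setwise_close:
  fixes D :: "'x::polish_space measure"
  assumes D: "D \<in> borel_prob" and \<nu>: "\<And>n. \<nu> n \<in> borel_prob"
    and lim: "\<And>A. A \<in> sets borel \<Longrightarrow> (\<lambda>n. measure (\<nu> n) A) \<longlonglongrightarrow> measure D A" and e: "0 < e"
  shows "\<forall>\<^sub>F n in sequentially. close e D (\<nu> n)"
proof -
  obtain Q :: "'x set" where Q: "countable Q" "\<And>X. open X \<Longrightarrow> X \<noteq> {} \<Longrightarrow> \<exists>d\<in>Q. d \<in> X"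
    using countable_dense_exists by blast
  have "Q \<noteq> {}" using Q(2)[of UNIV] by auto
  then have rQ: "range (from_nat_into Q) = Q" using Q(1) by (intro range_from_nat_into)
  define C where "C i = ball (from_nat_into Q i) (e / 2)" for i
  have C: "(\<Union>i. C i) = UNIV"
  proof (intro equalityI subsetI UNIV_I)
    fix x :: 'x
    obtain d where "d \<in> Q" "d \<in> ball x (e / 2)" using Q(2)[of "ball x (e / 2)"] e by auto
    moreover from this(1) obtain i where "d = from_nat_into Q i" using rQ by auto
    ultimately show "x \<in> (\<Union>i. C i)" by (auto simp: C_def dist_commute)
  qed
  have Cb: "(\<Union>i\<in>J. C i) \<in> sets borel" for J by (intro borel_open open_UN) (simp add: C_def)
  have "(\<lambda>k. measure D (\<Union>i<k. C i)) \<longlonglongrightarrow> measure D (\<Union>k. \<Union>i<k. C i)"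
  proof (rule finite_measure.finite_Lim_measure_incseq)
    show "range (\<lambda>k. \<Union>i<k. C i) \<subseteq> sets D" using Cb borel_probD(1)[OF D] by blast
    show "incseq (\<lambda>k. \<Union>i<k. C i)" by (intro incseq_SucI) (auto simp: less_Suc_eq)
  qed (use borel_probD[OF D] in auto)
  also have "(\<Union>k. \<Union>i<k. C i) = UNIV" using C by blast
  also have "measure D UNIV = 1" using borel_probD[OF D] prob_space.prob_space by metis
  finally have "\<forall>\<^sub>F k in sequentially. 1 - e / 2 < measure D (\<Union>i<k. C i)"
    by (rule order_tendstoD) (use e in auto)
  then obtain k where k: "1 - e / 2 < measure D (\<Union>i<k. C i)"
    using eventually_happens'[OF sequentially_bot] by blast
  have "\<forall>\<^sub>F n in sequentially. \<forall>J\<in>Pow {..<k}. measure D (\<Union>i\<in>J. C i) - e / 2 < measure (\<nu> n) (\<Union>i\<in>J. C i)"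
    using e by (intro eventually_ball_finite ballI order_tendstoD(1)[OF lim[OF Cb]]) auto
  then show ?thesis
  proof eventually_elim
    case (elim n)
    show ?case unfolding close_def
    proof
      fix A :: "'x set" assume A: "A \<in> sets borel"
      define J where "J = {i. i < k \<and> C i \<inter> A \<noteq> {}}"
      have "A \<subseteq> (\<Union>i\<in>J. C i) \<union> - (\<Union>i<k. C i)" by (auto simp: J_def)
      then have "measure D A \<le> measure D ((\<Union>i\<in>J. C i) \<union> - (\<Union>i<k. C i))"
        by (intro measure_borel_prob_mono D sets.Un borel_comp Cb)
      also have "\<dots> \<le> measure D (\<Union>i\<in>J. C i) + measure D (- (\<Union>i<k. C i))"
        by (intro measure_Un_le) (simp_all only: borel_probD(1)[OF D] borel_comp Cb)
      also have "\<dots> \<le> measure D (\<Union>i\<in>J. C i) + e / 2"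
        using measure_borel_prob_Compl[OF D Cb] k by simp
      also have "\<dots> \<le> measure (\<nu> n) (\<Union>i\<in>J. C i) + e"
      proof -
        have "J \<in> Pow {..<k}" by (auto simp: J_def)
        from elim[THEN bspec, OF this] show ?thesis by simp
      qed
      also have "(\<Union>i\<in>J. C i) \<subseteq> thick A e"
      proof
        fix x assume "x \<in> (\<Union>i\<in>J. C i)"
        then obtain i a where "x \<in> C i" "a \<in> C i" "a \<in> A" by (auto simp: J_def)
        moreover from this(1,2) have "dist a x < e"
          using dist_triangle_half_r[of "from_nat_into Q i" a e x] by (simp add: C_def)
        ultimately show "x \<in> thick A e" by (auto simp: mem_thick)
      qed
      then have "measure (\<nu> n) (\<Union>i\<in>J. C i) \<le> measure (\<nu> n) (thick A e)"
        by (intro measure_borel_prob_mono \<nu>) auto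
      finally show "measure D A \<le> measure (\<nu> n) (thick A e) + e" by simp
    qed
  qed
qed

text \<open>
  Gliding hump: if mass \<open>c > 0\<close> escaped along the sets \<open>A k\<close>, there would be consecutive blocks of
  indices such that \<open>\<nu> (n j)\<close> has mass about \<open>c\<close> on the \<open>j\<close>-th block and almost none beyond it. On the union
  of the even blocks the measures \<open>\<nu> (n j)\<close> with \<open>j\<close> even and with \<open>j\<close> odd then have different limits.
\<close>

lemma setwise_limit_tail:
  fixes \<nu> :: "nat \<Rightarrow> 'x::topological_space measure" and A :: "nat \<Rightarrow> 'x set"
  assumes \<nu>: "\<And>n. \<nu> n \<in> borel_prob" and A: "\<And>k. A k \<in> sets borel" and dj: "disjoint_family A"
    and L: "\<And>J. (\<lambda>n. measure (\<nu> n) (\<Union>k\<in>J. A k)) \<longlonglongrightarrow> L J"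
  shows "(\<lambda>K. L {K..}) \<longlonglongrightarrow> 0"
proof -
  define m where "m n J = measure (\<nu> n) (\<Union>k\<in>J. A k)" for n J
  have UA: "(\<Union>k\<in>J. A k) \<in> sets borel" for J by (intro sets.countable_UN') (use A in auto)
  have m_Un: "m n (I \<union> J) = m n I + m n J" if "I \<inter> J = {}" for n I J
  proof -
    have "(\<Union>k\<in>I. A k) \<inter> (\<Union>k\<in>J. A k) = {}"
    proof (rule ccontr)
      assume "(\<Union>k\<in>I. A k) \<inter> (\<Union>k\<in>J. A k) \<noteq> {}"
      then obtain x i j where x: "i \<in> I" "j \<in> J" "x \<in> A i" "x \<in> A j" by auto
      with that have "i \<noteq> j" by auto
      then have "A i \<inter> A j = {}" using dj by (simp add: disjoint_family_on_def)
      with x show False by auto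
    qed
    then show ?thesis unfolding m_def UN_Un
      by (intro finite_measure.finite_measure_Union borel_probD(4)[OF \<nu>])
         (simp_all only: borel_probD(1)[OF \<nu>] UA)
  qed
  have m_mono: "m n I \<le> m n J" if "I \<subseteq> J" for n I J
    unfolding m_def using that by (intro measure_borel_prob_mono \<nu> UA) auto
  have m_nonneg: "0 \<le> m n J" for n J by (simp add: m_def)
  have mL: "(\<lambda>n. m n J) \<longlonglongrightarrow> L J" for J using L by (simp add: m_def)
  have L_mono: "L I \<le> L J" if "I \<subseteq> J" for I J
    by (rule LIMSEQ_le[OF mL mL]) (use m_mono[OF that] in auto)
  have L_nonneg: "0 \<le> L J" for J by (rule LIMSEQ_le_const[OF mL]) (use m_nonneg in auto)
  have m_tail: "(\<lambda>K. m n {K..}) \<longlonglongrightarrow> 0" for n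
  proof -
    have "(\<lambda>K. measure (\<nu> n) (\<Union>k\<in>{K..}. A k)) \<longlonglongrightarrow> measure (\<nu> n) (\<Inter>K. \<Union>k\<in>{K..}. A k)"
    proof (rule finite_measure.finite_Lim_measure_decseq)
      show "range (\<lambda>K. \<Union>k\<in>{K..}. A k) \<subseteq> sets (\<nu> n)" unfolding borel_probD(1)[OF \<nu>] using UA by auto
      show "decseq (\<lambda>K. \<Union>k\<in>{K..}. A k)" by (intro decseq_SucI UN_mono) auto
    qed (use borel_probD[OF \<nu>] in auto)
    also have "(\<Inter>K. \<Union>k\<in>{K..}. A k) = {}"
    proof (rule ccontr)
      assume "(\<Inter>K. \<Union>k\<in>{K..}. A k) \<noteq> {}"
      then obtain x where x: "\<forall>K. \<exists>k\<in>{K..}. x \<in> A k" by auto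
      from x[rule_format, of 0] obtain k where k: "x \<in> A k" by blast
      from x[rule_format, of "Suc k"] obtain k' where k': "k' \<ge> Suc k" "x \<in> A k'" by auto
      then have "A k \<inter> A k' = {}" using dj by (simp add: disjoint_family_on_def)
      with k k' show False by auto
    qed
    finally show ?thesis by (simp add: m_def)
  qed
  have "decseq (\<lambda>K. L {K..})" by (intro decseq_SucI L_mono) auto
  then obtain c where c: "(\<lambda>K. L {K..}) \<longlonglongrightarrow> c" "\<And>K. c \<le> L {K..}"
    using decseq_convergent[of "\<lambda>K. L {K..}" 0] L_nonneg by blast
  have "0 \<le> c" by (rule LIMSEQ_le_const[OF c(1)]) (use L_nonneg in auto)
  moreover have "\<not> 0 < c"
  proof
    assume "0 < c"
    \<comment> \<open>The even blocks will exceed the common reference value by at least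
      \<open>c - 3 * e\<close>, the odd ones by at most \<open>2 * e\<close>; any \<open>e\<close>
      below \<open>c / 5\<close> separates them.\<close>
    define e where "e = c / 10"
    have e: "0 < e" using \<open>0 < c\<close> by (simp add: e_def)
    \<comment> \<open>Here \<open>n\<close> is late enough for all sets of indices below
      \<open>K\<close>, where only finitely many limits are involved, and the block of
      \<open>n\<close> extends from \<open>K\<close> up to \<open>K'\<close>.\<close>
    define good where "good n K K' \<longleftrightarrow> (\<forall>S\<in>Pow {..<K}. \<bar>m n S - L S\<bar> < e) \<and> c - e < m n {K..} \<and> m n {K'..} < e"
      for n K K'
    have ex: "\<exists>n>N. \<exists>K'>K. good n K K'" for N K
    proof -
      have "\<forall>\<^sub>F n in sequentially. \<forall>S\<in>Pow {..<K}. \<bar>m n S - L S\<bar> < e"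
        using e mL by (intro eventually_ball_finite) (auto simp: tendsto_iff dist_real_def)
      moreover have "\<forall>\<^sub>F n in sequentially. c - e < m n {K..}"
        by (rule order_tendstoD(1)[OF mL]) (use c(2)[of K] e in linarith)
      ultimately have "\<forall>\<^sub>F n in sequentially. (\<forall>S\<in>Pow {..<K}. \<bar>m n S - L S\<bar> < e) \<and> c - e < m n {K..} \<and> N < n"
        using eventually_gt_at_top[of N] by eventually_elim simp
      then obtain n where n: "\<forall>S\<in>Pow {..<K}. \<bar>m n S - L S\<bar> < e" "c - e < m n {K..}" "N < n"
        using eventually_happens'[OF sequentially_bot] by blast
      have "\<forall>\<^sub>F K' in sequentially. m n {K'..} < e" by (rule order_tendstoD(2)[OF m_tail e])
      then have "\<forall>\<^sub>F K' in sequentially. m n {K'..} < e \<and> K < K'"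
        using eventually_gt_at_top[of K] by eventually_elim simp
      then obtain K' where "m n {K'..} < e" "K < K'"
        using eventually_happens'[OF sequentially_bot] by blast
      with n show ?thesis unfolding good_def by blast
    qed
    define P where "P z \<longleftrightarrow> fst (snd z) < snd (snd z) \<and> good (fst z) (fst (snd z)) (snd (snd z))" for z
    define Q where "Q z z' \<longleftrightarrow> fst (snd z') = snd (snd z) \<and> fst z < (fst z' :: nat)" for z z' :: "nat \<times> nat \<times> nat"
    have "\<exists>f. \<forall>j. P (f j) \<and> Q (f j) (f (Suc j))"
    proof (rule dependent_nat_choice)
      show "\<exists>z. P z" using ex[of 0 0] by (force simp: P_def)
      show "\<exists>z'. P z' \<and> Q z z'" for z
      proof -
        obtain n K' where "fst z < n" "snd (snd z) < K'" "good n (snd (snd z)) K'"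
          using ex[of "fst z" "snd (snd z)"] by blast
        then show ?thesis by (intro exI[of _ "(n, snd (snd z), K')"]) (simp add: P_def Q_def)
      qed
    qed
    then obtain f where f: "\<forall>j. P (f j) \<and> Q (f j) (f (Suc j))" ..
    define n K where "n j = fst (f j)" and "K j = fst (snd (f j))" for j
    have good: "good (n j) (K j) (K (Suc j))" and KS: "K j < K (Suc j)" for j
      using f by (simp_all add: n_def K_def P_def Q_def)
    have "strict_mono n" using f by (intro strict_monoI_Suc) (simp add: n_def Q_def)
    have Kmono: "strict_mono K" using KS by (intro strict_monoI_Suc)
    then have Kle: "K i \<le> K j \<longleftrightarrow> i \<le> j" for i j by (rule strict_mono_less_eq)
    define J where "J = {k. \<exists>j. even j \<and> K j \<le> k \<and> k < K (Suc j)}"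
    have mJ: "(\<lambda>j. m (n j) J) \<longlonglongrightarrow> L J"
      using LIMSEQ_subseq_LIMSEQ[OF mL \<open>strict_mono n\<close>] by (simp add: o_def)
    \<comment> \<open>Countable additivity of the limit is not known at this point, so
      \<open>l\<close> may differ from \<open>L J\<close>; it serves as the common reference for
      both parities.\<close>
    have "incseq (\<lambda>j. L (J \<inter> {..<K j}))" using KS by (intro incseq_SucI L_mono) (auto intro: less_trans)
    moreover have "L (J \<inter> {..<K j}) \<le> L J" for j by (intro L_mono) auto
    ultimately obtain l where l: "(\<lambda>j. L (J \<inter> {..<K j})) \<longlonglongrightarrow> l" using incseq_convergent by metis
    have low: "\<bar>m (n j) (J \<inter> {..<K j}) - L (J \<inter> {..<K j})\<bar> < e"
      and hi: "c - e < m (n j) {K j..}" and tl: "m (n j) {K (Suc j)..} < e" for j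
      using good[of j] by (auto simp: good_def)
    have even: "L (J \<inter> {..<K j}) + (c - 3 * e) \<le> m (n j) J" if "even j" for j
    proof -
      have "{K j..<K (Suc j)} \<subseteq> J" using that by (auto simp: J_def)
      then have "m (n j) ((J \<inter> {..<K j}) \<union> {K j..<K (Suc j)}) \<le> m (n j) J" by (intro m_mono) auto
      moreover have "m (n j) ((J \<inter> {..<K j}) \<union> {K j..<K (Suc j)}) = m (n j) (J \<inter> {..<K j}) + m (n j) {K j..<K (Suc j)}"
        by (intro m_Un) auto
      moreover have "m (n j) {K j..} = m (n j) {K j..<K (Suc j)} + m (n j) {K (Suc j)..}"
      proof -
        have "{K j..<K (Suc j)} \<inter> {K (Suc j)..} = {}" "{K j..<K (Suc j)} \<union> {K (Suc j)..} = {K j..}"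
          using KS[of j] by auto
        then show ?thesis using m_Un[of "{K j..<K (Suc j)}" "{K (Suc j)..}" "n j"] by simp
      qed
      ultimately show ?thesis using low[of j] hi[of j] tl[of j] by linarith
    qed
    have odd: "m (n j) J \<le> L (J \<inter> {..<K j}) + 2 * e" if "odd j" for j
    proof -
      have "J \<subseteq> (J \<inter> {..<K j}) \<union> {K (Suc j)..}"
      proof
        fix k assume "k \<in> J"
        then obtain i where i: "even i" "K i \<le> k" "k < K (Suc i)" by (auto simp: J_def)
        then have "i \<noteq> j" using that by auto
        then consider "Suc i \<le> j" | "Suc j \<le> i" by linarith
        then show "k \<in> (J \<inter> {..<K j}) \<union> {K (Suc j)..}"
        proof cases
          case 1
          then have "K (Suc i) \<le> K j" by (simp only: Kle)
          with i \<open>k \<in> J\<close> show ?thesis by auto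
        next
          case 2
          then have "K (Suc j) \<le> K i" by (simp only: Kle)
          with i show ?thesis by auto
        qed
      qed
      from m_mono[OF this, of "n j"] have "m (n j) J \<le> m (n j) ((J \<inter> {..<K j}) \<union> {K (Suc j)..})" .
      then have "m (n j) J \<le> m (n j) (J \<inter> {..<K j}) + m (n j) {K (Suc j)..}"
      proof -
        have "(J \<inter> {..<K j}) \<inter> {K (Suc j)..} = {}" using KS[of j] by auto
        with \<open>m (n j) J \<le> m (n j) ((J \<inter> {..<K j}) \<union> {K (Suc j)..})\<close> show ?thesis using m_Un[of "J \<inter> {..<K j}" "{K (Suc j)..}" "n j"] by simp
      qed
      then show ?thesis using low[of j] tl[of j] by linarith
    qed
    have "l + (c - 3 * e) \<le> L J"
    proof (rule LIMSEQ_le)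
      show "(\<lambda>i. L (J \<inter> {..<K (2 * i)}) + (c - 3 * e)) \<longlonglongrightarrow> l + (c - 3 * e)"
        using LIMSEQ_subseq_LIMSEQ[OF l, of "\<lambda>i. 2 * i"]
        by (intro tendsto_intros) (auto simp: o_def strict_mono_def)
      show "(\<lambda>i. m (n (2 * i)) J) \<longlonglongrightarrow> L J"
        using LIMSEQ_subseq_LIMSEQ[OF mJ, of "\<lambda>i. 2 * i"] by (auto simp: o_def strict_mono_def)
    qed (use even in auto)
    moreover have "L J \<le> l + 2 * e"
    proof (rule LIMSEQ_le)
      show "(\<lambda>i. L (J \<inter> {..<K (Suc (2 * i))}) + 2 * e) \<longlonglongrightarrow> l + 2 * e"
        using LIMSEQ_subseq_LIMSEQ[OF l, of "\<lambda>i. Suc (2 * i)"]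
        by (intro tendsto_intros) (auto simp: o_def strict_mono_def)
      show "(\<lambda>i. m (n (Suc (2 * i))) J) \<longlonglongrightarrow> L J"
        using LIMSEQ_subseq_LIMSEQ[OF mJ, of "\<lambda>i. Suc (2 * i)"] by (auto simp: o_def strict_mono_def)
    qed (use odd in auto)
    ultimately show False using e by (simp add: e_def)
  qed
  ultimately show ?thesis using c(1) by simp
qed

text \<open>Nikodym's convergence theorem for probability measures. Finite additivity passes to the
  limit, and the vanishing of the tails, \<open>setwise_limit_tail\<close>, turns it into countable
  additivity.\<close>

lemma setwise_limit:
  fixes \<nu> :: "nat \<Rightarrow> 'x::topological_space measure"
  assumes \<nu>: "\<And>n. \<nu> n \<in> borel_prob"
    and L: "\<And>A. A \<in> sets borel \<Longrightarrow> (\<lambda>n. measure (\<nu> n) A) \<longlonglongrightarrow> L A"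
  shows "\<exists>D\<in>borel_prob. \<forall>A\<in>sets borel. measure D A = L A"
proof -
  define D where "D = measure_of UNIV (sets borel) (\<lambda>A. ennreal (L A))"
  have sets: "sets D = sets borel" unfolding D_def using sets.sets_measure_of_eq[of borel] by simp
  have nonneg: "0 \<le> L A" if "A \<in> sets borel" for A by (rule LIMSEQ_le_const[OF L[OF that]]) auto
  have em: "emeasure D A = ennreal (L A)" if "A \<in> sets borel" for A
  proof (rule emeasure_measure_of[OF D_def])
    have "L {} = 0" using LIMSEQ_unique[OF L[of "{}"], of 0] by simp
    then show "positive (sets D) (\<lambda>A. ennreal (L A))" by (simp add: positive_def)
    show "countably_additive (sets D) (\<lambda>A. ennreal (L A))"
    proof (rule countably_additiveI)
      fix A :: "nat \<Rightarrow> 'x set" assume A: "range A \<subseteq> sets D" "disjoint_family A"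
      then have Ab: "A k \<in> sets borel" for k using sets by auto
      have UA: "(\<Union>k\<in>J. A k) \<in> sets borel" for J by (intro sets.countable_UN') (use Ab in auto)
      have tail: "(\<lambda>K. L (\<Union>k\<in>{K..}. A k)) \<longlonglongrightarrow> 0"
        using setwise_limit_tail[of \<nu> A "\<lambda>J. L (\<Union>k\<in>J. A k)", OF \<nu> Ab A(2) L[OF UA]] .
      have split: "L (\<Union>k. A k) = (\<Sum>k<K. L (A k)) + L (\<Union>k\<in>{K..}. A k)" for K
      proof (rule LIMSEQ_unique[OF L])
        show "(\<Union>k. A k) \<in> sets borel" by (rule UA)
        have "measure (\<nu> n) (\<Union>k. A k) = (\<Sum>k<K. measure (\<nu> n) (A k)) + measure (\<nu> n) (\<Union>k\<in>{K..}. A k)" for n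
        proof -
          have fin: "finite_measure (\<nu> n)" and sn: "sets (\<nu> n) = sets borel" using borel_probD[OF \<nu>] by auto
          have "(\<Union>k. A k) = (\<Union>k\<in>{..<K}. A k) \<union> (\<Union>k\<in>{K..}. A k)"
          proof -
            have "{..<K} \<union> {K..} = UNIV" by auto
            then show ?thesis by (metis UN_Un)
          qed
          moreover have "(\<Union>k\<in>{..<K}. A k) \<inter> (\<Union>k\<in>{K..}. A k) = {}"
          proof (rule ccontr)
            assume "(\<Union>k\<in>{..<K}. A k) \<inter> (\<Union>k\<in>{K..}. A k) \<noteq> {}"
            then obtain x i j where x: "i < K" "K \<le> j" "x \<in> A i" "x \<in> A j" by auto
            then have "A i \<inter> A j = {}" using A(2) by (simp add: disjoint_family_on_def)
            with x show False by auto
          qed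
          ultimately have "measure (\<nu> n) (\<Union>k. A k) = measure (\<nu> n) (\<Union>k\<in>{..<K}. A k) + measure (\<nu> n) (\<Union>k\<in>{K..}. A k)"
            using finite_measure.finite_measure_Union[OF fin] UA sn by metis
          also have "measure (\<nu> n) (\<Union>k\<in>{..<K}. A k) = (\<Sum>k<K. measure (\<nu> n) (A k))"
            using A(2) Ab sn by (intro finite_measure.finite_measure_finite_Union[OF fin])
              (auto simp: disjoint_family_on_def)
          finally show ?thesis .
        qed
        then show "(\<lambda>n. measure (\<nu> n) (\<Union>k. A k)) \<longlonglongrightarrow> (\<Sum>k<K. L (A k)) + L (\<Union>k\<in>{K..}. A k)"
          by (simp only:) (intro tendsto_intros L UA Ab)
      qed
      have "(\<lambda>K. L (\<Union>k. A k) - L (\<Union>k\<in>{K..}. A k)) \<longlonglongrightarrow> L (\<Union>k. A k) - 0"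
        by (intro tendsto_intros tail)
      also have "(\<lambda>K. L (\<Union>k. A k) - L (\<Union>k\<in>{K..}. A k)) = (\<lambda>K. \<Sum>k<K. L (A k))"
        using split by (intro ext) (metis add_diff_cancel_right')
      finally have "(\<lambda>k. L (A k)) sums L (\<Union>k. A k)" by (simp add: sums_def)
      then show "(\<Sum>k. ennreal (L (A k))) = ennreal (L (\<Union>k. A k))"
        by (intro suminf_ennreal_eq nonneg Ab)
    qed
  qed (use that sets in auto)
  have "L UNIV = 1"
  proof (rule LIMSEQ_unique[OF L])
    have "measure (\<nu> n) UNIV = 1" for n using borel_probD[OF \<nu>[of n]] prob_space.prob_space by metis
    then show "(\<lambda>n. measure (\<nu> n) UNIV) \<longlonglongrightarrow> 1" by simp
  qed simp
  then have "D \<in> borel_prob" unfolding borel_prob_def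
    using sets em[of UNIV] sets_eq_imp_space_eq[OF sets] by (auto intro!: prob_spaceI)
  moreover have "measure D A = L A" if "A \<in> sets borel" for A
    using em[OF that] nonneg[OF that] by (simp add: measure_def)
  ultimately show ?thesis by blast
qed

section \<open>Slices\<close>

definition slice :: "('a::polish_space \<times> 'b::polish_space) measure \<Rightarrow> 'b set \<Rightarrow> 'a measure" where
  "slice \<mu> E = distr (uniform_measure \<mu> (UNIV \<times> E)) borel fst"

lemma Times_borel:
  "A \<in> sets borel \<Longrightarrow> E \<in> sets borel \<Longrightarrow> (A :: 'a::second_countable_topology set) \<times> (E :: 'b::second_countable_topology set) \<in> sets borel"
  unfolding borel_prod[symmetric] by (rule pair_measureI)

lemma
  assumes \<mu>: "\<mu> \<in> borel_prob" and E: "E \<in> sets borel" and pos: "measure \<mu> (UNIV \<times> E) \<noteq> 0"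
  shows slice_borel_prob: "slice \<mu> E \<in> borel_prob"
    and measure_slice: "A \<in> sets borel \<Longrightarrow> measure (slice \<mu> E) A = measure \<mu> (A \<times> E) / measure \<mu> (UNIV \<times> E)"
proof -
  have sets: "sets \<mu> = sets borel" and fin: "finite_measure \<mu>" using borel_probD[OF \<mu>] by auto
  have em: "emeasure \<mu> (UNIV \<times> E) \<noteq> 0" "emeasure \<mu> (UNIV \<times> E) \<noteq> \<infinity>"
    using pos finite_measure.emeasure_eq_measure[OF fin] by auto
  have fst: "fst \<in> measurable (uniform_measure \<mu> (UNIV \<times> E)) borel"
    using sets by (subst measurable_cong_sets[of _ borel, OF _ refl])
      (auto intro!: borel_measurable_continuous_onI continuous_intros)
  show "slice \<mu> E \<in> borel_prob"
    unfolding borel_prob_def slice_def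
    using prob_space.prob_space_distr[OF prob_space_uniform_measure[OF em] fst] by simp
  show "measure (slice \<mu> E) A = measure \<mu> (A \<times> E) / measure \<mu> (UNIV \<times> E)" if A: "A \<in> sets borel"
  proof -
    have sp: "space \<mu> = UNIV" using borel_probD[OF \<mu>] by simp
    have "fst -` A \<inter> space (uniform_measure \<mu> (UNIV \<times> E)) = A \<times> UNIV" by (auto simp: sp)
    then have "measure (slice \<mu> E) A = measure (uniform_measure \<mu> (UNIV \<times> E)) (A \<times> UNIV)"
      unfolding slice_def measure_distr[OF fst A] by simp
    also have "\<dots> = measure \<mu> ((UNIV \<times> E) \<inter> (A \<times> UNIV)) / measure \<mu> (UNIV \<times> E)"
    proof (rule measure_uniform_measure[OF em])
      show "A \<times> UNIV \<in> sets \<mu>" unfolding sets using A by (intro Times_borel) auto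
    qed
    also have "(UNIV \<times> E) \<inter> (A \<times> UNIV) = A \<times> E" by auto
    finally show ?thesis .
  qed
qed

text \<open>Totality gives the limits one Borel set at a time. Along a regular sequence they are
  setwise limits of slices and therefore form a probability measure. The shift by \<open>N\<close>
  is there because slices are probability measures only once the denominators are nonzero.\<close>

lemma Dstar_slices:
  fixes \<mu> :: "('a::polish_space \<times> 'b::polish_space) measure"
  assumes \<mu>: "\<mu> \<in> borel_prob" and V: "V \<subseteq> sets borel" and tot: "Dstar_total \<mu> V"
  shows "\<exists>D\<in>borel_prob. Dstar \<mu> V x = {D} \<and>
    (\<forall>E. range E \<subseteq> V \<and> converges_regularly (marginal \<mu>) E x \<longrightarrow>
      (\<exists>N. (\<forall>n\<ge>N. measure \<mu> (UNIV \<times> E n) \<noteq> 0) \<and>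
        (\<forall>A\<in>sets borel. (\<lambda>n. measure (slice \<mu> (E (n + N))) A) \<longlonglongrightarrow> measure D A)))"
proof -
  obtain L where L: "\<And>A. A \<in> sets borel \<Longrightarrow> is_dstar_limit \<mu> V x A (L A)"
    using tot unfolding Dstar_total_def by metis
  have slices: "\<exists>N. (\<forall>n\<ge>N. measure \<mu> (UNIV \<times> E n) \<noteq> 0) \<and>
      (\<forall>A\<in>sets borel. (\<lambda>n. measure (slice \<mu> (E (n + N))) A) \<longlonglongrightarrow> L A)"
    if E: "range E \<subseteq> V" "converges_regularly (marginal \<mu>) E x" for E
  proof -
    \<comment> \<open>The set \<open>UNIV\<close> is used only to extract that the denominators are
      eventually nonzero.\<close>
    from L[of UNIV] E obtain N where N: "\<And>n. n \<ge> N \<Longrightarrow> measure \<mu> (UNIV \<times> E n) \<noteq> 0"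
      unfolding is_dstar_limit_def eventually_sequentially by force
    have "(\<lambda>n. measure (slice \<mu> (E (n + N))) A) \<longlonglongrightarrow> L A" if "A \<in> sets borel" for A
    proof -
      have "(\<lambda>n. measure \<mu> (A \<times> E n) / measure \<mu> (UNIV \<times> E n)) \<longlonglongrightarrow> L A"
        using L[OF that] E unfolding is_dstar_limit_def by blast
      from LIMSEQ_ignore_initial_segment[OF this, of N]
      moreover have "E n \<in> sets borel" for n using E(1) V by auto
      ultimately show ?thesis using N that by (subst measure_slice[OF \<mu>]) auto
    qed
    with N show ?thesis by blast
  qed
  obtain E where E: "range E \<subseteq> V" "converges_regularly (marginal \<mu>) E x"
    using L[of UNIV] unfolding is_dstar_limit_def by auto
  obtain N where N: "\<And>n. n \<ge> N \<Longrightarrow> measure \<mu> (UNIV \<times> E n) \<noteq> 0"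
     "\<And>A. A \<in> sets borel \<Longrightarrow> (\<lambda>n. measure (slice \<mu> (E (n + N))) A) \<longlonglongrightarrow> L A"
    using slices[OF E] by blast
  have "slice \<mu> (E (n + N)) \<in> borel_prob" for n
    using N(1)[of "n + N"] E(1) V by (intro slice_borel_prob \<mu>) auto
  from setwise_limit[of "\<lambda>n. slice \<mu> (E (n + N))" L, OF this N(2)]
  obtain D where D: "D \<in> borel_prob" "\<And>A. A \<in> sets borel \<Longrightarrow> measure D A = L A" by blast
  have "Dstar \<mu> V x = {D}"
  proof (intro equalityI subsetI)
    fix M assume "M \<in> Dstar \<mu> V x"
    then have M: "M \<in> borel_prob" "\<And>A. A \<in> sets borel \<Longrightarrow> is_dstar_limit \<mu> V x A (measure M A)"
      by (auto simp: Dstar_def)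
    have eq: "measure M A = measure D A" if "A \<in> sets borel" for A
    proof -
      have "(\<lambda>n. measure \<mu> (A \<times> E n) / measure \<mu> (UNIV \<times> E n)) \<longlonglongrightarrow> measure M A"
        "(\<lambda>n. measure \<mu> (A \<times> E n) / measure \<mu> (UNIV \<times> E n)) \<longlonglongrightarrow> L A"
        using M(2)[OF that] L[OF that] E unfolding is_dstar_limit_def by blast+
      from LIMSEQ_unique[OF this] show ?thesis by (simp add: D(2)[OF that])
    qed
    have "M = D"
    proof (rule measure_eqI)
      show "sets M = sets D" using borel_probD(1)[OF M(1)] borel_probD(1)[OF D(1)] by simp
      show "emeasure M A = emeasure D A" if "A \<in> sets M" for A
        using eq[of A] that finite_measure.emeasure_eq_measure[OF borel_probD(4)[OF M(1)]]
          finite_measure.emeasure_eq_measure[OF borel_probD(4)[OF D(1)]] borel_probD(1)[OF M(1)] by simp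
    qed
    then show "M \<in> {D}" by simp
  next
    fix M assume "M \<in> {D}"
    then show "M \<in> Dstar \<mu> V x" using D L unfolding Dstar_def by simp
  qed
  with D slices show ?thesis by (intro bexI[of _ D]) auto
qed


section \<open>Approximating slices by restricted Dirac combinations\<close>

text \<open>The code \<open>I\<close> stands for a set of atoms of the combination \<open>k\<close>,
  namely those whose entry in \<open>I\<close> is nonzero.\<close>

definition msum :: "nat \<Rightarrow> nat \<Rightarrow> nat" where
  "msum I k = (\<Sum>i<clen k. if el I i \<noteq> 0 then cw k i else 0)"

text \<open>The selected atoms are projected to the first coordinate, since atoms in a product space
  have pairs as their index, and renormalised.\<close>

definition mcomb :: "nat \<Rightarrow> nat \<Rightarrow> nat" where
  "mcomb I k = combcode (clen k) (\<lambda>i. pi1 (cpos k i)) (\<lambda>i. if el I i \<noteq> 0 then cw k i else 0)"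

lemma tot_msum [cintros]:
  assumes "tot f" "tot g" shows "tot (\<lambda>p x. msum (f p x) (g p x))"
  unfolding msum_def by (intro cintros assms tot_comp[OF assms(1)] tot_comp[OF assms(2)])

lemma tot_mcomb [cintros]:
  assumes "tot f" "tot g" shows "tot (\<lambda>p x. mcomb (f p x) (g p x))"
  unfolding mcomb_def by (intro cintros assms tot_comp[OF assms(1)] tot_comp[OF assms(2)])

lemma prod_dense_seq_pi: "prod_dense_seq s t n = (s (pi1 n), t (pi2 n))"
  by (simp add: prod_dense_seq_def pi1_def pi2_def)

lemma mem_thick_Times:
  "(x, y) \<in> thick (A \<times> u) e \<Longrightarrow> x \<in> thick A e \<and> (\<exists>b\<in>u. dist b y < e)"
  unfolding mem_thick using dist_fst_le[of "(_, _)" "(x, y)"] dist_snd_le[of "(_, _)" "(x, y)"]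
  by (auto intro: le_less_trans) (meson le_less_trans)+

text \<open>Atoms in \<open>I\<close> lie deep inside \<open>u\<close> and atoms in \<open>J\<close>
  deep inside \<open>v\<close>, so replacing \<mu> by the combination can go wrong only by the
  undecided weight and by \<open>e\<close>. The numerator of the slice is estimated from above and
  the denominator from below; \<open>cert\<close> makes both errors small relative to the selected
  weight, which also forces that weight to be positive.\<close>

lemma restricted_comb_close_slice:
  fixes s :: "nat \<Rightarrow> 'a::polish_space" and t :: "nat \<Rightarrow> 'b::polish_space"
  assumes \<mu>: "\<mu> \<in> borel_prob" and u: "u \<in> sets borel" "u \<inter> v = {}"
    and e: "0 < e" and cl: "close e (dirac_comb (prod_dense_seq s t) k) \<mu>"
    and I: "\<And>i. i < clen k \<Longrightarrow> el I i \<noteq> 0 \<Longrightarrow> ball (t (pi2 (cpos k i))) e \<subseteq> u"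
    and J: "\<And>i. i < clen k \<Longrightarrow> el J i \<noteq> 0 \<Longrightarrow> ball (t (pi2 (cpos k i))) e \<subseteq> v"
    and cert: "(real (ctot k) - real (msum I k) - real (msum J k)) + e * real (ctot k) \<le> \<tau> * real (msum I k)"
    and \<tau>: "0 < \<tau>" "\<tau> \<le> 1/2"
  shows "close (2 * \<tau>) (slice \<mu> u) (dirac_comb s (mcomb I k))" "measure \<mu> (UNIV \<times> u) \<noteq> 0"
proof -
  let ?\<eta> = "dirac_comb (prod_dense_seq s t) k" and ?L = "dirac_comb s (mcomb I k)"
  define W a b where "W = real (ctot k)" and "a = real (msum I k)" and "b = real (msum J k)"
  have \<eta>: "?\<eta> \<in> borel_prob" by (rule dirac_comb_borel_prob)
  have W: "0 < W" using ctot_pos by (simp add: W_def)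
  have excl: "\<not> (el I i \<noteq> 0 \<and> el J i \<noteq> 0)" if "i < clen k" for i
    using I[OF that] J[OF that] u(2) e by (metis centre_in_ball disjoint_iff subsetD)
  have split: "real (cw k i) = (if el I i \<noteq> 0 then real (cw k i) else 0) + (if el J i \<noteq> 0 then real (cw k i) else 0)
      + (if el I i = 0 \<and> el J i = 0 then real (cw k i) else 0)" if "i < clen k" for i
    using excl[OF that] by auto
  have a_eq: "a = (\<Sum>i<clen k. if el I i \<noteq> 0 then real (cw k i) else 0)"
    and b_eq: "b = (\<Sum>i<clen k. if el J i \<noteq> 0 then real (cw k i) else 0)"
    by (auto simp: a_def b_def msum_def intro!: sum.cong)
  have rest: "W - a - b = (\<Sum>i<clen k. if el I i = 0 \<and> el J i = 0 then real (cw k i) else 0)"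
  proof -
    have "W = (\<Sum>i<clen k. real (cw k i))" by (simp add: W_def ctot_def)
    also have "\<dots> = a + b + (\<Sum>i<clen k. if el I i = 0 \<and> el J i = 0 then real (cw k i) else 0)"
      unfolding a_eq b_eq sum.distrib[symmetric] by (intro sum.cong refl split) simp
    finally show ?thesis by simp
  qed
  have rest0: "0 \<le> W - a - b" unfolding rest by (intro sum_nonneg) auto
  have b0: "0 \<le> b" by (simp add: b_def)
  have aW: "a \<le> W" using rest0 b0 by linarith
  have "0 < e * W" using e W by simp
  with cert rest0 have "0 < \<tau> * a" unfolding W_def[symmetric] a_def[symmetric] b_def[symmetric] by linarith
  then have a: "0 < a" using \<tau> by (simp add: zero_less_mult_iff)
  have eW: "e * W \<le> \<tau> * W"
    using cert rest0 mult_left_mono[OF aW, of \<tau>] \<tau> unfolding W_def[symmetric] a_def[symmetric] b_def[symmetric] by linarith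
  then have e\<tau>: "e \<le> \<tau>" using W by simp
  \<comment> \<open>The fraction of undecided weight plus the Prokhorov error.\<close>
  define \<kappa> where "\<kappa> = (W - a - b) / W + e"
  have \<kappa>: "\<kappa> \<le> \<tau> * (a / W)"
  proof -
    have "((W - a - b) + e * W) / W \<le> (\<tau> * a) / W"
      using cert W unfolding W_def[symmetric] a_def[symmetric] b_def[symmetric] by (intro divide_right_mono) auto
    then show ?thesis using W unfolding \<kappa>_def by (simp add: add_divide_distrib)
  qed
  have lam: "measure ?L B = (\<Sum>i<clen k. (if el I i \<noteq> 0 then real (cw k i) else 0) * indicator B (s (pi1 (cpos k i)))) / a"
    if "B \<in> sets borel" for B
  proof -
    have "0 < msum I k" using a by (simp add: a_def)
    then have "0 < (\<Sum>i<clen k. if el I i \<noteq> 0 then cw k i else 0)" by (simp only: msum_def)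
    from measure_combcode[OF this that] show ?thesis
      unfolding mcomb_def a_def msum_def by (auto intro!: sum.cong arg_cong2[of _ _ _ _ "(/)"])
  qed
  have num: "measure \<mu> (A \<times> u) \<le> (a / W) * measure ?L (thick A e) + \<kappa>" if A: "A \<in> sets borel" for A
  proof -
    have "measure \<mu> (A \<times> u) \<le> measure ?\<eta> (thick (A \<times> u) e) + e"
      using close_sym[OF \<eta> \<mu> cl] Times_borel[OF A u(1)] by (simp add: close_def)
    also have "measure ?\<eta> (thick (A \<times> u) e) =
      (\<Sum>i<clen k. real (cw k i) * indicator (thick (A \<times> u) e) (prod_dense_seq s t (cpos k i))) / W"
      unfolding W_def by (rule measure_dirac_comb) simp
    also have "\<dots> \<le> (\<Sum>i<clen k. (if el I i \<noteq> 0 then real (cw k i) else 0) * indicator (thick A e) (s (pi1 (cpos k i)))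
        + (if el I i = 0 \<and> el J i = 0 then real (cw k i) else 0)) / W"
    proof (intro divide_right_mono sum_mono)
      fix i assume "i \<in> {..<clen k}"
      then have i: "i < clen k" by simp
      \<comment> \<open>An atom that is \<open>e\<close>-near to \<open>A \<times> u\<close> has a
        ball meeting \<open>u\<close>, so that ball is not contained in \<open>v\<close> and the
        atom is not in \<open>J\<close>.\<close>
      have "el J i = 0 \<and> s (pi1 (cpos k i)) \<in> thick A e" if "prod_dense_seq s t (cpos k i) \<in> thick (A \<times> u) e"
      proof -
        from that have 1: "s (pi1 (cpos k i)) \<in> thick A e" and 2: "\<exists>b\<in>u. dist b (t (pi2 (cpos k i))) < e"
          using mem_thick_Times[of "s (pi1 (cpos k i))" "t (pi2 (cpos k i))" A u e] by (auto simp: prod_dense_seq_pi)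
        from 2 have "ball (t (pi2 (cpos k i))) e \<inter> u \<noteq> {}" by (auto simp: dist_commute)
        with J[OF i] u(2) have "el J i = 0" by auto
        with 1 show ?thesis by simp
      qed
      then show "real (cw k i) * indicator (thick (A \<times> u) e) (prod_dense_seq s t (cpos k i)) \<le>
        (if el I i \<noteq> 0 then real (cw k i) else 0) * indicator (thick A e) (s (pi1 (cpos k i)))
        + (if el I i = 0 \<and> el J i = 0 then real (cw k i) else 0)"
        by (auto simp: indicator_def)
    qed (use W in auto)
    also have "\<dots> = (a / W) * measure ?L (thick A e) + (W - a - b) / W"
      unfolding sum.distrib rest[symmetric] lam[OF borel_thick] using a W by (simp add: field_simps)
    finally show ?thesis by (simp add: \<kappa>_def)
  qed
  have den: "a / W - e \<le> measure \<mu> (UNIV \<times> u)"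
  proof -
    \<comment> \<open>The test set is a cylinder over the finitely many selected points, and its
      thickening by \<open>e\<close> stays within the cylinder over \<open>u\<close>.\<close>
    define G where "G = (UNIV :: 'a set) \<times> ((\<lambda>i. t (pi2 (cpos k i))) ` {i. i < clen k \<and> el I i \<noteq> 0})"
    have G: "G \<in> sets borel" unfolding G_def by (rule Times_borel, simp, rule borel_closed, rule finite_imp_closed, simp)
    have "a / W \<le> measure ?\<eta> G"
      unfolding measure_dirac_comb[OF G] W_def[symmetric] a_eq
      using W by (intro divide_right_mono sum_mono) (auto simp: G_def prod_dense_seq_pi)
    also have "\<dots> \<le> measure \<mu> (thick G e) + e" using cl G by (simp add: close_def)
    also have "thick G e \<subseteq> UNIV \<times> u"
    proof
      fix z assume z: "z \<in> thick G e"
      obtain x y where xy: "z = (x, y)" by fastforce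
      from z obtain i where i: "i < clen k" "el I i \<noteq> 0" "dist (t (pi2 (cpos k i))) y < e"
        unfolding xy G_def by (auto dest!: mem_thick_Times)
      from I[OF i(1,2)] i(3) show "z \<in> UNIV \<times> u" by (auto simp: xy)
    qed
    then have "measure \<mu> (thick G e) \<le> measure \<mu> (UNIV \<times> u)"
      using u(1) by (intro measure_borel_prob_mono[OF \<mu>] Times_borel) auto
    finally show ?thesis by simp
  qed
  define x where "x = a / W"
  note num = num[folded x_def] and den = den[folded x_def] and \<kappa> = \<kappa>[folded x_def]
  define P where "P = measure \<mu> (UNIV \<times> u)"
  have "e \<le> \<kappa>" using rest0 W by (simp add: \<kappa>_def)
  then have P: "x * (1 - \<tau>) \<le> P" using den \<kappa> by (simp add: P_def algebra_simps)
  have aW0: "0 < x" using a W by (simp add: x_def)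
  have P0: "0 < P" using mult_pos_pos[OF aW0, of "1 - \<tau>"] P \<tau> by linarith
  then show nz: "measure \<mu> (UNIV \<times> u) \<noteq> 0" by (simp add: P_def)
  show "close (2 * \<tau>) (slice \<mu> u) ?L"
    unfolding close_def
  proof
    fix A :: "'a set" assume A: "A \<in> sets borel"
    define r where "r = measure (slice \<mu> u) A"
    have r1: "r \<le> 1" unfolding r_def by (rule measure_borel_prob_le_1[OF slice_borel_prob[OF \<mu> u(1) nz]])
    have r0: "0 \<le> r" by (simp add: r_def)
    have rP: "r * P = measure \<mu> (A \<times> u)"
      unfolding r_def measure_slice[OF \<mu> u(1) nz A] P_def using nz by simp
    have "r * (x * (1 - \<tau>)) \<le> r * P" using P r0 by (intro mult_left_mono)
    also have "\<dots> \<le> x * measure ?L (thick A e) + \<tau> * x"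
      unfolding rP using num[OF A] \<kappa> by linarith
    finally have "x * (r * (1 - \<tau>)) \<le> x * (measure ?L (thick A e) + \<tau>)"
      by (simp add: algebra_simps)
    then have "r * (1 - \<tau>) \<le> measure ?L (thick A e) + \<tau>" using aW0 by (simp add: mult_le_cancel_left_pos)
    \<comment> \<open>Since \<open>r \<le> 1\<close>, the factor \<open>1 - \<tau>\<close> costs
      another additive \<tau>, hence the bound \<open>2 * \<tau>\<close>.\<close>
    moreover have "\<tau> * r \<le> \<tau>" using r1 \<tau> by simp
    ultimately have "r \<le> measure ?L (thick A e) + 2 * \<tau>" by (simp add: algebra_simps)
    also have "measure ?L (thick A e) \<le> measure ?L (thick A (2 * \<tau>))"
      using e\<tau> \<tau> by (intro measure_borel_prob_mono dirac_comb_borel_prob thick_mono) auto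
    finally show "measure (slice \<mu> u) A \<le> measure ?L (thick A (2 * \<tau>)) + 2 * \<tau>" by (simp add: r_def)
  qed
qed

text \<open>An inner approximation of \<open>ball_sum t B\<close> for which membership of dense
  points is semidecidable. It depends on the enumerated balls and not only on their union.\<close>

definition shrink :: "(nat \<Rightarrow> 'x::metric_space) \<Rightarrow> (nat \<Rightarrow> nat \<Rightarrow> nat \<Rightarrow> bool) \<Rightarrow> real \<Rightarrow> 'x set" where
  "shrink t B e = {x. \<exists>i j r. B i j r \<and> dist x (t j) + e < rt r}"

lemma open_shrink: "open (shrink t B e)"
proof -
  have "shrink t B e = (\<Union>(j, r)\<in>{(j, r). \<exists>i. B i j r}. ball (t j) (rt r - e))"
    by (auto simp: shrink_def dist_commute less_diff_eq; blast)
  then show ?thesis by (auto intro!: open_UN)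
qed

lemma borel_UNIV_Times_shrink:
  "(UNIV :: 'a::polish_space set) \<times> shrink t (B :: nat \<Rightarrow> nat \<Rightarrow> nat \<Rightarrow> bool) e \<in> sets (borel :: ('a \<times> 'b::polish_space) measure)"
  by (intro Times_borel borel_open open_shrink) simp

lemma shrink_mono: "d \<le> e \<Longrightarrow> shrink t B e \<subseteq> shrink t B d"
  unfolding shrink_def by fastforce

lemma ball_subset_ball_sum: "x \<in> shrink t B e \<Longrightarrow> ball x e \<subseteq> ball_sum t B"
proof
  fix y assume x: "x \<in> shrink t B e" and y: "y \<in> ball x e"
  from x obtain i j r where B: "B i j r" "dist x (t j) + e < rt r" by (auto simp: shrink_def)
  have "dist (t j) y \<le> dist x (t j) + dist x y" by (metis dist_commute dist_triangle)
  with y B(2) have "dist (t j) y < rt r" by simp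
  with B(1) show "y \<in> ball_sum t B" by (auto simp: ball_sum_def)
qed

lemma shrink_ball: "x \<in> shrink t B (2 * e) \<Longrightarrow> dist x y < e \<Longrightarrow> y \<in> shrink t B e"
proof -
  assume x: "x \<in> shrink t B (2 * e)" and y: "dist x y < e"
  from x obtain i j r where B: "B i j r" "dist x (t j) + 2 * e < rt r" by (auto simp: shrink_def)
  have "dist y (t j) \<le> dist x y + dist x (t j)" by (metis dist_commute dist_triangle)
  with y B(2) have "dist y (t j) + e < rt r" by linarith
  with B(1) show ?thesis by (auto simp: shrink_def)
qed

text \<open>The radius \<open>4 * (1/2) ^ m\<close> is twice the margin used when testing atoms; one
  half of it is lost in passing from \<mu> to a combination.\<close>

lemma shrink_measure_tendsto:
  fixes \<mu> :: "('a::polish_space \<times> 'b::polish_space) measure"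
  assumes \<mu>: "\<mu> \<in> borel_prob"
  shows "(\<lambda>m. measure \<mu> (UNIV \<times> shrink t B (4 * (1/2) ^ m))) \<longlonglongrightarrow> measure \<mu> (UNIV \<times> ball_sum t B)"
proof -
  let ?G = "\<lambda>m. (UNIV :: 'a set) \<times> shrink t B (4 * (1/2) ^ m)"
  have "(\<lambda>m. measure \<mu> (?G m)) \<longlonglongrightarrow> measure \<mu> (\<Union>m. ?G m)"
  proof (rule finite_measure.finite_Lim_measure_incseq)
    show "range ?G \<subseteq> sets \<mu>" unfolding borel_probD(1)[OF \<mu>]
      using borel_UNIV_Times_shrink by blast
    show "incseq ?G" by (intro incseq_SucI Sigma_mono shrink_mono) auto
  qed (rule borel_probD[OF \<mu>])
  moreover have "(\<Union>m. ?G m) = UNIV \<times> ball_sum t B"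
  proof -
    have "(\<Union>m. shrink t B (4 * (1/2) ^ m)) = ball_sum t B"
    proof (intro equalityI subsetI)
      fix x assume "x \<in> (\<Union>m. shrink t B (4 * (1/2) ^ m))"
      then obtain m where "x \<in> shrink t B (4 * (1/2) ^ m)" by blast
      from ball_subset_ball_sum[OF this] show "x \<in> ball_sum t B" by auto
    next
      fix x assume "x \<in> ball_sum t B"
      then obtain i j r where B: "B i j r" "dist (t j) x < rt r" by (auto simp: ball_sum_def)
      then obtain m where "(1/2) ^ m < (rt r - dist (t j) x) / 4"
        using real_arch_pow_inv[of "(rt r - dist (t j) x) / 4" "1/2"] by auto
      then have "x \<in> shrink t B (4 * (1/2) ^ m)" using B(1) by (force simp: shrink_def dist_commute)
      then show "x \<in> (\<Union>m. shrink t B (4 * (1/2) ^ m))" by blast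
    qed
    then show ?thesis by auto
  qed
  ultimately show ?thesis by simp
qed

text \<open>Thickening \<open>shrink t B (2 * e)\<close> by \<open>e\<close> stays inside
  \<open>shrink t B e\<close>, so the accepted atoms carry nearly all of the mass of the smaller
  set.\<close>

lemma shrink_mass_lower:
  fixes s :: "nat \<Rightarrow> 'a::polish_space" and t :: "nat \<Rightarrow> 'b::polish_space"
  assumes \<mu>: "\<mu> \<in> borel_prob" and e: "0 < e" and cl: "close e (dirac_comb (prod_dense_seq s t) k) \<mu>"
    and I: "\<And>i. i < clen k \<Longrightarrow> el I i \<noteq> 0 \<longleftrightarrow> t (pi2 (cpos k i)) \<in> shrink t B e"
  shows "measure \<mu> (UNIV \<times> shrink t B (2 * e)) - e \<le> real (msum I k) / real (ctot k)"
proof -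
  let ?\<eta> = "dirac_comb (prod_dense_seq s t) k" and ?G = "(UNIV :: 'a set) \<times> shrink t B (2 * e)" and ?H = "(UNIV :: 'a set) \<times> shrink t B e"
  have b: "?G \<in> sets borel" "?H \<in> sets borel" by (rule borel_UNIV_Times_shrink)+
  have "measure \<mu> ?G \<le> measure ?\<eta> (thick ?G e) + e"
    using close_sym[OF dirac_comb_borel_prob \<mu> cl] b by (simp add: close_def)
  also have "thick ?G e \<subseteq> ?H" using shrink_ball[of _ t B e] by (auto dest!: mem_thick_Times)
  then have "measure ?\<eta> (thick ?G e) \<le> measure ?\<eta> ?H" by (intro measure_borel_prob_mono dirac_comb_borel_prob b)
  also have "measure ?\<eta> ?H = real (msum I k) / real (ctot k)"
  proof -
    have "(\<Sum>i<clen k. real (cw k i) * indicator ?H (prod_dense_seq s t (cpos k i))) = real (msum I k)"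
      unfolding msum_def of_nat_sum
    proof (intro sum.cong refl)
      fix i assume "i \<in> {..<clen k}"
      then show "real (cw k i) * indicator ?H (prod_dense_seq s t (cpos k i)) = real (if el I i \<noteq> 0 then cw k i else 0)"
        using I[of i] by (auto simp: prod_dense_seq_pi indicator_def)
    qed
    then show ?thesis unfolding measure_dirac_comb[OF b(2)] by simp
  qed
  finally show ?thesis by simp
qed

text \<open>This shows that the search for a certificate succeeds. The two open sets together have
  full measure, so with growing precision the accepted atoms exhaust the weight on both sides, while
  the right-hand side of the certificate stays bounded away from 0 relative to the total
  weight.\<close>

lemma restricted_comb_exists:
  fixes s :: "nat \<Rightarrow> 'a::polish_space" and t :: "nat \<Rightarrow> 'b::polish_space"
  assumes \<mu>: "\<mu> \<in> borel_prob" and h: "\<And>m. close (2 * (1/2) ^ m) (dirac_comb (prod_dense_seq s t) (h m)) \<mu>"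
    and pos: "measure \<mu> (UNIV \<times> ball_sum t B) \<noteq> 0"
    and full: "measure \<mu> (UNIV \<times> ball_sum t C) = 1 - measure \<mu> (UNIV \<times> ball_sum t B)" and \<tau>: "0 < \<tau>"
  shows "\<exists>m I J. (\<forall>i<clen (h m). el I i \<noteq> 0 \<longleftrightarrow> t (pi2 (cpos (h m) i)) \<in> shrink t B (2 * (1/2) ^ m)) \<and>
    (\<forall>i<clen (h m). el J i \<noteq> 0 \<longleftrightarrow> t (pi2 (cpos (h m) i)) \<in> shrink t C (2 * (1/2) ^ m)) \<and>
    (real (ctot (h m)) - real (msum I (h m)) - real (msum J (h m))) + 2 * (1/2) ^ m * real (ctot (h m))
      \<le> \<tau> * real (msum I (h m))"
proof -
  define P where "P = measure \<mu> (UNIV \<times> ball_sum t B)"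
  have P: "0 < P" using pos by (simp add: P_def zero_less_measure_iff)
  \<comment> \<open>Chosen such that \<open>5 * \<kappa> = \<tau> * (P - 2 * \<kappa>)\<close>. Each
    of the two accepted fractions falls short of its limit by at most \<open>2 * \<kappa>\<close>,
    and the Prokhorov error contributes one more \<kappa>.\<close>
  define \<kappa> where "\<kappa> = P * \<tau> / (5 + 2 * \<tau>)"
  have \<kappa>: "0 < \<kappa>" "5 * \<kappa> + 2 * \<kappa> * \<tau> = \<tau> * P" 
  proof -
    show "0 < \<kappa>" using P \<tau> by (simp add: \<kappa>_def)
    have "\<kappa> * (5 + 2 * \<tau>) = P * \<tau>" using \<tau> by (simp add: \<kappa>_def)
    then show "5 * \<kappa> + 2 * \<kappa> * \<tau> = \<tau> * P" by (simp add: algebra_simps)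
  qed
  have "\<forall>\<^sub>F m in sequentially. P - \<kappa> < measure \<mu> (UNIV \<times> shrink t B (4 * (1/2) ^ m))"
    using \<kappa> by (intro order_tendstoD(1)[OF shrink_measure_tendsto[OF \<mu>]]) (simp add: P_def)
  moreover have "\<forall>\<^sub>F m in sequentially. (1 - P) - \<kappa> < measure \<mu> (UNIV \<times> shrink t C (4 * (1/2) ^ m))"
    using \<kappa> full by (intro order_tendstoD(1)[OF shrink_measure_tendsto[OF \<mu>]]) (simp add: P_def)
  moreover have "(\<lambda>m. 2 * (1/2 :: real) ^ m) \<longlonglongrightarrow> 2 * 0" by (intro tendsto_intros) auto
  then have "\<forall>\<^sub>F m in sequentially. 2 * (1/2) ^ m < \<kappa>" by (rule order_tendstoD(2)) (use \<kappa> in simp)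
  ultimately have "\<forall>\<^sub>F m in sequentially. P - \<kappa> < measure \<mu> (UNIV \<times> shrink t B (4 * (1/2) ^ m)) \<and>
    (1 - P) - \<kappa> < measure \<mu> (UNIV \<times> shrink t C (4 * (1/2) ^ m)) \<and> 2 * (1/2) ^ m < \<kappa>"
    by eventually_elim simp
  then obtain m where m: "P - \<kappa> < measure \<mu> (UNIV \<times> shrink t B (4 * (1/2) ^ m))"
    "(1 - P) - \<kappa> < measure \<mu> (UNIV \<times> shrink t C (4 * (1/2) ^ m))" "2 * (1/2) ^ m < \<kappa>"
    using eventually_happens'[OF sequentially_bot] by blast
  define e where "e = 2 * (1/2 :: real) ^ m"
  have e: "0 < e" "4 * (1/2) ^ m = 2 * e" by (simp_all add: e_def)
  obtain I where I: "\<forall>i<clen (h m). el I i = of_bool (t (pi2 (cpos (h m) i)) \<in> shrink t B e)"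
    using ex_el[of "clen (h m)" "\<lambda>i. of_bool (t (pi2 (cpos (h m) i)) \<in> shrink t B e)"] by blast
  obtain J where J: "\<forall>i<clen (h m). el J i = of_bool (t (pi2 (cpos (h m) i)) \<in> shrink t C e)"
    using ex_el[of "clen (h m)" "\<lambda>i. of_bool (t (pi2 (cpos (h m) i)) \<in> shrink t C e)"] by blast
  define W a b where "W = real (ctot (h m))" and "a = real (msum I (h m))" and "b = real (msum J (h m))"
  have W: "0 < W" using ctot_pos by (simp add: W_def)
  have "measure \<mu> (UNIV \<times> shrink t B (2 * e)) - e \<le> a / W" unfolding a_def W_def
    by (rule shrink_mass_lower[OF \<mu> e(1)]) (use h[of m] I in \<open>auto simp: e_def\<close>)
  then have a: "P - 2 * \<kappa> \<le> a / W" using m unfolding e(2) e_def[symmetric] by linarith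
  have "measure \<mu> (UNIV \<times> shrink t C (2 * e)) - e \<le> b / W" unfolding b_def W_def
    by (rule shrink_mass_lower[OF \<mu> e(1)]) (use h[of m] J in \<open>auto simp: e_def\<close>)
  then have b: "(1 - P) - 2 * \<kappa> \<le> b / W" using m unfolding e(2) e_def[symmetric] by linarith
  have "\<tau> * (P - 2 * \<kappa>) \<le> \<tau> * (a / W)" using a \<tau> by (intro mult_left_mono) auto
  moreover have "\<tau> * (P - 2 * \<kappa>) = 5 * \<kappa>" using \<kappa>(2) by (simp add: algebra_simps)
  ultimately have "1 - a / W - b / W + e \<le> \<tau> * (a / W)"
    using a b m(3) unfolding e_def[symmetric] by linarith
  then have "(1 - a / W - b / W + e) * W \<le> (\<tau> * (a / W)) * W" using W by (intro mult_right_mono) auto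
  then have "(W - a - b) + e * W \<le> \<tau> * a" using W by (simp add: algebra_simps)
  with I J show ?thesis unfolding W_def a_def b_def e_def
    by (intro exI[of _ m] exI[of _ I] exI[of _ J]) auto
qed


section \<open>Approximating the values of the derivative\<close>

lemma measure_marginal:
  fixes \<mu> :: "('a::polish_space \<times> 'b::polish_space) measure"
  assumes \<mu>: "\<mu> \<in> borel_prob"
  shows "marginal \<mu> \<in> borel_prob" "A \<in> sets borel \<Longrightarrow> measure (marginal \<mu>) A = measure \<mu> (UNIV \<times> A)"
proof -
  have snd: "snd \<in> measurable \<mu> borel"
    using borel_probD(1)[OF \<mu>] by (subst measurable_cong_sets[of _ borel, OF _ refl])
      (auto intro!: borel_measurable_continuous_onI continuous_intros)
  show "marginal \<mu> \<in> borel_prob"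
    unfolding marginal_def borel_prob_def
    using prob_space.prob_space_distr[OF borel_probD(2)[OF \<mu>] snd] by simp
  show "measure (marginal \<mu>) A = measure \<mu> (UNIV \<times> A)" if "A \<in> sets borel"
  proof -
    have "snd -` A \<inter> space \<mu> = UNIV \<times> A" using borel_probD(3)[OF \<mu>] by auto
    then show ?thesis unfolding marginal_def measure_distr[OF snd that] by simp
  qed
qed

definition marg_code :: "nat \<Rightarrow> nat" where
  "marg_code k = combcode (clen k) (\<lambda>i. pi2 (cpos k i)) (\<lambda>i. cw k i)"

lemma tot_marg_code [cintros]:
  assumes "tot f" shows "tot (\<lambda>p x. marg_code (f p x))"
  unfolding marg_code_def by (intro cintros assms tot_comp[OF assms])

lemma measure_marg_code:
  fixes s :: "nat \<Rightarrow> 'a::polish_space" and t :: "nat \<Rightarrow> 'b::polish_space"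
  assumes A: "A \<in> sets borel"
  shows "measure (dirac_comb t (marg_code k)) A = measure (dirac_comb (prod_dense_seq s t) k) (UNIV \<times> A)"
proof -
  have UA: "(UNIV :: 'a set) \<times> A \<in> sets borel" using A by (intro Times_borel) auto
  have "0 < (\<Sum>i<clen k. cw k i)" using ctot_pos[of k] by (simp add: ctot_def)
  from measure_combcode[OF this A] show ?thesis
    unfolding marg_code_def measure_dirac_comb[OF UA]
    by (simp add: ctot_def prod_dense_seq_pi indicator_def)
qed

text \<open>Thickening a cylinder stays inside the cylinder over the thickened base, so projecting
  to the second coordinate does not increase distances.\<close>

lemma prokhorov_marginal:
  fixes \<mu> :: "('a::polish_space \<times> 'b::polish_space) measure"
  assumes \<mu>: "\<mu> \<in> borel_prob"
  shows "prokhorov (dirac_comb t (marg_code k)) (marginal \<mu>) \<le> prokhorov (dirac_comb (prod_dense_seq s t) k) \<mu>"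
proof (rule field_le_epsilon)
  let ?\<eta> = "dirac_comb (prod_dense_seq s t) k"
  fix e :: real assume e: "0 < e"
  define d where "d = prokhorov ?\<eta> \<mu> + e"
  have d: "0 < d" using e prokhorov_nonneg[OF dirac_comb_borel_prob \<mu>, of "prod_dense_seq s t" k] by (simp add: d_def)
  have cl: "close d ?\<eta> \<mu>"
    by (rule prokhorov_closeD[OF dirac_comb_borel_prob \<mu>]) (use e in \<open>simp add: d_def\<close>)
  have "close d (dirac_comb t (marg_code k)) (marginal \<mu>)"
    unfolding close_def
  proof
    fix A :: "'b set" assume A: "A \<in> sets borel"
    have A': "(UNIV :: 'a set) \<times> A \<in> sets borel" "(UNIV :: 'a set) \<times> thick A d \<in> sets borel"
      using A by (auto intro!: Times_borel)
    have "measure (dirac_comb t (marg_code k)) A = measure ?\<eta> (UNIV \<times> A)" by (rule measure_marg_code[OF A])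
    also have "\<dots> \<le> measure \<mu> (thick (UNIV \<times> A) d) + d" using cl A' by (simp add: close_def)
    also have "thick (UNIV \<times> A) d \<subseteq> UNIV \<times> thick A d" by (auto dest!: mem_thick_Times simp: mem_thick)
    then have "measure \<mu> (thick (UNIV \<times> A) d) \<le> measure \<mu> (UNIV \<times> thick A d)"
      by (intro measure_borel_prob_mono \<mu> A')
    also have "\<dots> = measure (marginal \<mu>) (thick A d)" by (simp add: measure_marginal[OF \<mu>])
    finally show "measure (dirac_comb t (marg_code k)) A \<le> measure (marginal \<mu>) (thick A d) + d" by simp
  qed
  then show "prokhorov (dirac_comb t (marg_code k)) (marginal \<mu>) \<le> prokhorov ?\<eta> \<mu> + e"
    unfolding d_def[symmetric] using d by (intro prokhorov_le dirac_comb_borel_prob measure_marginal \<mu>)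
qed

definition evenR :: "orc \<Rightarrow> orc" where "evenR G i y = G (2 * i) y"
definition oddR :: "orc \<Rightarrow> orc" where "oddR G i y = G (2 * i + 1) y"

lemma evenR_graph: "evenR (graph (pair_seq p q)) = graph p"
  and oddR_graph: "oddR (graph (pair_seq p q)) = graph q"
  by (intro ext; simp add: evenR_def oddR_def graph_def pair_seq_def)+

lemma sig_evenR [cintros]:
  assumes G: "sigR G" and "tot f" "tot g"
  shows "sig (\<lambda>p z. evenR (G p z) (f p z) (g p z))"
  unfolding evenR_def by (intro cintros sig_subst3[OF G] assms)

lemma sig_oddR [cintros]:
  assumes G: "sigR G" and "tot f" "tot g"
  shows "sig (\<lambda>p z. oddR (G p z) (f p z) (g p z))"
  unfolding oddR_def by (intro cintros sig_subst3[OF G] assms)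

section \<open>The search for approximate slices\<close>

locale dstar_setting = comp_metric \<delta>T t for \<delta>T :: "'b::polish_space rep" and t +
  fixes s :: "nat \<Rightarrow> 'a::polish_space" and \<mu> :: "('a \<times> 'b) measure" and V :: "'b set set"
  assumes \<mu>: "\<mu> \<in> borel_prob"
    and \<mu>_computable: "computable_point (rep_prob (prod_dense_seq s t)) \<mu>"
    and V: "V \<subseteq> sets borel"
    and vitali: "strong_vitali_covering_property \<delta>T t (marginal \<mu>) V"
    and total: "Dstar_total \<mu> V"
begin

definition h :: baire where
  "h = (SOME p. computable_seq p \<and> rep_prob (prod_dense_seq s t) p = Some \<mu>)"

lemma h: "computable_seq h" "rep_prob (prod_dense_seq s t) h = Some \<mu>"
proof -
  have "\<exists>p. computable_seq p \<and> rep_prob (prod_dense_seq s t) p = Some \<mu>"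
    using \<mu>_computable unfolding computable_point_def by blast
  then have "computable_seq h \<and> rep_prob (prod_dense_seq s t) h = Some \<mu>"
    unfolding h_def by (rule someI_ex)
  then show "computable_seq h" "rep_prob (prod_dense_seq s t) h = Some \<mu>" by auto
qed

lemmas tot_h [cintros] = tot_computable_seq[OF h(1)]

lemma close_h: "close (2 * (1/2) ^ m) (dirac_comb (prod_dense_seq s t) (h m)) \<mu>"
proof -
  have "prokhorov (dirac_comb (prod_dense_seq s t) (h m)) \<mu> \<le> (1/2) ^ m" by (rule rep_prob_SomeD[OF h(2)])
  also have "\<dots> < 2 * (1/2) ^ m" by simp
  finally show ?thesis by (intro prokhorov_closeD dirac_comb_borel_prob \<mu>)
qed

text \<open>The Vitali map is computable only relative to the marginal. Projecting the computable
  name of \<mu> yields a computable name of the marginal, which is fed to the Vitali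
  machine.\<close>

lemma marginal_name: "rep_prob t (\<lambda>m. marg_code (h m)) = Some (marginal \<mu>)"
  by (intro rep_prob_Some measure_marginal \<mu> order_trans[OF prokhorov_marginal[OF \<mu>, where s = s] rep_prob_SomeD(2)[OF h(2)]])

text \<open>Only the existence of suitable sets \<open>E\<close> is kept, so that the multi-valued
  map behind the strong Vitali property disappears from the later statements.\<close>

definition vitali_name :: "baire \<Rightarrow> 'b \<Rightarrow> bool" where
  "vitali_name q x \<longleftrightarrow> (\<exists>u E. rep_fun rep_nat (rep_open_cont \<delta>T (marginal \<mu>)) q = Some u \<and>
     range E \<subseteq> V \<and> converges_regularly (marginal \<mu>) E x \<and>
     (\<forall>n. u n \<subseteq> E n \<and> measure (marginal \<mu>) (u n) = measure (marginal \<mu>) (E n)))"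

definition vitali_prog :: "nat \<Rightarrow> bool" where
  "vitali_prog E \<longleftrightarrow> (\<forall>p x. \<delta>T p = Some x \<longrightarrow>
     (\<exists>q. run (pairR (graph (\<lambda>m. marg_code (h m))) (graph p)) E = graph q \<and> vitali_name q x))"

definition vcode :: nat where "vcode = (SOME E. vitali_prog E)"

lemma vcode: "vitali_prog vcode"
proof -
  let ?\<nu> = "marginal \<mu>"
  obtain U :: "'b \<Rightarrow> (nat \<Rightarrow> 'b set) set" where
    U0: "\<forall>x. U x \<noteq> {} \<and> U x \<subseteq> ran (rep_fun rep_nat (rep_open_cont \<delta>T ?\<nu>))"
    and comp: "rep_computable (rep_prod (rep_prob t) \<delta>T) (rep_fun rep_nat (rep_open_cont \<delta>T ?\<nu>))
          (\<lambda>(\<nu>', x). if \<nu>' = ?\<nu> then U x else {})"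
    and U1: "\<forall>x. \<forall>u \<in> U x. \<exists>E. range E \<subseteq> V \<and> converges_regularly ?\<nu> E x \<and>
           (\<forall>n. u n \<subseteq> E n \<and> measure ?\<nu> (u n) = measure ?\<nu> (E n))"
    using vitali unfolding strong_vitali_covering_property_def by (elim conjE exE)
  have ne: "U x \<noteq> {}" for x using U0 by simp
  note U = U1[rule_format]
  obtain E where E: "\<forall>p z. rep_prod (rep_prob t) \<delta>T p = Some z \<and> (\<lambda>(\<nu>', x). if \<nu>' = ?\<nu> then U x else {}) z \<noteq> {} \<longrightarrow>
    (\<exists>q y. run (graph p) E = graph q \<and> rep_fun rep_nat (rep_open_cont \<delta>T ?\<nu>) q = Some y \<and>
      y \<in> (\<lambda>(\<nu>', x). if \<nu>' = ?\<nu> then U x else {}) z)"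
    using rep_computable_run[OF comp] by (rule exE)
  have "vitali_prog E"
    unfolding vitali_prog_def
  proof (intro allI impI)
    fix p x assume p: "\<delta>T p = Some x"
    have "rep_prod (rep_prob t) \<delta>T (pair_seq (\<lambda>m. marg_code (h m)) p) = Some (?\<nu>, x)"
      by (rule rep_prod_pair[of "rep_prob t" "\<lambda>m. marg_code (h m)" ?\<nu> \<delta>T p x, OF marginal_name p])
    then obtain q u where q: "run (graph (pair_seq (\<lambda>m. marg_code (h m)) p)) E = graph q"
      "rep_fun rep_nat (rep_open_cont \<delta>T ?\<nu>) q = Some u" "u \<in> U x"
      using E[rule_format, of "pair_seq (\<lambda>m. marg_code (h m)) p" "(?\<nu>, x)"] ne[of x] by auto
    from U[OF q(3)] q(1,2)
    show "\<exists>q. run (pairR (graph (\<lambda>m. marg_code (h m))) (graph p)) E = graph q \<and> vitali_name q x"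
      unfolding pairR_graph vitali_name_def by blast
  qed
  then show ?thesis unfolding vcode_def by (rule someI)
qed

text \<open>The sequence \<open>q\<close> is turned into a name of the point, then into a name of a
  sequence of continuity sets, and then into a name of its \<open>N\<close>-th member. The even half
  of the latter names the open set, the odd half a set filling its complement up to a null
  set.\<close>

definition setsR :: "baire \<Rightarrow> nat \<Rightarrow> orc" where
  "setsR q N = applyR (run (pairR (graph (\<lambda>m. marg_code (h m))) (limR (graph q))) vcode) (natR N)"

lemma sig_setsR [cintros]:
  assumes "tot N" "tot f" "tot g" shows "sig (\<lambda>q z. setsR q (N q z) (f q z) (g q z))"
  unfolding setsR_def by (intro cintros assms tot_comp[OF assms(1)])

definition good_sets :: "orc \<Rightarrow> 'b set \<Rightarrow> 'b set \<Rightarrow> 'b set \<Rightarrow> bool" where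
  "good_sets P u W E \<longleftrightarrow> ball_sum t (ballR (evenR P)) = u \<and> ball_sum t (ballR (oddR P)) = W \<and>
      open u \<and> u \<inter> W = {} \<and> (\<forall>A\<in>sets borel. measure \<mu> (A \<times> u) = measure \<mu> (A \<times> E)) \<and>
      measure \<mu> (UNIV \<times> W) = 1 - measure \<mu> (UNIV \<times> u)"

lemma setsR:
  assumes "fast q x"
  shows "\<exists>u W E. range E \<subseteq> V \<and> converges_regularly (marginal \<mu>) E x \<and>
    (\<forall>N. good_sets (setsR q N) (u N) (W N) (E N))"
proof -
  let ?\<nu> = "marginal \<mu>"
  have \<nu>: "?\<nu> \<in> borel_prob" by (rule measure_marginal[OF \<mu>])
  obtain p where p: "limR (graph q) = graph p" "\<delta>T p = Some x" using limR_fast[OF assms] by blast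
  obtain q' u E where q': "run (pairR (graph (\<lambda>m. marg_code (h m))) (graph p)) vcode = graph q'"
     "rep_fun rep_nat (rep_open_cont \<delta>T ?\<nu>) q' = Some u"
    and E: "range E \<subseteq> V" "converges_regularly ?\<nu> E x"
     "\<And>n. u n \<subseteq> E n \<and> measure ?\<nu> (u n) = measure ?\<nu> (E n)"
    using vcode p(2) unfolding vitali_prog_def vitali_name_def by blast
  have "\<exists>W. good_sets (setsR q N) (u N) W (E N)" for N
  proof -
    obtain w where w: "applyR (graph q') (natR N) = graph w" "rep_open_cont \<delta>T ?\<nu> w = Some (u N)"
      using applyR_rep_fun_nat[OF q'(2)] by blast
    obtain a b W where W: "w = pair_seq a b" "rep_open \<delta>T a = Some (u N)" "rep_open \<delta>T b = Some W"
      "W \<subseteq> - u N" "measure ?\<nu> W = measure ?\<nu> (- u N)"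
      using rep_of_SomeD[OF w(2)[unfolded rep_open_cont_def]] by blast
    have st: "setsR q N = graph (pair_seq a b)" unfolding setsR_def p(1) q'(1) w(1) W(1) ..
    have op: "open (u N)" "open W" using open_rep_open W by blast+
    have Eb: "E N \<in> sets borel" using E(1) V by auto
    have fin: "finite_measure \<mu>" using borel_probD[OF \<mu>] by simp
    have "measure \<mu> (A \<times> u N) = measure \<mu> (A \<times> E N)" if A: "A \<in> sets borel" for A
    proof (rule antisym)
      show "measure \<mu> (A \<times> u N) \<le> measure \<mu> (A \<times> E N)"
        using E(3)[of N] A Eb by (intro measure_borel_prob_mono \<mu> Times_borel) auto
      have b: "A \<times> u N \<in> sets \<mu>" "UNIV \<times> (E N - u N) \<in> sets \<mu>" "UNIV \<times> E N \<in> sets \<mu>" "UNIV \<times> u N \<in> sets \<mu>"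
        unfolding borel_probD(1)[OF \<mu>] using A Eb op by (auto intro!: Times_borel)
      \<comment> \<open>What \<open>A \<times> E N\<close> has beyond \<open>A \<times> u N\<close>
        lies in the cylinder over \<open>E N - u N\<close>, a null set of the marginal.\<close>
      have "measure \<mu> (A \<times> E N) \<le> measure \<mu> ((A \<times> u N) \<union> (UNIV \<times> (E N - u N)))"
        using b borel_probD(1)[OF \<mu>] by (intro measure_borel_prob_mono \<mu>) auto
      also have "\<dots> \<le> measure \<mu> (A \<times> u N) + measure \<mu> (UNIV \<times> (E N - u N))"
        using b by (intro measure_Un_le)
      also have "UNIV \<times> (E N - u N) = UNIV \<times> E N - UNIV \<times> u N" by auto
      also have "measure \<mu> (UNIV \<times> E N - UNIV \<times> u N) = measure \<mu> (UNIV \<times> E N) - measure \<mu> (UNIV \<times> u N)"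
        using b E(3)[of N] by (intro finite_measure.finite_measure_Diff fin) auto
      also have "\<dots> = 0" using E(3)[of N] Eb op by (simp flip: measure_marginal(2)[OF \<mu>])
      finally show "measure \<mu> (A \<times> E N) \<le> measure \<mu> (A \<times> u N)" by simp
    qed
    moreover have "measure \<mu> (UNIV \<times> W) = 1 - measure \<mu> (UNIV \<times> u N)"
      using W(5) measure_borel_prob_Compl[OF \<nu>, of "u N"] op by (simp flip: measure_marginal(2)[OF \<mu>])
    ultimately show ?thesis unfolding good_sets_def st evenR_graph oddR_graph
      using ballR[OF W(2)] ballR[OF W(3)] op W(4) by auto
  qed
  then have "\<forall>N. \<exists>W. good_sets (setsR q N) (u N) W (E N)" ..
  from choice[OF this] E(1,2) show ?thesis by blast
qed

definition inside :: "orc \<Rightarrow> nat \<Rightarrow> nat \<Rightarrow> bool" where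
  "inside P b m \<longleftrightarrow> (\<exists>j k r. ballR P j k r \<and> dballR (ptR b) (ptR k) m r)"

lemma inside_iff: "inside P b m \<longleftrightarrow> t b \<in> shrink t (ballR P) (2 * (1/2) ^ m)"
proof -
  have "dballR (ptR b) (ptR k) m r \<longleftrightarrow> dist (t b) (t k) + 2 * (1/2) ^ m < rt r" for k r
  proof -
    obtain p q where pq: "ptR b = graph p" "\<delta>T p = Some (t b)" "ptR k = graph q" "\<delta>T q = Some (t k)"
      using ptR by metis
    show ?thesis unfolding dballR_def pq(1,3) dist_code_less[OF pq(2,4)] by (simp only: less_diff_eq)
  qed
  then show ?thesis by (simp add: inside_def shrink_def)
qed

lemma sig_inside [cintros]:
  assumes P: "sigR P" and "tot b" "tot m"
  shows "sig (\<lambda>p z. inside (P p z) (b p z) (m p z))"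
  unfolding inside_def by (intro cintros sig_subst3[OF P] assms(2,3)[THEN tot_comp])

text \<open>The last conjunct is the inequality of \<open>restricted_comb_close_slice\<close> with
  \<open>e = 2 * (1/2) ^ m\<close> and \<open>\<tau> = (1/2) ^ Suc n\<close>, cleared of
  denominators. The index \<open>N\<close> is bounded only from below, since a particular
  \<open>u N\<close> may be null and then admits no certificate.\<close>

definition cert :: "baire \<Rightarrow> nat \<Rightarrow> nat \<Rightarrow> nat \<Rightarrow> nat \<Rightarrow> nat \<Rightarrow> bool" where
  "cert q n N m I J \<longleftrightarrow> n \<le> N \<and>
     (\<forall>i<clen (h m). el I i \<noteq> 0 \<longrightarrow> inside (evenR (setsR q N)) (pi2 (cpos (h m) i)) m) \<and>
     (\<forall>i<clen (h m). el J i \<noteq> 0 \<longrightarrow> inside (oddR (setsR q N)) (pi2 (cpos (h m) i)) m) \<and>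
     2 ^ Suc n * (ctot (h m) * 2 ^ m + 2 * ctot (h m)) \<le>
       msum I (h m) * 2 ^ m + 2 ^ Suc n * (msum I (h m) + msum J (h m)) * 2 ^ m"

definition approx :: "baire \<Rightarrow> nat \<Rightarrow> bool" where
  "approx q z \<longleftrightarrow> (\<exists>N m I J. cert q (pi1 z) N m I J \<and> pi2 z = mcomb I (h m))"

lemma sig_approx: "sig approx"
proof -
  have "sig (\<lambda>q z. \<exists>N m I J. cert q (pi1 z) N m I J \<and> pi2 z = mcomb I (h m))"
    unfolding cert_def by (intro cintros)
  then show ?thesis by (rule sig_cong) (simp add: approx_def)
qed

lemma cert_arith:
  "2 ^ Suc n * (W * 2 ^ m + 2 * W) \<le> a * 2 ^ m + 2 ^ Suc n * (a + b) * 2 ^ m \<longleftrightarrow>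
   (real W - real a - real b) + 2 * (1/2) ^ m * real W \<le> (1/2) ^ Suc n * real a" for W a b :: nat
proof -
  have "(real W - real a - real b) + 2 * (1/2) ^ m * real W \<le> (1/2) ^ Suc n * real a \<longleftrightarrow>
    ((real W - real a - real b) + 2 * (1/2) ^ m * real W) * (2 ^ m * 2 ^ Suc n) \<le> ((1/2) ^ Suc n * real a) * (2 ^ m * 2 ^ Suc n)"
    by (rule mult_le_cancel_right_pos[symmetric]) simp
  also have "((1/2) ^ Suc n * real a) * (2 ^ m * 2 ^ Suc n) = real a * 2 ^ m"
    by (simp add: power_one_over)
  also have "((real W - real a - real b) + 2 * (1/2) ^ m * real W) * (2 ^ m * 2 ^ Suc n) =
     2 ^ Suc n * (real W * 2 ^ m + 2 * real W) - 2 ^ Suc n * (real a + real b) * 2 ^ m"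
    by (simp add: power_one_over field_simps)
  also have "2 ^ Suc n * (real W * 2 ^ m + 2 * real W) - 2 ^ Suc n * (real a + real b) * 2 ^ m \<le> real a * 2 ^ m \<longleftrightarrow>
    real (2 ^ Suc n * (W * 2 ^ m + 2 * W)) \<le> real (a * 2 ^ m + 2 ^ Suc n * (a + b) * 2 ^ m)"
    by (simp add: algebra_simps)
  finally show ?thesis by linarith
qed

text \<open>All certificates for \<open>n\<close> use some \<open>N \<ge> n\<close>, hence a late
  member of the regular sequence; so the bound \<open>n0\<close> covers each of them and not just
  the one found first. The sets \<open>E\<close> come from \<open>q\<close>, but \<open>D\<close>
  depends on \<open>x\<close> alone.\<close>

lemma approx_correct:
  assumes q: "fast q x"
  shows "\<exists>D\<in>borel_prob. Dstar \<mu> V x = {D} \<and> (\<forall>n. \<exists>c. approx q (prod_encode (n, c))) \<and>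
    (\<forall>e>0. \<exists>n0. \<forall>n\<ge>n0. \<forall>c. approx q (prod_encode (n, c)) \<longrightarrow> close e D (dirac_comb s c))"
proof -
  obtain u W E where E: "range E \<subseteq> V" "converges_regularly (marginal \<mu>) E x"
    and all: "\<And>N. good_sets (setsR q N) (u N) (W N) (E N)"
    using setsR[OF q] by blast
  have B: "ball_sum t (ballR (evenR (setsR q N))) = u N"
    and C: "ball_sum t (ballR (oddR (setsR q N))) = W N"
    and u: "open (u N)" "u N \<inter> W N = {}"
    and W: "measure \<mu> (UNIV \<times> W N) = 1 - measure \<mu> (UNIV \<times> u N)" for N
    using all[of N] by (simp_all add: good_sets_def)
  have uE: "measure \<mu> (A \<times> u N) = measure \<mu> (A \<times> E N)" if "A \<in> sets borel" for A N
    using all[of N] that by (simp add: good_sets_def)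
  obtain D where D: "D \<in> borel_prob" "Dstar \<mu> V x = {D}"
    and D': "\<And>E. range E \<subseteq> V \<and> converges_regularly (marginal \<mu>) E x \<Longrightarrow>
      \<exists>N. (\<forall>n\<ge>N. measure \<mu> (UNIV \<times> E n) \<noteq> 0) \<and>
        (\<forall>A\<in>sets borel. (\<lambda>n. measure (slice \<mu> (E (n + N))) A) \<longlonglongrightarrow> measure D A)"
    using Dstar_slices[OF \<mu> V total, of x] by blast
  obtain N0 where N0: "\<And>n. n \<ge> N0 \<Longrightarrow> measure \<mu> (UNIV \<times> E n) \<noteq> 0"
    "\<And>A. A \<in> sets borel \<Longrightarrow> (\<lambda>n. measure (slice \<mu> (E (n + N0))) A) \<longlonglongrightarrow> measure D A"
    using D'[of E] E by blast
  have Eb: "E n \<in> sets borel" and ub: "u n \<in> sets borel" for n using E(1) V u(1) by auto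
  have u0: "measure \<mu> (UNIV \<times> u n) = measure \<mu> (UNIV \<times> E n)" for n using uE[of UNIV] by simp
  have ex: "\<exists>c. approx q (prod_encode (n, c))" for n
  proof -
    \<comment> \<open>From \<open>N0\<close> on the masses are nonzero, which is what the existence
      of a certificate requires.\<close>
    define N where "N = max n N0"
    have "measure \<mu> (UNIV \<times> ball_sum t (ballR (evenR (setsR q N)))) \<noteq> 0"
      unfolding B u0 using N0(1)[of N] by (simp add: N_def)
    moreover have "measure \<mu> (UNIV \<times> ball_sum t (ballR (oddR (setsR q N)))) =
      1 - measure \<mu> (UNIV \<times> ball_sum t (ballR (evenR (setsR q N))))" unfolding B C by (rule W)
    moreover have "0 < (1/2 :: real) ^ Suc n" by simp
    ultimately obtain m I J where mIJ:
      "\<forall>i<clen (h m). el I i \<noteq> 0 \<longleftrightarrow> t (pi2 (cpos (h m) i)) \<in> shrink t (ballR (evenR (setsR q N))) (2 * (1/2) ^ m)"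
      "\<forall>i<clen (h m). el J i \<noteq> 0 \<longleftrightarrow> t (pi2 (cpos (h m) i)) \<in> shrink t (ballR (oddR (setsR q N))) (2 * (1/2) ^ m)"
      "(real (ctot (h m)) - real (msum I (h m)) - real (msum J (h m))) + 2 * (1/2) ^ m * real (ctot (h m))
      \<le> (1/2) ^ Suc n * real (msum I (h m))"
      using restricted_comb_exists[OF \<mu> close_h, of "ballR (evenR (setsR q N))" "ballR (oddR (setsR q N))" "(1/2) ^ Suc n"]
      by blast
    then have "cert q n N m I J"
      unfolding cert_def cert_arith inside_iff by (simp add: N_def)
    then have "approx q (prod_encode (n, mcomb I (h m)))" unfolding approx_def by auto
    then show ?thesis ..
  qed
  have "\<exists>n0. \<forall>n\<ge>n0. \<forall>c. approx q (prod_encode (n, c)) \<longrightarrow> close e D (dirac_comb s c)" if e: "0 < e" for e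
  proof -
    have "\<forall>\<^sub>F n in sequentially. close (e / 2) D (slice \<mu> (E (n + N0)))"
      using e N0 by (intro setwise_close D slice_borel_prob \<mu> Eb) auto
    moreover have "(\<lambda>n. 2 * (1/2 :: real) ^ Suc n) \<longlonglongrightarrow> 2 * 0"
      by (intro tendsto_intros LIMSEQ_Suc[OF LIMSEQ_realpow_zero]) auto
    then have "\<forall>\<^sub>F n in sequentially. 2 * (1/2 :: real) ^ Suc n < e / 2"
      by (rule order_tendstoD(2)) (use e in simp)
    ultimately obtain M where M: "\<And>n. n \<ge> M \<Longrightarrow> close (e / 2) D (slice \<mu> (E (n + N0)))"
      "\<And>n. n \<ge> M \<Longrightarrow> 2 * (1/2 :: real) ^ Suc n < e / 2"
      unfolding eventually_sequentially by (metis nle_le order_trans)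
    have "close e D (dirac_comb s c)" if n: "n \<ge> M + N0" and c: "approx q (prod_encode (n, c))" for n c
    proof -
      obtain N m I J where ce: "cert q n N m I J" and c: "c = mcomb I (h m)"
        using c unfolding approx_def by auto
      have N: "N \<ge> n" using ce by (simp add: cert_def)
      have I: "ball (t (pi2 (cpos (h m) i))) (2 * (1/2) ^ m) \<subseteq> u N" if "i < clen (h m)" "el I i \<noteq> 0" for i
        using ce that ball_subset_ball_sum[of "t (pi2 (cpos (h m) i))" t "ballR (evenR (setsR q N))" "2 * (1/2) ^ m"]
        unfolding cert_def inside_iff B by blast
      have J: "ball (t (pi2 (cpos (h m) i))) (2 * (1/2) ^ m) \<subseteq> W N" if "i < clen (h m)" "el J i \<noteq> 0" for i
        using ce that ball_subset_ball_sum[of "t (pi2 (cpos (h m) i))" t "ballR (oddR (setsR q N))" "2 * (1/2) ^ m"]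
        unfolding cert_def inside_iff C by blast
      have ar: "(real (ctot (h m)) - real (msum I (h m)) - real (msum J (h m))) + 2 * (1/2) ^ m * real (ctot (h m))
        \<le> (1/2) ^ Suc n * real (msum I (h m))"
        using ce unfolding cert_def cert_arith by blast
      have \<tau>: "0 < (1/2 :: real) ^ Suc n" "(1/2 :: real) ^ Suc n \<le> 1/2" "0 < 2 * (1/2 :: real) ^ m"
        by (simp_all add: power_le_one)
      note R = restricted_comb_close_slice[OF \<mu> ub u(2) \<tau>(3) close_h I J ar \<tau>(1,2)]
      have nzE: "measure \<mu> (UNIV \<times> E N) \<noteq> 0" using R(2) by (simp add: u0)
      have "close (e / 2) D (slice \<mu> (E N))" using M(1)[of "N - N0"] N n by simp
      moreover have "measure (slice \<mu> (u N)) B = measure (slice \<mu> (E N)) B" if "B \<in> sets borel" for B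
        by (simp add: measure_slice[OF \<mu> ub R(2) that] measure_slice[OF \<mu> Eb nzE that] uE that)
      ultimately have 1: "close (e / 2) D (slice \<mu> (u N))"
        unfolding close_def by simp
      have 2: "close (e / 2) (slice \<mu> (u N)) (dirac_comb s c)"
        unfolding c by (rule close_mono[OF R(1)]) (use M(2)[of n] n dirac_comb_borel_prob in auto)
      from close_trans[OF 1 2 dirac_comb_borel_prob] show ?thesis by simp
    qed
    then show ?thesis by blast
  qed
  with D ex show ?thesis by blast
qed

definition acode :: prog where
  "acode = (SOME e. \<forall>p x y. approx p (prod_encode (x, y)) \<longrightarrow>
    (\<exists>y'. eval p e x y' \<and> approx p (prod_encode (x, y'))))"

lemma acode: "approx q (prod_encode (n, c)) \<Longrightarrow> \<exists>c'. eval q acode n c' \<and> approx q (prod_encode (n, c'))"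
  using someI_ex[OF sig_search[OF sig_approx]] unfolding acode_def[symmetric] by blast

lemma acode_correct:
  assumes "fast q x"
  shows "\<exists>D\<in>borel_prob. Dstar \<mu> V x = {D} \<and> (\<forall>n. \<exists>c. eval q acode n c) \<and>
    (\<forall>e>0. \<exists>n0. \<forall>n\<ge>n0. \<forall>c. eval q acode n c \<longrightarrow> close e D (dirac_comb s c))"
proof -
  obtain D where D: "D \<in> borel_prob" "Dstar \<mu> V x = {D}" "\<And>n. \<exists>c. approx q (prod_encode (n, c))"
    "\<And>e. e > 0 \<Longrightarrow> \<exists>n0. \<forall>n\<ge>n0. \<forall>c. approx q (prod_encode (n, c)) \<longrightarrow> close e D (dirac_comb s c)"
    using approx_correct[OF assms] by blast
  have ap: "approx q (prod_encode (n, c))" if "eval q acode n c" for n c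
    using D(3)[of n] acode[of q n] eval_functional[OF that] by metis
  have "\<exists>c. eval q acode n c" for n using D(3)[of n] acode[of q n] by blast
  moreover have "\<exists>n0. \<forall>n\<ge>n0. \<forall>c. eval q acode n c \<longrightarrow> close e D (dirac_comb s c)" if "0 < e" for e
    using D(4)[OF that] ap by blast
  ultimately show ?thesis using D(1,2) by blast
qed

end


section \<open>Averaging over names\<close>

definition unif :: "real measure" where "unif = uniform_measure lborel {0<..<1}"

lemma unif: "prob_space unif" "sets unif = sets borel" "space unif = UNIV"
  unfolding unif_def by (auto intro!: prob_space_uniform_measure)

lemma measure_unif: "B \<in> sets borel \<Longrightarrow> measure unif B = measure lborel ({0<..<1} \<inter> B)"
  unfolding unif_def by (subst measure_uniform_measure) auto

lemma unif_finite: "finite_measure unif"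
  using unif(1) by (rule prob_space.finite_measure)

lemma measure_unif_Ioo: "measure unif {0<..<1} = 1"
  by (subst measure_unif) auto

text \<open>The exceptional set \<open>Z\<close> is empty when the averages are shown to converge;
  it consists of the thresholds and the dyadic rationals when cells are counted.\<close>

lemma unif_incseq_tendsto_1:
  assumes B: "\<And>n. B n \<in> sets borel" "incseq B" and Z: "countable Z" "{0<..<1} - Z \<subseteq> (\<Union>n. B n)"
  shows "(\<lambda>n. measure unif (B n)) \<longlonglongrightarrow> 1"
proof -
  have "(\<lambda>n. measure unif (B n)) \<longlonglongrightarrow> measure unif (\<Union>n. B n)"
    by (rule finite_measure.finite_Lim_measure_incseq[OF unif_finite]) (use B unif(2) in auto)
  moreover have "measure unif (\<Union>n. B n) = 1"
  proof (rule antisym)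
    have UB: "(\<Union>n. B n) \<in> sets borel" using B by auto
    have Zb: "Z \<in> sets borel" using Z(1) by (rule sets.countable[rotated]) auto
    have "measure lborel ({0<..<1} \<inter> Z) = 0"
    proof -
      have "countable ({0<..<1} \<inter> Z)" using Z(1) by auto
      from emeasure_lborel_countable[OF this] show ?thesis by (simp add: measure_def)
    qed
    then have "measure unif Z = 0" using Zb by (simp add: measure_unif)
    moreover have "measure unif {0<..<1} \<le> measure unif ((\<Union>n. B n) \<union> Z)"
      using Z UB Zb unif(2) by (intro finite_measure.finite_measure_mono[OF unif_finite]) auto
    moreover have "measure unif ((\<Union>n. B n) \<union> Z) \<le> measure unif (\<Union>n. B n) + measure unif Z"
      using UB Zb unif(2) by (intro measure_Un_le) auto
    ultimately show "1 \<le> measure unif (\<Union>n. B n)" by (simp add: measure_unif_Ioo)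
  qed (rule prob_space.prob_le_1[OF unif(1)])
  ultimately show ?thesis by simp
qed

text \<open>The kernel depends on \<theta> only through a natural number, so the measurability of
  \<open>f\<close> is all that is needed to form the integral.\<close>

lemma mixture:
  fixes N :: "nat \<Rightarrow> 'x::topological_space measure"
  assumes f: "f \<in> measurable unif (count_space UNIV)" and N: "\<And>c. N c \<in> borel_prob"
  defines "K \<equiv> unif \<bind> (\<lambda>\<theta>. N (f \<theta>))"
  shows "K \<in> borel_prob"
    and "A \<in> sets borel \<Longrightarrow> integrable unif (\<lambda>\<theta>. measure (N (f \<theta>)) A)"
    and "A \<in> sets borel \<Longrightarrow> measure K A = (\<integral>\<theta>. measure (N (f \<theta>)) A \<partial>unif)"
proof -
  have "N c \<in> space (subprob_algebra borel)" for c
    using borel_probD[OF N] by (auto simp: space_subprob_algebra intro: prob_space_imp_subprob_space)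
  then have "N \<in> measurable (count_space UNIV) (subprob_algebra borel)" by simp
  with f have Nf: "(\<lambda>\<theta>. N (f \<theta>)) \<in> measurable unif (subprob_algebra borel)" by (rule measurable_compose)
  have ne: "space unif \<noteq> {}" by (simp add: unif)
  have sK: "sets K = sets borel" unfolding K_def by (rule sets_bind) (use Nf ne borel_probD[OF N] in auto)
  have "prob_space K" unfolding K_def
    by (rule prob_space.prob_space_bind[OF unif(1) _ Nf]) (use borel_probD[OF N] in auto)
  with sK show K: "K \<in> borel_prob" by (simp add: borel_prob_def)
  assume A: "A \<in> sets borel"
  have "(\<lambda>c. measure (N c) A) \<in> measurable (count_space UNIV) borel" by simp
  with f have m: "(\<lambda>\<theta>. measure (N (f \<theta>)) A) \<in> borel_measurable unif" by (rule measurable_compose)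
  show i: "integrable unif (\<lambda>\<theta>. measure (N (f \<theta>)) A)"
    using measure_borel_prob_le_1[OF N] m
    by (intro finite_measure.integrable_const_bound[OF unif_finite, of _ 1]) auto
  have "emeasure K A = (\<integral>\<^sup>+\<theta>. emeasure (N (f \<theta>)) A \<partial>unif)"
    unfolding K_def by (rule emeasure_bind[OF ne Nf A])
  also have "\<dots> = (\<integral>\<^sup>+\<theta>. ennreal (measure (N (f \<theta>)) A) \<partial>unif)"
    using finite_measure.emeasure_eq_measure[OF borel_probD(4)[OF N]] by simp
  also have "\<dots> = ennreal (\<integral>\<theta>. measure (N (f \<theta>)) A \<partial>unif)"
    by (rule nn_integral_eq_integral[OF i]) simp
  finally show "measure K A = (\<integral>\<theta>. measure (N (f \<theta>)) A \<partial>unif)"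
    by (simp add: measure_def integral_nonneg_AE)
qed

context dstar_setting
begin

text \<open>For \<open>\<theta>\<close> outside \<open>(0, 1)\<close> the values of \<open>rname\<close> and \<open>out\<close> are irrelevant.\<close>

definition rname :: "'b \<Rightarrow> real \<Rightarrow> nat \<Rightarrow> nat" where
  "rname x \<theta> i = (LEAST j. dist (t j) x * 2 ^ (i + 2) < \<theta>)"

lemma rname_eq:
  "dist (t k) x * 2 ^ (i + 2) < \<theta> \<Longrightarrow> (\<And>j. j < k \<Longrightarrow> \<not> dist (t j) x * 2 ^ (i + 2) < \<theta>) \<Longrightarrow> rname x \<theta> i = k"
  unfolding rname_def by (rule Least_equality) (auto simp: not_less[symmetric])

lemma
  assumes "0 < \<theta>"
  shows rname_less: "dist (t (rname x \<theta> i)) x * 2 ^ (i + 2) < \<theta>"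
    and rname_ge: "j < rname x \<theta> i \<Longrightarrow> \<theta> \<le> dist (t j) x * 2 ^ (i + 2)"
proof -
  have "\<exists>j. dist (t j) x * 2 ^ (i + 2) < \<theta>"
    using dense[of "\<theta> / 2 ^ (i + 2)" x] assms by (simp add: pos_less_divide_eq)
  from LeastI_ex[OF this] show "dist (t (rname x \<theta> i)) x * 2 ^ (i + 2) < \<theta>" unfolding rname_def .
  show "j < rname x \<theta> i \<Longrightarrow> \<theta> \<le> dist (t j) x * 2 ^ (i + 2)"
    unfolding rname_def using not_less_Least by (meson not_less)
qed

lemma fast_rname:
  assumes "\<theta> \<in> {0<..<1}" shows "fast (rname x \<theta>) x"
  unfolding fast_def
proof
  fix i
  have "dist (t (rname x \<theta> i)) x * 2 ^ (i + 2) < 1" using rname_less[of \<theta> x i] assms by simp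
  then show "dist (t (rname x \<theta> i)) x < (1/2) ^ (i + 2)"
    by (simp add: power_one_over pos_less_divide_eq)
qed

definition out :: "'b \<Rightarrow> nat \<Rightarrow> real \<Rightarrow> nat" where
  "out x n \<theta> = (if \<exists>c. eval (rname x \<theta>) acode n c then THE c. eval (rname x \<theta>) acode n c else 0)"

lemma out_eq: "eval (rname x \<theta>) acode n c \<Longrightarrow> out x n \<theta> = c"
  unfolding out_def using eval_functional by (auto intro!: the_equality)

lemma eval_out_nonzero:
  assumes "out x n \<theta> \<noteq> 0" shows "eval (rname x \<theta>) acode n (out x n \<theta>)"
proof -
  from assms obtain c where "eval (rname x \<theta>) acode n c" by (auto simp: out_def split: if_splits)
  with out_eq[OF this] show ?thesis by simp
qed

lemma eval_out: "\<theta> \<in> {0<..<1} \<Longrightarrow> eval (rname x \<theta>) acode n (out x n \<theta>)"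
  using acode_correct[OF fast_rname] out_eq by metis

lemma measurable_rname: "{\<theta>. rname x \<theta> i = k} \<in> sets borel"
proof -
  have "rname x \<in> borel \<rightarrow>\<^sub>M (Pi\<^sub>M UNIV (\<lambda>_. count_space UNIV))"
    unfolding rname_def[abs_def]
    by (intro measurable_PiM_single') (auto intro!: measurable_Least)
  then have "(\<lambda>\<theta>. rname x \<theta> i) \<in> borel \<rightarrow>\<^sub>M count_space UNIV"
    unfolding rname_def by measurable
  from measurable_sets[OF this, of "{k}"] show ?thesis by (simp add: vimage_def)
qed

text \<open>By finite use the event is a countable union, over the oracle prefixes of length
  \<open>l\<close> coded by \<open>w\<close> that produce the output, of finite intersections fixing
  single entries of the name.\<close>

lemma eval_rname_borel: "{\<theta>. eval (rname x \<theta>) acode n c} \<in> sets borel"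
proof -
  have "{\<theta>. eval (rname x \<theta>) acode n c} =
    (\<Union>(w, l)\<in>{(w, l). run (restr l (el w)) (prog_code acode) n c}. \<Inter>i\<in>{..<l}. {\<theta>. rname x \<theta> i = el w i})"
    (is "?L = ?R")
  proof (intro equalityI subsetI)
    fix \<theta> assume "\<theta> \<in> ?L"
    then have "run (graph (rname x \<theta>)) (prog_code acode) n c" by (simp add: run_graph_iff)
    then obtain l where l: "run (restr l (rname x \<theta>)) (prog_code acode) n c" using run_finite_use by blast
    obtain w where w: "\<forall>i<l. el w i = rname x \<theta> i" using ex_el[of l "rname x \<theta>"] by blast
    then have "restr l (el w) = restr l (rname x \<theta>)" by (auto simp: restr_def fun_eq_iff)
    with l w show "\<theta> \<in> ?R" by (intro UN_I[of "(w, l)"]) auto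
  next
    fix \<theta> assume "\<theta> \<in> ?R"
    then obtain w l where r: "run (restr l (el w)) (prog_code acode) n c" and w: "\<forall>i<l. rname x \<theta> i = el w i" by auto
    have "restr l (el w) \<le> graph (rname x \<theta>)" using w by (auto simp: restr_def graph_def le_fun_def)
    from run_mono[OF r this] show "\<theta> \<in> ?L" by (simp add: run_graph_iff)
  qed
  moreover have "(\<Inter>i\<in>{..<l}. {\<theta>. rname x \<theta> i = el w i}) \<in> sets borel" for w l
    by (cases "l = 0") (auto intro!: sets.finite_INT measurable_rname)
  ultimately show ?thesis by (auto intro!: sets.countable_UN'')
qed

lemma measurable_out: "out x n \<in> measurable unif (count_space UNIV)"
proof -
  have "{\<theta>. out x n \<theta> = c} \<in> sets borel" for c
  proof (cases "c = 0")
    case False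
    then have "{\<theta>. out x n \<theta> = c} = {\<theta>. eval (rname x \<theta>) acode n c}"
      using eval_out_nonzero[of x n] by (auto simp: out_eq)
    then show ?thesis by (simp add: eval_rname_borel)
  next
    \<comment> \<open>The value 0 is also the default where there is no output, so its preimage is
      obtained as a complement.\<close>
    case True
    have "{\<theta>. out x n \<theta> = c} = - (\<Union>c'\<in>-{0}. {\<theta>. eval (rname x \<theta>) acode n c'})"
      using out_eq eval_out_nonzero[of x n] by (force simp: True)
    moreover have "(\<Union>c'\<in>-{0}. {\<theta>. eval (rname x \<theta>) acode n c'}) \<in> sets borel"
      by (intro sets.countable_UN') (auto intro: eval_rname_borel)
    ultimately show ?thesis by (simp only: borel_comp)
  qed
  then show ?thesis unfolding measurable_count_space_eq_countable[OF countableI_type]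
    by (auto simp: unif vimage_def)
qed

definition K :: "'b \<Rightarrow> nat \<Rightarrow> 'a measure" where
  "K x n = unif \<bind> (\<lambda>\<theta>. dirac_comb s (out x n \<theta>))"

lemma K_props:
  shows "K x n \<in> borel_prob"
    and "A \<in> sets borel \<Longrightarrow> integrable unif (\<lambda>\<theta>. measure (dirac_comb s (out x n \<theta>)) A)"
    and "A \<in> sets borel \<Longrightarrow> measure (K x n) A = (\<integral>\<theta>. measure (dirac_comb s (out x n \<theta>)) A \<partial>unif)"
  unfolding K_def by (intro mixture[OF measurable_out dirac_comb_borel_prob]; assumption)+

text \<open>For each \<theta> the outputs stay \<open>e\<close>-close to \<open>D\<close> from some
  stage on. The \<theta> for which this stage is not yet reached have measure below \<open>e\<close>
  and cost at most that much in the average, hence the bound \<open>2 * e\<close>.\<close>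

lemma K_converges:
  "\<exists>D\<in>borel_prob. Dstar \<mu> V x = {D} \<and> (\<forall>e>0. \<forall>\<^sub>F n in sequentially. close (2 * e) D (K x n))"
proof -
  have "\<exists>D\<in>borel_prob. Dstar \<mu> V x = {D}"
    \<comment> \<open>Any \<theta> in the interval would do, since the value of \<open>Dstar\<close>
      does not depend on names.\<close>
    using acode_correct[OF fast_rname[of "1/2" x]] by auto
  then obtain D where D: "D \<in> borel_prob" "Dstar \<mu> V x = {D}" by blast
  have cl: "\<exists>n0. \<forall>n\<ge>n0. close e D (dirac_comb s (out x n \<theta>))" if th: "\<theta> \<in> {0<..<1}" and e: "0 < e" for \<theta> e
  proof -
    obtain D' where "Dstar \<mu> V x = {D'}"
      "\<forall>e>0. \<exists>n0. \<forall>n\<ge>n0. \<forall>c. eval (rname x \<theta>) acode n c \<longrightarrow> close e D' (dirac_comb s c)"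
      using acode_correct[OF fast_rname[OF th, of x]] by blast
    with D(2) e eval_out[OF th] show ?thesis by (metis singleton_inject)
  qed
  have "\<forall>\<^sub>F n in sequentially. close (2 * e) D (K x n)" if e: "0 < e" for e
  proof -
    define G where "G n = (\<Inter>m\<in>{n..}. {\<theta>. close e D (dirac_comb s (out x m \<theta>))})" for n
    have bo: "{\<theta>. close e D (dirac_comb s (out x m \<theta>))} \<in> sets borel" for m
      using measurable_sets[OF measurable_out[of x m], of "{c. close e D (dirac_comb s c)}"]
      by (simp add: unif vimage_def)
    have G: "G n \<in> sets borel" for n unfolding G_def by (intro sets.countable_INT') (auto intro: bo)
    have "incseq G" unfolding G_def by (intro incseq_SucI) auto
    moreover have "{0<..<1} - {} \<subseteq> (\<Union>n. G n)"
    proof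
      fix \<theta> :: real assume "\<theta> \<in> {0<..<1} - {}"
      then obtain n0 where "\<forall>n\<ge>n0. close e D (dirac_comb s (out x n \<theta>))" using cl[OF _ e] by blast
      then have "\<theta> \<in> G n0" by (simp add: G_def)
      then show "\<theta> \<in> (\<Union>n. G n)" by blast
    qed
    ultimately have "(\<lambda>n. measure unif (G n)) \<longlonglongrightarrow> 1" using G by (intro unif_incseq_tendsto_1[of G "{}"]) auto
    then have "\<forall>\<^sub>F n in sequentially. 1 - e < measure unif (G n)" by (rule order_tendstoD) (use e in simp)
    then show ?thesis
    proof eventually_elim
      case (elim n)
      show ?case unfolding close_def
      proof
        fix A :: "'a set" assume A: "A \<in> sets borel"
        have "measure D A = (\<integral>\<theta>. measure D A \<partial>unif)"
          using prob_space.prob_space[OF unif(1)] by simp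
        also have "\<dots> \<le> (\<integral>\<theta>. measure (dirac_comb s (out x n \<theta>)) (thick A e) + (e + indicator (- G n) \<theta>) \<partial>unif)"
        proof (rule integral_mono)
          show "integrable unif (\<lambda>\<theta>. measure D A)" by (simp add: finite_measure.integrable_const[OF unif_finite])
          show "integrable unif (\<lambda>\<theta>. measure (dirac_comb s (out x n \<theta>)) (thick A e) + (e + indicator (- G n) \<theta>))"
            using G[of n] finite_measure.emeasure_finite[OF unif_finite]
            by (intro Bochner_Integration.integrable_add K_props(2) finite_measure.integrable_const[OF unif_finite])
               (auto simp: unif less_top)
          fix \<theta>
          show "measure D A \<le> measure (dirac_comb s (out x n \<theta>)) (thick A e) + (e + indicator (- G n) \<theta>)"
          proof (cases "\<theta> \<in> G n")
            case True
            then have "close e D (dirac_comb s (out x n \<theta>))" by (simp add: G_def)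
            with A True show ?thesis by (simp add: close_def)
          next
            case False
            then show ?thesis using measure_borel_prob_le_1[OF D(1), of A] e
              by (simp add: add_increasing)
          qed
        qed
        also have "\<dots> = measure (K x n) (thick A e) + (e + measure unif (- G n))"
        proof -
          have i: "integrable unif (indicator (- G n) :: real \<Rightarrow> real)" "integrable unif (\<lambda>_. e)"
            using G[of n] finite_measure.emeasure_finite[OF unif_finite]
            by (auto simp: unif less_top finite_measure.integrable_const[OF unif_finite])
          have "(\<integral>\<theta>. e + indicator (- G n) \<theta> \<partial>unif) = e + measure unif (- G n)"
            using prob_space.prob_space[OF unif(1)]
            by (subst Bochner_Integration.integral_add[OF i(2,1)]) (auto simp: unif)
          then show ?thesis
            by (subst Bochner_Integration.integral_add[OF K_props(2) Bochner_Integration.integrable_add[OF i(2,1)]])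
               (simp_all add: K_props(3))
        qed
        also have "measure unif (- G n) = 1 - measure unif (G n)"
          using prob_space.prob_compl[OF unif(1), of "G n"] G[of n] by (simp add: unif Compl_eq_Diff_UNIV)
        also have "measure (K x n) (thick A e) \<le> measure (K x n) (thick A (2 * e))"
          using e by (intro measure_borel_prob_mono K_props thick_mono) auto
        finally show "measure D A \<le> measure (K x n) (thick A (2 * e)) + 2 * e" using elim by simp
      qed
    qed
  qed
  with D show ?thesis by blast
qed

end


section \<open>Computing the averages\<close>

context dstar_setting
begin

text \<open>
  A cell \<open>(k / M, (k + 1) / M)\<close> is certified when all its points yield names with the
  same initial segment, and this segment determines the output.
\<close>

definition cell :: "baire \<Rightarrow> nat \<Rightarrow> nat \<Rightarrow> nat \<Rightarrow> nat \<Rightarrow> nat \<Rightarrow> nat \<Rightarrow> bool" where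
  "cell p L k w l n c \<longleftrightarrow> run (restr l (el w)) (prog_code acode) n c \<and>
     (\<forall>i<l. dltR (ptR (el w i)) (graph p) k (L + i + 2)) \<and>
     (\<forall>i<l. \<forall>j<el w i. dgtR (ptR j) (graph p) (Suc k) (L + i + 2))"

text \<open>This counterpart of \<open>cell\<close> mentions the point instead of a name, so all
  names of \<open>x\<close> certify the same cells. Already the left endpoint must accept the entry
  \<open>el w i\<close>, and even the right endpoint must reject all smaller indices; then every
  \<theta> in between selects the same entry.\<close>

definition cell_pt :: "'b \<Rightarrow> nat \<Rightarrow> nat \<Rightarrow> nat \<Rightarrow> nat \<Rightarrow> nat \<Rightarrow> nat \<Rightarrow> bool" where
  "cell_pt x M k w l n c \<longleftrightarrow> run (restr l (el w)) (prog_code acode) n c \<and>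
     (\<forall>i<l. dist (t (el w i)) x * 2 ^ (i + 2) * real M < real k) \<and>
     (\<forall>i<l. \<forall>j<el w i. dist (t j) x * 2 ^ (i + 2) * real M > real (Suc k))"

lemma cell_iff:
  assumes "\<delta>T p = Some x" shows "cell p L k w l n c \<longleftrightarrow> cell_pt x (2 ^ L) k w l n c"
proof -
  have pow: "(v :: real) * 2 ^ (i + 2) * real (2 ^ L) = v * 2 ^ (L + i + 2)" for v i by (simp add: power_add)
  have "dltR (ptR j) (graph p) k (L + i + 2) \<longleftrightarrow> dist (t j) x * 2 ^ (i + 2) * real (2 ^ L) < real k"
    "dgtR (ptR j) (graph p) (Suc k) (L + i + 2) \<longleftrightarrow> dist (t j) x * 2 ^ (i + 2) * real (2 ^ L) > real (Suc k)" for i j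
  proof -
    obtain q where q: "ptR j = graph q" "\<delta>T q = Some (t j)" using ptR by blast
    show "dltR (ptR j) (graph p) k (L + i + 2) \<longleftrightarrow> dist (t j) x * 2 ^ (i + 2) * real (2 ^ L) < real k"
      unfolding q(1) dltR_def dist_code_less[OF q(2) assms] pow by (simp only: pos_less_divide_eq zero_less_power zero_less_numeral)
    show "dgtR (ptR j) (graph p) (Suc k) (L + i + 2) \<longleftrightarrow> dist (t j) x * 2 ^ (i + 2) * real (2 ^ L) > real (Suc k)"
      unfolding q(1) dgtR_def dist_code_greater[OF q(2) assms] pow by (simp only: pos_divide_less_eq zero_less_power zero_less_numeral)
  qed
  then show ?thesis by (simp only: cell_def cell_pt_def)
qed

lemma sig_cell [cintros]:
  assumes "tot M" "tot k" "tot w" "tot l" "tot n" "tot c" and q: "tot (\<lambda>p z. q p (pi1 z) (pi2 z))"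
  shows "sig (\<lambda>p z. cell (q p z) (M p z) (k p z) (w p z) (l p z) (n p z) (c p z))"
proof -
  have q': "tot (\<lambda>p z. q p (f p z) (g p z))" if "tot f" "tot g" for f g
    using tot_comp[OF q, of "\<lambda>p z. prod_encode (f p z, g p z)"] that by (simp add: cintros)
  show ?thesis unfolding cell_def restr_def
    by (intro cintros assms(1-6) assms(1-6)[THEN tot_comp] q')
qed

lemma cell_out:
  assumes c: "cell_pt x M k w l n c" and M: "0 < M" and \<theta>: "real k / real M < \<theta>" "\<theta> < real (Suc k) / real M"
  shows "out x n \<theta> = c"
proof -
  have \<theta>': "real k < \<theta> * real M" "\<theta> * real M < real (Suc k)" using \<theta> M by (simp_all add: field_simps)
  have M': "0 < real M" using M by simp
  have "rname x \<theta> i = el w i" if "i < l" for i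
  proof (rule rname_eq)
    have "dist (t (el w i)) x * 2 ^ (i + 2) * real M < \<theta> * real M"
      using c that \<theta>'(1) unfolding cell_pt_def by (meson less_trans)
    then show "dist (t (el w i)) x * 2 ^ (i + 2) < \<theta>" using M' by (simp only: mult_less_cancel_right_pos)
    fix j assume "j < el w i"
    then have "\<theta> * real M < dist (t j) x * 2 ^ (i + 2) * real M"
      using c that \<theta>'(2) unfolding cell_pt_def by (meson less_trans)
    then show "\<not> dist (t j) x * 2 ^ (i + 2) < \<theta>" using M' by (simp only: mult_less_cancel_right_pos not_less less_imp_le)
  qed
  then have "restr l (el w) \<le> graph (rname x \<theta>)" by (auto simp: restr_def graph_def le_fun_def)
  with c have "run (graph (rname x \<theta>)) (prog_code acode) n c" unfolding cell_pt_def using run_mono by blast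
  then show ?thesis by (intro out_eq) (simp add: run_graph_iff)
qed

text \<open>The computation at \<theta> involves finitely many comparisons. The accepting ones are
  strict by themselves, and the rejecting ones become strict because \<theta> is not a threshold. A
  cell narrower than all the gaps is certified.\<close>

lemma eventually_cell:
  assumes \<theta>: "0 < \<theta>" "\<theta> < 1" and Z: "\<And>i j. dist (t j) x * 2 ^ (i + 2) \<noteq> \<theta>" and dy: "\<And>L k. real k / 2 ^ L \<noteq> \<theta>"
  shows "\<forall>\<^sub>F L in sequentially. \<exists>k w l c. k < 2 ^ L \<and> cell_pt x (2 ^ L) k w l n c \<and>
    real k / 2 ^ L < \<theta> \<and> \<theta> < real (Suc k) / 2 ^ L"
proof -
  have "run (graph (rname x \<theta>)) (prog_code acode) n (out x n \<theta>)"
    using eval_out[of \<theta> x n] \<theta> by (simp add: run_graph_iff)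
  then obtain l where l: "run (restr l (rname x \<theta>)) (prog_code acode) n (out x n \<theta>)" using run_finite_use by blast
  obtain w where w: "\<forall>i<l. el w i = rname x \<theta> i" using ex_el[of l "rname x \<theta>"] by blast
  then have rw: "restr l (el w) = restr l (rname x \<theta>)" by (auto simp: restr_def fun_eq_iff)
  have big: "\<forall>\<^sub>F L in sequentially. 1 < a * 2 ^ L" if "0 < a" for a :: real
  proof -
    have "\<forall>\<^sub>F L in sequentially. (1/2 :: real) ^ L < a"
      using that by (intro order_tendstoD(2)[OF LIMSEQ_realpow_zero]) auto
    then show ?thesis by eventually_elim (simp add: power_one_over pos_divide_less_eq)
  qed
  have 1: "\<forall>\<^sub>F L in sequentially. \<forall>i\<in>{..<l}. 1 < (\<theta> - dist (t (el w i)) x * 2 ^ (i + 2)) * 2 ^ L"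
    using rname_less[OF \<theta>(1)] w by (intro eventually_ball_finite ballI big) auto
  have 2: "\<forall>\<^sub>F L in sequentially. \<forall>i\<in>{..<l}. \<forall>j\<in>{..<el w i}. 1 < (dist (t j) x * 2 ^ (i + 2) - \<theta>) * 2 ^ L"
  proof (intro eventually_ball_finite ballI big)
    fix i j assume "i \<in> {..<l}" "j \<in> {..<el w i}"
    then have "\<theta> \<le> dist (t j) x * 2 ^ (i + 2)" using rname_ge[OF \<theta>(1)] w by auto
    with Z[of j i] show "0 < dist (t j) x * 2 ^ (i + 2) - \<theta>" by linarith
  qed auto
  from 1 2 show ?thesis
  proof eventually_elim
    case (elim L)
    \<comment> \<open>The index of the cell containing \<theta>; it lies in the open cell because it
      is not dyadic.\<close>
    define k where "k = nat \<lfloor>\<theta> * 2 ^ L\<rfloor>"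
    have k: "real k \<le> \<theta> * 2 ^ L" "\<theta> * 2 ^ L < real k + 1" using \<theta>(1) by (simp_all add: k_def)
    have "real k \<noteq> \<theta> * 2 ^ L"
    proof
      assume "real k = \<theta> * 2 ^ L"
      then have "real k / 2 ^ L = \<theta>" by simp
      with dy[of k L] show False ..
    qed
    with k(1) have k': "real k < \<theta> * 2 ^ L" by linarith
    have "\<theta> * 2 ^ L < 2 ^ L" using \<theta>(2) by simp
    with k' have "real k < 2 ^ L" by linarith
    then have kL: "k < 2 ^ L" by (metis of_nat_less_iff of_nat_numeral of_nat_power)
    have "cell_pt x (2 ^ L) k w l n (out x n \<theta>)"
      unfolding cell_pt_def rw
    proof (intro conjI allI impI l)
      fix i assume "i < l"
      then have "1 < (\<theta> - dist (t (el w i)) x * 2 ^ (i + 2)) * 2 ^ L" using elim(1) by simp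
      then have "dist (t (el w i)) x * 2 ^ (i + 2) * 2 ^ L < \<theta> * 2 ^ L - 1" by (simp only: left_diff_distrib)
      with k(2) show "dist (t (el w i)) x * 2 ^ (i + 2) * real (2 ^ L) < real k" by simp
      fix j assume "j < el w i"
      then have "1 < (dist (t j) x * 2 ^ (i + 2) - \<theta>) * 2 ^ L" using elim(2) \<open>i < l\<close> by simp
      then have "\<theta> * 2 ^ L + 1 < dist (t j) x * 2 ^ (i + 2) * 2 ^ L" by (simp only: left_diff_distrib)
      with k(1) show "real (Suc k) < dist (t j) x * 2 ^ (i + 2) * real (2 ^ L)" by simp
    qed
    then show ?case using kL k' k(2)
      by (intro exI[of _ k] exI[of _ w] exI[of _ l] exI[of _ "out x n \<theta>"]) (simp add: field_simps)
  qed
qed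

lemma many_cells:
  assumes "0 < e"
  shows "\<exists>L. 1 - e < real (card {k. k < 2 ^ L \<and> (\<exists>w l c. cell_pt x (2 ^ L) k w l n c)}) / 2 ^ L"
proof -
  define I where "I L = {k. k < 2 ^ L \<and> (\<exists>w l c. cell_pt x (2 ^ L) k w l n c)}" for L :: nat
  define G where "G L = (\<Union>k\<in>I L. {real k / 2 ^ L<..<real (Suc k) / 2 ^ L})" for L :: nat
  have finI: "finite (I L)" for L by (simp add: I_def)
  have Gb: "G L \<in> sets borel" for L unfolding G_def by (intro borel_open open_UN) auto
  have meas: "measure unif (G L) \<le> real (card (I L)) / 2 ^ L" for L
  proof -
    have "measure unif (G L) \<le> (\<Sum>k\<in>I L. measure unif {real k / 2 ^ L<..<real (Suc k) / 2 ^ L})"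
      unfolding G_def using finI unif(2) by (intro measure_UNION_le) auto
    also have "\<dots> \<le> (\<Sum>k\<in>I L. 1 / 2 ^ L)"
    proof (rule sum_mono)
      fix k
      have le: "real k / 2 ^ L \<le> real (Suc k) / 2 ^ L" by (intro divide_right_mono) auto
      have "measure unif {real k / 2 ^ L<..<real (Suc k) / 2 ^ L} = measure lborel ({0<..<1} \<inter> {real k / 2 ^ L<..<real (Suc k) / 2 ^ L})"
        by (rule measure_unif) simp
      also have "\<dots> \<le> measure lborel {real k / 2 ^ L<..<real (Suc k) / 2 ^ L}"
        using emeasure_lborel_Ioo[OF le] by (intro measure_mono_fmeasurable) (auto simp: fmeasurable_def)
      also have "\<dots> = 1 / 2 ^ L" by (simp add: divide_right_mono diff_divide_distrib[symmetric])
      finally show "measure unif {real k / 2 ^ L<..<real (Suc k) / 2 ^ L} \<le> 1 / 2 ^ L" .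
    qed
    also have "\<dots> = real (card (I L)) / 2 ^ L" by simp
    finally show ?thesis .
  qed
  \<comment> \<open>Demanding certification on all later levels makes the family increasing, as
    continuity from below requires.\<close>
  define H where "H N = (\<Inter>L\<in>{N..}. G L)" for N
  define Z where "Z = (\<lambda>(i, j). dist (t j) x * 2 ^ (i + 2)) ` UNIV \<union> (\<lambda>(k, L). real k / 2 ^ L) ` UNIV"
  have "(\<lambda>N. measure unif (H N)) \<longlonglongrightarrow> 1"
  proof (rule unif_incseq_tendsto_1)
    show "H N \<in> sets borel" for N unfolding H_def by (intro sets.countable_INT') (auto intro: Gb)
    show "incseq H" unfolding H_def by (intro incseq_SucI) auto
    show "countable Z" unfolding Z_def by (intro countable_Un countable_image) auto
    show "{0<..<1} - Z \<subseteq> (\<Union>N. H N)"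
    proof
      fix \<theta> assume \<theta>: "\<theta> \<in> {0<..<1} - Z"
      have "\<forall>\<^sub>F L in sequentially. \<theta> \<in> G L"
      proof (rule eventually_mono[OF eventually_cell[of \<theta> x n]])
        show "dist (t j) x * 2 ^ (i + 2) \<noteq> \<theta>" for i j using \<theta> unfolding Z_def by force
        show "real k / 2 ^ L \<noteq> \<theta>" for k L using \<theta> unfolding Z_def by force
        fix L
        assume "\<exists>k w l c. k < 2 ^ L \<and> cell_pt x (2 ^ L) k w l n c \<and> real k / 2 ^ L < \<theta> \<and> \<theta> < real (Suc k) / 2 ^ L"
        then obtain k w l c where "k < 2 ^ L" "cell_pt x (2 ^ L) k w l n c" and th: "real k / 2 ^ L < \<theta>" "\<theta> < real (Suc k) / 2 ^ L"
          by blast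
        then have "k \<in> I L" by (auto simp: I_def)
        with th show "\<theta> \<in> G L" unfolding G_def by (intro UN_I[of k]) auto
      qed (use \<theta> in auto)
      then obtain N where "\<And>L. L \<ge> N \<Longrightarrow> \<theta> \<in> G L" by (auto simp: eventually_sequentially)
      then have "\<theta> \<in> H N" by (simp add: H_def)
      then show "\<theta> \<in> (\<Union>N. H N)" by blast
    qed
  qed
  then have "\<forall>\<^sub>F N in sequentially. 1 - e < measure unif (H N)" by (rule order_tendstoD) (use assms in simp)
  then obtain N where N: "1 - e < measure unif (H N)"
    using eventually_happens'[OF sequentially_bot] by blast
  also have "measure unif (H N) \<le> measure unif (G N)"
    using Gb unif(2) by (intro finite_measure.finite_measure_mono[OF unif_finite]) (auto simp: H_def)
  also have "\<dots> \<le> real (card (I N)) / 2 ^ N" by (rule meas)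
  finally show ?thesis unfolding I_def by blast
qed

text \<open>On a certified cell the integrand is the mass under the combination \<open>c k\<close>;
  elsewhere it is nonnegative and is dropped.\<close>

lemma cells_le_K:
  assumes M: "0 < M" and J: "J \<subseteq> {..<M}" "\<And>k. k \<in> J \<Longrightarrow> \<exists>w l. cell_pt x M k w l n (c k)" and A: "A \<in> sets borel"
  shows "(\<Sum>k\<in>J. measure (dirac_comb s (c k)) A) / real M \<le> measure (K x n) A"
proof -
  define I where "I k = {real k / real M<..<real (Suc k) / real M}" for k
  have finJ: "finite J" using J(1) finite_subset by blast
  have M': "0 < real M" using M by simp
  have mI: "measure unif (I k) = 1 / real M" if "k \<in> J" for k
  proof -
    have "k < M" using that J(1) by auto
    then have "real (Suc k) / real M \<le> 1" using M' by (simp add: field_simps)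
    moreover have "0 \<le> real k / real M" using M' by simp
    ultimately have "I k \<subseteq> {0<..<1}" unfolding I_def greaterThanLessThan_subseteq_greaterThanLessThan by blast
    then have "{0<..<1} \<inter> I k = I k" by (rule Int_absorb1)
    then have "measure unif (I k) = measure lborel (I k)" by (simp add: measure_unif I_def)
    also have "\<dots> = 1 / real M" using M' by (simp add: I_def divide_right_mono diff_divide_distrib[symmetric])
    finally show ?thesis .
  qed
  have int: "integrable unif (\<lambda>\<theta>. measure (dirac_comb s (c k)) A * indicator (I k) \<theta>)" for k
    using finite_measure.emeasure_finite[OF unif_finite, of "I k"]
    by (intro integrable_mult_right) (auto simp: unif less_top I_def)
  have "(\<Sum>k\<in>J. measure (dirac_comb s (c k)) A) / real M = (\<Sum>k\<in>J. measure (dirac_comb s (c k)) A * measure unif (I k))"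
    by (simp add: mI sum_divide_distrib)
  also have "\<dots> = (\<integral>\<theta>. (\<Sum>k\<in>J. measure (dirac_comb s (c k)) A * indicator (I k) \<theta>) \<partial>unif)"
    by (subst Bochner_Integration.integral_sum[OF int]) (simp add: unif)
  also have "\<dots> \<le> (\<integral>\<theta>. measure (dirac_comb s (out x n \<theta>)) A \<partial>unif)"
  proof (rule integral_mono)
    show "integrable unif (\<lambda>\<theta>. \<Sum>k\<in>J. measure (dirac_comb s (c k)) A * indicator (I k) \<theta>)"
      by (intro Bochner_Integration.integrable_sum int)
    show "integrable unif (\<lambda>\<theta>. measure (dirac_comb s (out x n \<theta>)) A)" by (rule K_props(2)[OF A])
    fix \<theta>
    show "(\<Sum>k\<in>J. measure (dirac_comb s (c k)) A * indicator (I k) \<theta>) \<le> measure (dirac_comb s (out x n \<theta>)) A"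
    proof (cases "\<exists>k\<in>J. \<theta> \<in> I k")
      case True
      then obtain k where k: "k \<in> J" "\<theta> \<in> I k" by blast
      have uniq: "k' = k" if "\<theta> \<in> I k'" for k'
      proof -
        have "real k < \<theta> * real M" "\<theta> * real M < real (Suc k)" "real k' < \<theta> * real M" "\<theta> * real M < real (Suc k')"
          using k(2) that M' by (simp_all add: I_def field_simps)
        then have "real k < real (Suc k')" "real k' < real (Suc k)" by linarith+
        then show ?thesis by linarith
      qed
      obtain w l where "cell_pt x M k w l n (c k)" using J(2)[OF k(1)] by blast
      from cell_out[OF this M] k(2) have o: "out x n \<theta> = c k" by (auto simp: I_def)
      have "(\<Sum>k'\<in>J. measure (dirac_comb s (c k')) A * indicator (I k') \<theta>) =
        measure (dirac_comb s (c k)) A * indicator (I k) \<theta> + (\<Sum>k'\<in>J - {k}. measure (dirac_comb s (c k')) A * indicator (I k') \<theta>)"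
        by (rule sum.remove[OF finJ k(1)])
      also have "(\<Sum>k'\<in>J - {k}. measure (dirac_comb s (c k')) A * indicator (I k') \<theta>) = 0"
      proof (rule sum.neutral, rule ballI)
        fix k' assume "k' \<in> J - {k}"
        then have "\<theta> \<notin> I k'" using uniq by blast
        then show "measure (dirac_comb s (c k')) A * indicator (I k') \<theta> = 0" by simp
      qed
      also have "measure (dirac_comb s (c k)) A * indicator (I k) \<theta> + 0 = measure (dirac_comb s (c k)) A"
        using k(2) by simp
      finally show ?thesis by (simp add: o)
    next
      case False
      then have "(\<Sum>k\<in>J. measure (dirac_comb s (c k)) A * indicator (I k) \<theta>) = 0"
        by (intro sum.neutral) auto
      then show ?thesis by simp
    qed
  qed
  also have "\<dots> = measure (K x n) A" by (rule K_props(3)[OF A, symmetric])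
  finally show ?thesis .
qed

text \<open>
  In the flattened combination the atom \<open>i\<close> of \<open>el C k\<close> has index \<open>prod_encode (k, i)\<close>. The
  factors \<open>el Y k\<close> give all certified cells \<open>k\<close> the same total weight \<open>Z\<close>.
\<close>

definition outw :: "nat \<Rightarrow> nat \<Rightarrow> nat \<Rightarrow> nat \<Rightarrow> nat" where
  "outw C Y M r = (if pi1 r < M \<and> pi2 r < clen (el C (pi1 r)) then el Y (pi1 r) * cw (el C (pi1 r)) (pi2 r) else 0)"

definition outc :: "nat \<Rightarrow> nat \<Rightarrow> nat \<Rightarrow> nat \<Rightarrow> nat" where
  "outc C Y M R = combcode R (\<lambda>r. cpos (el C (pi1 r)) (pi2 r)) (\<lambda>r. outw C Y M r)"

text \<open>Nonzero entries of \<open>Y\<close> mark the cells in use. The third conjunct says that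
  the cells left out make up at most a fraction \<open>(1/2) ^ m\<close>; for \<open>m = 0\<close>
  it is void, hence the separate demand that some cell be used. The bound \<open>R\<close> makes the
  flattened combination finite.\<close>

definition outR :: "baire \<Rightarrow> nat \<Rightarrow> nat \<Rightarrow> nat \<Rightarrow> bool" where
  "outR p n m c \<longleftrightarrow> (\<exists>L R w l C Y Z.
     (\<forall>k<2 ^ L. el Y k \<noteq> 0 \<longrightarrow> cell p L k (el w k) (el l k) n (el C k) \<and> el Y k * ctot (el C k) = Z) \<and>
     (\<forall>k<2 ^ L. \<forall>i<clen (el C k). prod_encode (k, i) < R) \<and>
     2 ^ L * 2 ^ m \<le> (\<Sum>k<2 ^ L. if el Y k \<noteq> 0 then 1 else 0) * 2 ^ m + (2 ^ L :: nat) \<and>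
     0 < (\<Sum>k<2 ^ L. if el Y k \<noteq> 0 then 1 else (0::nat)) \<and>
     c = outc C Y (2 ^ L) R)"

lemma sum_outw:
  fixes f :: "nat \<Rightarrow> real"
  assumes R: "\<And>k i. k < M \<Longrightarrow> i < clen (el C k) \<Longrightarrow> prod_encode (k, i) < R"
  shows "(\<Sum>r<R. real (outw C Y M r) * f (cpos (el C (pi1 r)) (pi2 r))) =
    (\<Sum>k<M. \<Sum>i<clen (el C k). real (el Y k * cw (el C k) i) * f (cpos (el C k) i))"
proof -
  let ?S = "SIGMA k:{..<M}. {..<clen (el C k)}"
  have S: "prod_encode ` ?S = {r. r < R \<and> pi1 r < M \<and> pi2 r < clen (el C (pi1 r))}"
  proof (intro equalityI subsetI)
    fix r assume "r \<in> {r. r < R \<and> pi1 r < M \<and> pi2 r < clen (el C (pi1 r))}"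
    then show "r \<in> prod_encode ` ?S" by (intro image_eqI[of _ _ "(pi1 r, pi2 r)"]) auto
  qed (use R in auto)
  have "(\<Sum>r<R. real (outw C Y M r) * f (cpos (el C (pi1 r)) (pi2 r))) =
    (\<Sum>r\<in>prod_encode ` ?S. real (outw C Y M r) * f (cpos (el C (pi1 r)) (pi2 r)))"
    unfolding S by (intro sum.mono_neutral_right) (auto simp: outw_def)
  also have "\<dots> = (\<Sum>z\<in>?S. real (outw C Y M (prod_encode z)) * f (cpos (el C (pi1 (prod_encode z))) (pi2 (prod_encode z))))"
    by (subst sum.reindex) (auto intro: inj_prod_encode)
  also have "\<dots> = (\<Sum>(k, i)\<in>?S. real (el Y k * cw (el C k) i) * f (cpos (el C k) i))"
    by (intro sum.cong) (auto simp: outw_def)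
  also have "\<dots> = (\<Sum>k<M. \<Sum>i<clen (el C k). real (el Y k * cw (el C k) i) * f (cpos (el C k) i))"
    by (subst sum.Sigma) auto
  finally show ?thesis .
qed

text \<open>Every cell in use contributes \<open>Z\<close> times its probability measure, so
  normalising leaves their plain average.\<close>

lemma measure_outc:
  assumes R: "\<And>k i. k < M \<Longrightarrow> i < clen (el C k) \<Longrightarrow> prod_encode (k, i) < R"
    and Z: "\<And>k. k < M \<Longrightarrow> el Y k \<noteq> 0 \<Longrightarrow> el Y k * ctot (el C k) = Z"
    and ne: "J \<noteq> {}" "J = {k. k < M \<and> el Y k \<noteq> 0}" and A: "A \<in> sets borel"
  shows "measure (dirac_comb s (outc C Y M R)) A = (\<Sum>k\<in>J. measure (dirac_comb s (el C k)) A) / real (card J)"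
proof -
  have Z0: "0 < Z"
  proof -
    from ne obtain k where "k < M" "el Y k \<noteq> 0" by auto
    with Z[of k] ctot_pos[of "el C k"] show ?thesis by (metis mult_is_0 neq0_conv)
  qed
  have Zr: "real (el Y k) * real (ctot (el C k)) = real Z" if "k \<in> J" for k
    using Z[of k] that ne(2) by (metis (mono_tags, lifting) mem_Collect_eq of_nat_mult)
  have finJ: "finite J" using ne(2) by simp
  have inner: "(\<Sum>i<clen (el C k). real (el Y k * cw (el C k) i) * indicator B (s (cpos (el C k) i))) =
      (if k \<in> J then real Z * measure (dirac_comb s (el C k)) B else 0)" if "k < M" "B \<in> sets borel" for k B
  proof -
    have "(\<Sum>i<clen (el C k). real (el Y k * cw (el C k) i) * indicator B (s (cpos (el C k) i))) =
      real (el Y k) * (\<Sum>i<clen (el C k). real (cw (el C k) i) * indicator B (s (cpos (el C k) i)))"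
      by (simp only: sum_distrib_left of_nat_mult mult.assoc)
    also have "\<dots> = real (el Y k) * (real (ctot (el C k)) * measure (dirac_comb s (el C k)) B)"
      using ctot_pos[of "el C k"] by (simp add: measure_dirac_comb[OF that(2)])
    finally show ?thesis using Zr[of k] that ne(2) by (auto simp: mult.assoc[symmetric])
  qed
  have tot: "(\<Sum>r<R. real (outw C Y M r) * indicator B (s (cpos (el C (pi1 r)) (pi2 r)))) =
    real Z * (\<Sum>k\<in>J. measure (dirac_comb s (el C k)) B)" if "B \<in> sets borel" for B
  proof -
    have "(\<Sum>r<R. real (outw C Y M r) * indicator B (s (cpos (el C (pi1 r)) (pi2 r)))) =
      (\<Sum>k<M. \<Sum>i<clen (el C k). real (el Y k * cw (el C k) i) * indicator B (s (cpos (el C k) i)))"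
      by (rule sum_outw) (rule R)
    also have "\<dots> = (\<Sum>k<M. if k \<in> J then real Z * measure (dirac_comb s (el C k)) B else 0)"
      by (intro sum.cong refl inner that) simp
    also have "\<dots> = (\<Sum>k\<in>J. real Z * measure (dirac_comb s (el C k)) B)"
      using ne(2) by (subst sum.inter_restrict[symmetric]) (auto intro!: sum.cong)
    finally show ?thesis by (simp add: sum_distrib_left)
  qed
  have "real (\<Sum>r<R. outw C Y M r) = real Z * real (card J)"
  proof -
    have "measure (dirac_comb s (el C k)) UNIV = 1" for k
      using prob_space.prob_space[OF borel_probD(2)[OF dirac_comb_borel_prob]] borel_probD(3)[OF dirac_comb_borel_prob] by metis
    then show ?thesis using tot[of UNIV] by simp
  qed
  moreover have "0 < card J" using finJ ne(1) by (simp add: card_gt_0_iff)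
  ultimately have pos: "0 < (\<Sum>r<R. outw C Y M r)" and eq: "real (\<Sum>r<R. outw C Y M r) = real Z * real (card J)"
    using Z0 by (metis mult_pos_pos of_nat_0_less_iff)+
  show ?thesis unfolding outc_def measure_combcode[OF pos A] tot[OF A] eq using Z0 by simp
qed

text \<open>Dividing by the number of cells in use instead of all cells increases the mass of a set
  by at most the fraction of cells left out. This bounds the combination by \<open>K x n\<close>
  from one side, which is enough for the Prokhorov metric.\<close>

lemma outR_correct:
  assumes p: "\<delta>T p = Some x" and o: "outR p n m c"
  shows "prokhorov (dirac_comb s c) (K x n) \<le> (1/2) ^ m"
proof -
  obtain L R w l C Y Z where
    ce: "\<And>k. k < 2 ^ L \<Longrightarrow> el Y k \<noteq> 0 \<Longrightarrow> cell p L k (el w k) (el l k) n (el C k) \<and> el Y k * ctot (el C k) = Z"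
    and R: "\<And>k i. k < 2 ^ L \<Longrightarrow> i < clen (el C k) \<Longrightarrow> prod_encode (k, i) < R"
    and num: "2 ^ L * 2 ^ m \<le> (\<Sum>k<2 ^ L. if el Y k \<noteq> 0 then 1 else 0) * 2 ^ m + (2 ^ L :: nat)"
    and B0: "0 < (\<Sum>k<2 ^ L. if el Y k \<noteq> 0 then 1 else (0::nat))"
    and c: "c = outc C Y (2 ^ L) R"
    using o unfolding outR_def by blast
  define M :: nat where "M = 2 ^ L"
  define J where "J = {k. k < M \<and> el Y k \<noteq> 0}"
  have card: "(\<Sum>k<2 ^ L. if el Y k \<noteq> 0 then 1 else 0) = card J"
    unfolding J_def M_def by (subst card_eq_sum, subst sum.inter_filter[symmetric]) (auto intro!: sum.cong)
  have M: "0 < M" by (simp add: M_def)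
  have J0: "J \<noteq> {}" using B0 card by auto
  have B: "0 < real (card J)" using B0 card by simp
  have JM: "J \<subseteq> {..<M}" by (auto simp: J_def)
  have BM: "real (card J) \<le> real M" using card_mono[OF _ JM] by simp
  have "real (M * 2 ^ m) \<le> real (card J * 2 ^ m + M)" using num unfolding card M_def of_nat_le_iff .
  then have ratio: "1 - real (card J) / real M \<le> (1/2) ^ m"
    using M by (simp add: field_simps power_one_over)
  have "close ((1/2) ^ m) (dirac_comb s c) (K x n)"
  proof (rule close_measure[OF dirac_comb_borel_prob K_props(1)])
    fix A :: "'a set" assume A: "A \<in> sets borel"
    define S where "S = (\<Sum>k\<in>J. measure (dirac_comb s (el C k)) A)"
    have "measure (dirac_comb s c) A = S / real (card J)"
      unfolding c S_def M_def[symmetric]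
      by (rule measure_outc[OF _ _ J0 J_def A]) (use R ce in \<open>auto simp: M_def\<close>)
    also have "S / real (card J) = S / real M + (S / real (card J)) * (1 - real (card J) / real M)"
      using B M by (simp add: field_simps)
    also have "S / real M \<le> measure (K x n) A" unfolding S_def
    proof (rule cells_le_K[OF M JM _ A])
      fix k assume "k \<in> J"
      then have "cell p L k (el w k) (el l k) n (el C k)" using ce[of k] by (simp add: J_def M_def)
      then show "\<exists>w l. cell_pt x M k w l n (el C k)" unfolding cell_iff[OF p] M_def by blast
    qed
    also have "(S / real (card J)) * (1 - real (card J) / real M) \<le> 1 * (1 - real (card J) / real M)"
    proof (rule mult_right_mono)
      have "S \<le> (\<Sum>k\<in>J. 1)" unfolding S_def by (intro sum_mono measure_borel_prob_le_1 dirac_comb_borel_prob)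
      then show "S / real (card J) \<le> 1" using B by simp
      show "0 \<le> 1 - real (card J) / real M" using BM M by simp
    qed
    finally show "measure (dirac_comb s c) A \<le> measure (K x n) A + (1/2) ^ m" using ratio by simp
  qed simp
  then show ?thesis by (intro prokhorov_le dirac_comb_borel_prob K_props) auto
qed

lemma outR_exists:
  assumes p: "\<delta>T p = Some x" shows "\<exists>c. outR p n m c"
proof -
  have "0 < (1/2 :: real) ^ Suc m" by simp
  from many_cells[OF this, of x n] obtain L where
    L: "1 - (1/2) ^ Suc m < real (card {k. k < 2 ^ L \<and> (\<exists>w l c. cell_pt x (2 ^ L) k w l n c)}) / 2 ^ L" by blast
  define M :: nat where "M = 2 ^ L"
  define J where "J = {k. k < M \<and> (\<exists>w l c. cell_pt x M k w l n c)}"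
  have "\<forall>k\<in>J. \<exists>z. cell_pt x M k (fst z) (fst (snd z)) n (snd (snd z))" by (auto simp: J_def)
  then obtain g where g: "\<And>k. k \<in> J \<Longrightarrow> cell_pt x M k (fst (g k)) (fst (snd (g k))) n (snd (snd (g k)))" by metis
  have finJ: "finite J" by (simp add: J_def)
  obtain w where w: "\<forall>k<M. el w k = fst (g k)" using ex_el[of M "\<lambda>k. fst (g k)"] by blast
  obtain l where l: "\<forall>k<M. el l k = fst (snd (g k))" using ex_el[of M "\<lambda>k. fst (snd (g k))"] by blast
  obtain C where C: "\<forall>k<M. el C k = snd (snd (g k))" using ex_el[of M "\<lambda>k. snd (snd (g k))"] by blast
  \<comment> \<open>The product of all denominators is a common multiple; the factor for a cell is
    the product of the other denominators.\<close>
  define Z where "Z = (\<Prod>k\<in>J. ctot (el C k))"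
  obtain Y where Y: "\<forall>k<M. el Y k = (if k \<in> J then \<Prod>j\<in>J - {k}. ctot (el C j) else 0)"
    using ex_el[of M "\<lambda>k. if k \<in> J then \<Prod>j\<in>J - {k}. ctot (el C j) else 0"] by blast
  have Y0: "el Y k \<noteq> 0 \<longleftrightarrow> k \<in> J" if "k < M" for k
    using Y that ctot_pos finJ by (auto simp: prod_pos_nat_iff)
  have YZ: "el Y k * ctot (el C k) = Z" if "k \<in> J" for k
  proof -
    have "k < M" using that by (simp add: J_def)
    with Y that show ?thesis unfolding Z_def by (simp add: prod.remove[OF finJ that] mult.commute)
  qed
  have "finite (prod_encode ` (SIGMA k:{..<M}. {..<clen (el C k)}))" by auto
  then obtain R where R: "\<forall>z \<in> prod_encode ` (SIGMA k:{..<M}. {..<clen (el C k)}). z < R"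
    unfolding finite_nat_set_iff_bounded ..
  have card: "(\<Sum>k<M. if el Y k \<noteq> 0 then 1 else 0) = card J"
  proof -
    have "(\<Sum>k<M. if el Y k \<noteq> 0 then 1 else 0) = (\<Sum>k<M. if k \<in> J then 1 else (0::nat))"
      using Y0 by (intro sum.cong) auto
    also have "\<dots> = (\<Sum>k\<in>{..<M} \<inter> J. 1)" by (rule sum.inter_restrict[symmetric]) simp
    also have "{..<M} \<inter> J = J" by (auto simp: J_def)
    finally show ?thesis by simp
  qed
  have B: "1 - (1/2) ^ Suc m < real (card J) / real M" using L by (simp add: J_def M_def)
  have Mp: "0 < real M" by (simp add: M_def)
  have "(1/2 :: real) ^ Suc m < 1" by (rule power_Suc_less_one) auto
  then have "0 < real (card J) / real M" using B by linarith
  then have pos: "0 < card J" using Mp by (simp add: zero_less_divide_iff)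
  have "(1/2 :: real) ^ Suc m \<le> (1/2) ^ m" by simp
  with B have "1 - (1/2) ^ m \<le> real (card J) / real M" by linarith
  then have "real M * 2 ^ m \<le> real (card J) * 2 ^ m + real M" using Mp by (simp add: field_simps power_one_over)
  then have "real (M * 2 ^ m) \<le> real (card J * 2 ^ m + M)" by simp
  then have num: "M * 2 ^ m \<le> card J * 2 ^ m + M" by (simp only: of_nat_le_iff)
  have ce: "cell p L k (el w k) (el l k) n (el C k) \<and> el Y k * ctot (el C k) = Z" if "k < M" "el Y k \<noteq> 0" for k
    using g[of k] YZ[of k] Y0[OF that(1)] that w l C unfolding cell_iff[OF p] M_def by simp
  have "outR p n m (outc C Y M R)" unfolding outR_def
  proof (intro exI conjI)
    show "\<forall>k<2 ^ L. el Y k \<noteq> 0 \<longrightarrow> cell p L k (el w k) (el l k) n (el C k) \<and> el Y k * ctot (el C k) = Z"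
      using ce unfolding M_def by blast
    show "\<forall>k<2 ^ L. \<forall>i<clen (el C k). prod_encode (k, i) < R" using R by (auto simp: M_def)
    show "2 ^ L * 2 ^ m \<le> (\<Sum>k<2 ^ L. if el Y k \<noteq> 0 then 1 else 0) * 2 ^ m + (2 ^ L :: nat)"
      using num unfolding card[symmetric] M_def .
    show "0 < (\<Sum>k<2 ^ L. if el Y k \<noteq> 0 then 1 else (0::nat))" using pos unfolding card[symmetric] M_def .
    show "outc C Y M R = outc C Y (2 ^ L) R" by (simp add: M_def)
  qed
  then show ?thesis ..
qed

lemma sig_outR: "sig (\<lambda>o' z. \<exists>n. o' (2 * n + 1) = 1 \<and> outR (\<lambda>i. o' (2 * i)) n (pi1 z) (pi2 z))"
  unfolding outR_def outc_def outw_def by (intro cintros)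

text \<open>A name of the function \<open>K x\<close> is the number of a program followed by a
  parameter, and the name \<open>p\<close> of \<open>x\<close> can serve as this parameter. The
  realizer merely prefixes \<open>p\<close>; the work is done by the program \<open>e\<close> once
  it is given \<open>n\<close>. Other names lead to other approximations, but of the same measure
  \<open>K x n\<close>.\<close>

lemma K_computable: "rep_computable \<delta>T (rep_fun rep_nat (rep_prob s)) (\<lambda>x. {K x})"
proof -
  obtain e where e: "\<And>o' x y. (\<exists>n. o' (2 * n + 1) = 1 \<and> outR (\<lambda>i. o' (2 * i)) n x y) \<Longrightarrow>
    \<exists>y'. eval o' e x y' \<and> (\<exists>n. o' (2 * n + 1) = 1 \<and> outR (\<lambda>i. o' (2 * i)) n x y')"
    using sig_search[OF sig_outR] unfolding pi_simps by blast
  have run_e: "\<exists>r. phi e (pair_seq p (tag n (\<lambda>_. 0))) = Some r \<and> rep_prob s r = Some (K x n)"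
    if p: "\<delta>T p = Some x" for p x n
  proof -
    let ?o = "pair_seq p (tag n (\<lambda>_. 0))"
    have o: "(\<exists>k. ?o (2 * k + 1) = 1 \<and> outR (\<lambda>i. ?o (2 * i)) k m c) \<longleftrightarrow> outR p n m c" for m c
      by (auto simp: pair_seq_def tag_def split: if_splits)
    have "\<forall>m. \<exists>c. eval ?o e m c \<and> outR p n m c" using e[of ?o] outR_exists[OF p, of n] unfolding o by blast
    then obtain r where r: "\<And>m. eval ?o e m (r m)" "\<And>m. outR p n m (r m)" by metis
    have "rep_prob s r = Some (K x n)" by (rule rep_prob_Some[OF K_props(1) outR_correct[OF p r(2)]])
    with r(1) show ?thesis by (auto simp: phi_eq_Some)
  qed
  have "tot (\<lambda>p i. if i < prog_code e then 0 else if i = prog_code e then 1 else p (i - Suc (prog_code e)))"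
    by (intro cintros)
  then obtain e' where e': "\<And>p i. eval p e' i (tag (prog_code e) p i)" unfolding tot_def tag_def by blast
  then have phi_e': "phi e' p = Some (tag (prog_code e) p)" for p by (simp add: phi_eq_Some)
  have "realizes \<delta>T (rep_fun rep_nat (rep_prob s)) (phi e') (\<lambda>x. {K x})"
    unfolding realizes_def
  proof (intro allI impI)
    fix p x assume "\<delta>T p = Some x \<and> {K x} \<noteq> {}"
    then have p: "\<delta>T p = Some x" by simp
    have "rep_fun rep_nat (rep_prob s) (tag (prog_code e) p) = Some (K x)"
    proof (rule rep_fun_tag)
      show "K x \<in> ran rep_nat \<rightarrow>\<^sub>E ran (rep_prob s)"
        unfolding ran_rep_nat using run_e[OF p] by (auto simp: ran_def)
      show "\<exists>r. phi e (pair_seq p q) = Some r \<and> rep_prob s r = Some (K x n)" if "rep_nat q = Some n" for q n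
        using run_e[OF p, of n] rep_nat_SomeD[OF that] by simp
    qed
    with phi_e' show "\<exists>q y. phi e' p = Some q \<and> rep_fun rep_nat (rep_prob s) q = Some y \<and> y \<in> {K x}" by auto
  qed
  then show ?thesis unfolding rep_computable_def computable_def by (meson map_le_refl)
qed

text \<open>Besides convergence, \<open>lim_map\<close> demands that the measures have names. The
  certified combinations approximate each \<open>K x n\<close>, and thereby also the limit
  \<open>D\<close>.\<close>

lemma Dstar_eq_lim: "Dstar \<mu> V x = lim_map prokhorov (rep_prob s) (K x)"
proof -
  obtain D where D: "D \<in> borel_prob" "Dstar \<mu> V x = {D}" "\<And>e. 0 < e \<Longrightarrow> \<forall>\<^sub>F n in sequentially. close (2 * e) D (K x n)"
    using K_converges[of x] by blast
  have lim: "(\<lambda>n. prokhorov (K x n) D) \<longlonglongrightarrow> 0"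
  proof (rule tendstoI)
    fix e :: real assume e: "0 < e"
    then have "\<forall>\<^sub>F n in sequentially. close (2 * (e / 4)) D (K x n)" by (intro D(3)) simp
    then show "\<forall>\<^sub>F n in sequentially. dist (prokhorov (K x n) D) 0 < e"
    proof eventually_elim
      case (elim n)
      then have "prokhorov D (K x n) \<le> 2 * (e / 4)" using e by (intro prokhorov_le D K_props) auto
      then show ?case
        using prokhorov_nonneg[OF K_props(1) D(1), of x n] prokhorov_sym[OF K_props(1) D(1), of x n] e by simp
    qed
  qed
  obtain p where p: "\<delta>T p = Some x" using ex_name by blast
  have approx: "\<exists>c. prokhorov (dirac_comb s c) (K x n) \<le> (1/2) ^ m" for n m
    using outR_exists[OF p] outR_correct[OF p] by blast
  have ranK: "K x n \<in> ran (rep_prob s)" for n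
  proof -
    obtain r where "\<And>m. prokhorov (dirac_comb s (r m)) (K x n) \<le> (1/2) ^ m" using approx[of n] by metis
    from rep_prob_Some[OF K_props(1) this] show ?thesis by (auto simp: ran_def)
  qed
  have "\<exists>c. prokhorov (dirac_comb s c) D \<le> (1/2) ^ m" for m
  proof -
    have "\<forall>\<^sub>F n in sequentially. prokhorov (K x n) D < (1/2) ^ Suc m" by (rule order_tendstoD(2)[OF lim]) simp
    then obtain n where n: "prokhorov (K x n) D < (1/2) ^ Suc m"
      using eventually_happens'[OF sequentially_bot] by blast
    obtain c where "prokhorov (dirac_comb s c) (K x n) \<le> (1/2) ^ Suc m" using approx by blast
    with n prokhorov_triangle[OF dirac_comb_borel_prob K_props(1) D(1), of s c x n] show ?thesis
      by (intro exI[of _ c]) simp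
  qed
  then obtain r where "\<And>m. prokhorov (dirac_comb s (r m)) D \<le> (1/2) ^ m" by metis
  from rep_prob_Some[OF D(1) this] have ranD: "D \<in> ran (rep_prob s)" by (auto simp: ran_def)
  have "lim_map prokhorov (rep_prob s) (K x) = {D}"
  proof (intro equalityI subsetI)
    fix y assume "y \<in> lim_map prokhorov (rep_prob s) (K x)"
    then have y: "y \<in> borel_prob" "(\<lambda>n. prokhorov (K x n) y) \<longlonglongrightarrow> 0"
      by (auto simp: lim_map_def ran_def dest: rep_prob_SomeD(1))
    have "prokhorov y D \<le> prokhorov (K x n) y + prokhorov (K x n) D" for n
      using prokhorov_triangle[OF y(1) K_props(1) D(1), of x n] prokhorov_sym[OF K_props(1) y(1), of x n] by simp
    then have "prokhorov y D \<le> 0 + 0" by (intro LIMSEQ_le_const[OF tendsto_add[OF y(2) lim]]) auto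
    then show "y \<in> {D}" using prokhorov_le_0_imp_eq[OF y(1) D(1)] by simp
  qed (use lim ranD ranK in \<open>auto simp: lim_map_def\<close>)
  with D(2) show ?thesis by simp
qed

end

theorem proposition5p6:
  fixes \<delta>S :: "'a::polish_space rep" and s :: "nat \<Rightarrow> 'a"
    and \<delta>T :: "'b::polish_space rep" and t :: "nat \<Rightarrow> 'b"
    and \<mu> :: "('a \<times> 'b) measure" and V :: "'b set set"
  assumes "computable_metric_space \<delta>S s"
    and "computable_metric_space \<delta>T t"
    and "\<mu> \<in> borel_prob"
    and "computable_point (rep_prob (prod_dense_seq s t)) \<mu>"
    and "V \<subseteq> sets borel"
    and "\<forall>E\<in>V. continuity_set (marginal \<mu>) E"
    and "strong_vitali_covering_property \<delta>T t (marginal \<mu>) V"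
    and "Dstar_total \<mu> V"
  shows "(\<exists>K :: 'b \<Rightarrow> nat \<Rightarrow> 'a measure.
            rep_computable \<delta>T (rep_fun rep_nat (rep_prob s)) (\<lambda>x. {K x}) \<and>
            (\<forall>x. Dstar \<mu> V x = lim_map prokhorov (rep_prob s) (K x))) \<and>
         sW_reducible \<delta>T (rep_prob s) (Dstar \<mu> V)
           (rep_fun rep_nat (rep_prob s)) (rep_prob s) (lim_map prokhorov (rep_prob s))"
proof -
  interpret comp_metric \<delta>T t by (rule comp_metric.intro) (rule assms(2))
  interpret dstar_setting \<delta>T t s \<mu> V by unfold_locales (use assms in auto)
  obtain F where F: "computable F" "realizes \<delta>T (rep_fun rep_nat (rep_prob s)) F (\<lambda>x. {K x})"
    using K_computable unfolding rep_computable_def by blast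
  \<comment> \<open>The outer map of the reduction is the identity, computed by the program
    \<open>Oracle\<close>; the inner one is a realizer of \<open>K\<close>.\<close>
  have id: "computable Some"
  proof -
    have "phi Oracle p = Some p" for p by (auto simp: phi_eq_Some intro: eval.intros)
    then show ?thesis unfolding computable_def by (metis map_le_def)
  qed
  have "realizes \<delta>T (rep_prob s) (Some \<circ>\<^sub>m G \<circ>\<^sub>m F) (Dstar \<mu> V)"
    if G: "realizes (rep_fun rep_nat (rep_prob s)) (rep_prob s) G (lim_map prokhorov (rep_prob s))" for G
    unfolding realizes_def
  proof (intro allI impI)
    fix p x assume p: "\<delta>T p = Some x \<and> Dstar \<mu> V x \<noteq> {}"
    then obtain q where q: "F p = Some q" "rep_fun rep_nat (rep_prob s) q = Some (K x)"
      using F(2)[unfolded realizes_def, rule_format, of p x] by auto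
    moreover have "lim_map prokhorov (rep_prob s) (K x) \<noteq> {}" using p Dstar_eq_lim[of x] by simp
    ultimately obtain r y where "G q = Some r" "rep_prob s r = Some y" "y \<in> Dstar \<mu> V x"
      using G[unfolded realizes_def, rule_format, of q "K x"] Dstar_eq_lim[of x] by auto
    with q(1) show "\<exists>q y. (Some \<circ>\<^sub>m G \<circ>\<^sub>m F) p = Some q \<and> rep_prob s q = Some y \<and> y \<in> Dstar \<mu> V x"
      by (auto simp: map_comp_def)
  qed
  with F(1) id have "sW_reducible \<delta>T (rep_prob s) (Dstar \<mu> V)
           (rep_fun rep_nat (rep_prob s)) (rep_prob s) (lim_map prokhorov (rep_prob s))"
    unfolding sW_reducible_def by blast
  then show ?thesis using K_computable Dstar_eq_lim by blast
qed

end
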